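(* Let $\mathcal T_n$ be a conditioned Galton--Watson tree of order $n$ with offspring distribution $\xi$, where $\mathbb E\xi=1$ and $0<\sigma^2:=\operatorname{Var}\xi<\infty$, and let $\mathcal T$ be the corresponding unconditioned Galton--Watson tree. The subtree counts $n_T(\mathcal T_n)$, $T\in\mathfrak T$, are asymptotically jointly normal. More precisely, let $\pi_T:=\mathbb P(\mathcal T=T)$, $$\gamma_{T,T}:=\pi_T-\bigl(2|T|-1+\sigma^{-2}\bigr)\pi_T^2,$$ and, for $T_1\ne T_2$, $$\gamma_{T_1,T_2}:=n_{T_2}(T_1)\pi_{T_1}+n_{T_1}(T_2)\pi_{T_2}-\bigl(|T_1|+|T_2|-1+\sigma^{-2}\bigr)\pi_{T_1}\pi_{T_2}.$$ Then, for any trees $T,T_1,T_2\in\mathfrak T$, as $n\to\infty$, $$\mathbb E\,n_T(\mathcal T_n)=n\pi_T+o(\sqrt n),$$ $$\operatorname{Var}n_T(\mathcal T_n)=n\gamma_{T,T}+o(n),$$ $$\operatorname{Cov}\bigl(n_{T_1}(\mathcal T_n),n_{T_2}(\mathcal T_n)\bigr)=n\gamma_{T_1,T_2}+o(n),$$ $$\frac{n_T(\mathcal T_n)-n\pi_T}{\sqrt n}\overset{d}{\longrightarrow}Z_T,$$ the latter jointly for all $T\in\mathfrak T$, where the $Z_T$ are jointly normal with mean $\mathbb E Z_T=0$ and covariances $\operatorname{Cov}(Z_{T_1},Z_{T_2})=\gamma_{T_1,T_2}$.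
   Context: All trees are finite, rooted and ordered (plane). $\mathfrak T$ is the countable set of all such trees (up to isomorphism preserving the root and the orderings of children), and $|T|$ is the number of nodes of $T$. For a node $v$ of $T$, $T_v$ denotes the fringe subtree of $T$ consisting of $v$ and all its descendants. For $T,T'\in\mathfrak T$, $n_{T'}(T):=|\{v\in T:T_v=T'\}|$ is the number of fringe subtrees of $T$ equal (isomorphic) to $T'$. Given a nonnegative integer-valued random variable $\xi$, the Galton--Watson tree $\mathcal T$ with offspring distribution $\xi$ is the random tree obtained by starting with a root and giving each node a number of children that is an independent copy of $\xi$ (with $\mathbb E\xi=1$ and $\operatorname{Var}\xi>0$ it is a.s. finite). The conditioned Galton--Watson tree $\mathcal T_n$ is $\mathcal T$ conditioned on $|\mathcal T|=n$; only $n$ with $\mathbb P(|\mathcal T|=n)>0$ are considered, so limits as $n\to\infty$ are along such $n$. Joint convergence for all $T\in\mathfrak T$ means joint convergence in distribution for every finite set of trees $T$. Degenerate normal distributions are allowed. *)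

theory Defs
  imports "HOL-Probability.Probability"
begin

datatype plane_tree = Node "plane_tree list"

text \<open>
  Nodes are addressed in the Ulam--Harris way: \<^term>\<open>[]\<close> is the root and \<^term>\<open>v @ [i]\<close>
  is the \<open>i\<close>-th child (counting from 0) of \<open>v\<close>.
\<close>

function nodes :: "plane_tree \<Rightarrow> nat list set" where
  "nodes (Node ts) = insert [] (\<Union>i\<in>{..<length ts}. (#) i ` nodes (ts ! i))"
  by pat_completeness auto
termination
  by (relation "Wellfounded.measure size") (auto simp: less_Suc_eq_le intro!: size_list_estimation')

fun fringe_subtree :: "plane_tree \<Rightarrow> nat list \<Rightarrow> plane_tree" where
  "fringe_subtree t [] = t"
| "fringe_subtree (Node ts) (i # v) = fringe_subtree (ts ! i) v"

definition tree_order :: "plane_tree \<Rightarrow> nat" where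
  "tree_order T = card (nodes T)"

definition subtree_count :: "plane_tree \<Rightarrow> plane_tree \<Rightarrow> nat" where
  "subtree_count T' T = card {v \<in> nodes T. fringe_subtree T v = T'}"

text \<open>
  In a Galton--Watson process every potential node \<open>v\<close> carries an independent copy \<open>c v\<close> of
  the offspring variable; the nodes actually born are those in \<open>gw_nodes c\<close>.
\<close>

inductive_set gw_nodes :: "(nat list \<Rightarrow> nat) \<Rightarrow> nat list set" for c where
  root: "[] \<in> gw_nodes c"
| child: "v \<in> gw_nodes c \<Longrightarrow> i < c v \<Longrightarrow> v @ [i] \<in> gw_nodes c"

text \<open>The value \<^term>\<open>None\<close> stands for an infinite family tree.\<close>

definition gw_tree :: "(nat list \<Rightarrow> nat) \<Rightarrow> plane_tree option" where
  "gw_tree c = (if finite (gw_nodes c) then Some (THE T. nodes T = gw_nodes c) else None)"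

definition gw_law :: "nat pmf \<Rightarrow> plane_tree option measure" where
  "gw_law p = distr (\<Pi>\<^sub>M v\<in>UNIV. measure_pmf p) (count_space UNIV) gw_tree"

definition tree_prob :: "nat pmf \<Rightarrow> plane_tree \<Rightarrow> real" where
  "tree_prob p T = measure (gw_law p) {Some T}"

definition order_event :: "nat \<Rightarrow> plane_tree option set" where
  "order_event n = Some ` {T. tree_order T = n}"

text \<open>The law of the Galton--Watson tree conditioned to have \<open>n\<close> nodes.\<close>

definition cond_gw_law :: "nat pmf \<Rightarrow> nat \<Rightarrow> plane_tree measure" where
  "cond_gw_law p n = distr (uniform_measure (gw_law p) (order_event n)) (count_space UNIV) the"

text \<open>The filter \<open>n \<rightarrow> \<infinity>\<close> along those \<open>n\<close> for which the conditioning makes sense.\<close>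

definition admissible_at_top :: "nat pmf \<Rightarrow> nat filter" where
  "admissible_at_top p = inf at_top (principal {n. measure (gw_law p) (order_event n) > 0})"

definition covariance :: "'a measure \<Rightarrow> ('a \<Rightarrow> real) \<Rightarrow> ('a \<Rightarrow> real) \<Rightarrow> real" where
  "covariance M X Y =
     (\<integral>x. (X x - integral\<^sup>L M X) * (Y x - integral\<^sup>L M Y) \<partial>M)"

definition subtree_cov :: "nat pmf \<Rightarrow> plane_tree \<Rightarrow> plane_tree \<Rightarrow> real" where
  "subtree_cov p T1 T2 =
     (if T1 = T2
      then tree_prob p T1
             - (2 * real (tree_order T1) - 1 + inverse (measure_pmf.variance p real))
               * (tree_prob p T1)\<^sup>2
      else real (subtree_count T2 T1) * tree_prob p T1
             + real (subtree_count T1 T2) * tree_prob p T2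
             - (real (tree_order T1) + real (tree_order T2) - 1
                  + inverse (measure_pmf.variance p real))
               * tree_prob p T1 * tree_prob p T2)"

text \<open>Point masses count as (degenerate) normal distributions.\<close>

definition normal_variable :: "'a measure \<Rightarrow> ('a \<Rightarrow> real) \<Rightarrow> bool" where
  "normal_variable M X \<longleftrightarrow> X \<in> borel_measurable M \<and>
     ((\<exists>\<mu>. AE x in M. X x = \<mu>) \<or>
      (\<exists>\<mu> \<sigma>. \<sigma> > 0 \<and> distributed M lborel X (normal_density \<mu> \<sigma>)))"

definition jointly_normal :: "'a measure \<Rightarrow> ('i \<Rightarrow> 'a \<Rightarrow> real) \<Rightarrow> bool" where
  "jointly_normal M Z \<longleftrightarrow>
     (\<forall>S a. finite S \<longrightarrow> normal_variable M (\<lambda>x. \<Sum>i\<in>S. a i * Z i x))"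

text \<open>
  Joint convergence in distribution \<open>(X n i)\<^sub>i \<rightarrow> (Z i)\<^sub>i\<close> of families of real random
  variables, i.e. weak convergence of all finite-dimensional marginals. The \<open>X n i\<close> live on
  \<open>M n\<close>, the \<open>Z i\<close> on \<open>N\<close>.
\<close>

definition joint_conv_in_distr ::
  "(nat \<Rightarrow> 'a measure) \<Rightarrow> (nat \<Rightarrow> 'i \<Rightarrow> 'a \<Rightarrow> real) \<Rightarrow> 'b measure \<Rightarrow> ('i \<Rightarrow> 'b \<Rightarrow> real)
     \<Rightarrow> nat filter \<Rightarrow> bool" where
  "joint_conv_in_distr M X N Z F \<longleftrightarrow>
     (\<forall>S f. finite S
        \<and> continuous_map (product_topology (\<lambda>_. euclideanreal) S) euclideanreal f
        \<and> bounded (f ` topspace (product_topology (\<lambda>_. euclideanreal) S))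
        \<longrightarrow> ((\<lambda>n. \<integral>x. f (\<lambda>i\<in>S. X n i x) \<partial>M n) \<longlongrightarrow> (\<integral>y. f (\<lambda>i\<in>S. Z i y) \<partial>N)) F)"

end

theory Submission imports "HOL-Library.Sublist" Defs begin

text \<open>
  Depth-first search encodes a tree by its degree sequence, and a fringe subtree equal to \<open>T\<close> is an
  occurrence of the degree sequence of \<open>T\<close> as a factor. By the cycle lemma, the degree sequence of the
  conditioned tree of order \<open>n\<close> is the unique good rotation of an i.i.d. sequence conditioned on having
  sum \<open>n - 1\<close> (a bridge), so the subtree counts become cyclic pattern counts in a bridge, and these
  do not depend on the rotation.

  For the pattern counts, cut the bridge into blocks of length \<open>K\<close> and keep the windows inside the
  first \<open>K - 1\<close> letters of each block. The characteristic function of the block sum under the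
  conditioning is a Fourier integral; it converges to a Gaussian by dominated convergence. The
  lost windows contribute \<open>O(sqrt (n / K))\<close> in mean: each half of the bridge has a law whose density
  with respect to the i.i.d. law is bounded, so i.i.d. moment bounds carry over. Letting \<open>K\<close> tend to
  infinity gives the limit of the characteristic functions of all linear combinations, and uniform
  fourth moment bounds give the convergence of the first two moments. A Gaussian family with the
  limiting covariances is built by a Cholesky recursion from independent normal variables, and
  joint convergence follows by approximating bounded continuous functions by trigonometric polynomials.
\<close>

section \<open>Degree sequences and the cycle lemma\<close>

text \<open>A bridge has probability of order 1/sqrt n, so the unconditioned central limit theorem
  says nothing about it; this is why the joint characteristic function of block sum and walk is
  integrated over the variable dual to the walk. Conditioning then acts like regression on the walk:
  it subtracts the squared covariance with the walk, divided by the variance of the walk. An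
  occurrence of a degree sequence moves the walk with steps \<open>x - 1\<close> by exactly -1,
  whatever the tree, and this is the origin of the term with
  \<open>inverse (measure_pmf.variance p real)\<close>. The other terms of
  \<open>subtree_cov\<close> are exact i.i.d. covariances: degree sequences form a prefix code, so
  two occurrences are nested or disjoint. The steps live on a lattice whose span is the gcd of the
  support, since 0 is always a possible offspring number. The density of a whole bridge against the
  i.i.d. law is of order sqrt n; only for a proper fraction of the bridge it stays bounded, hence
  the two halves. Fourth moments are controlled because the limits of the second moments must be
  identified, which takes uniform integrability of the squares.\<close>

fun degree_seq :: "plane_tree \<Rightarrow> nat list" where
  "degree_seq (Node ts) = length ts # concat (map degree_seq ts)"

declare degree_seq.simps [simp del]

lemma degree_seq_neq_Nil [simp]: "degree_seq T \<noteq> []"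
  by (cases T) (simp add: degree_seq.simps)

text \<open>The first letter announces how many codewords follow, so a reader always knows where a
  codeword ends. The tails are arbitrary in the induction because, for a child, the codes of its
  later siblings belong to the tail.\<close>

lemma degree_seq_prefix_free:
  "degree_seq T @ xs = degree_seq T' @ ys \<Longrightarrow> T = T' \<and> xs = ys"
proof (induction T arbitrary: T' xs ys)
  case (Node ts)
  obtain ts' where T': "T' = Node ts'" by (cases T')
  have "length ts = length ts'"
    and "concat (map degree_seq ts) @ xs = concat (map degree_seq ts') @ ys"
    using Node.prems by (auto simp: T' degree_seq.simps)
  then have "ts = ts' \<and> xs = ys" using Node.IH
  proof (induction ts ts' rule: list_induct2)
    case (Cons t ts t' ts')
    have "t = t' \<and> concat (map degree_seq ts) @ xs = concat (map degree_seq ts') @ ys"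
      using Cons.prems(1) by (intro Cons.prems(2)) auto
    moreover have "ts = ts' \<and> xs = ys"
      by (rule Cons.IH) (use calculation Cons.prems(2) in auto)
    ultimately show ?case by simp
  qed simp
  then show ?case by (simp add: T')
qed

lemma degree_seq_inject: "degree_seq T = degree_seq T' \<longleftrightarrow> T = T'"
  using degree_seq_prefix_free[of T "[]" T' "[]"] by auto

lemma prefix_degree_seq_append [simp]:
  "prefix (degree_seq T') (degree_seq T @ xs) \<longleftrightarrow> T' = T"
proof
  assume "prefix (degree_seq T') (degree_seq T @ xs)"
  then obtain zs where "degree_seq T @ xs = degree_seq T' @ zs" by (auto elim: prefixE)
  from degree_seq_prefix_free[OF this] show "T' = T" by simp
qed simp

lemma prefix_degree_seq [simp]: "prefix (degree_seq T') (degree_seq T) \<longleftrightarrow> T' = T"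
  using prefix_degree_seq_append[of T' T "[]"] by simp

lemma finite_nodes [simp]: "finite (nodes T)"
  by (induction T rule: nodes.induct) auto

lemma subtree_count_Node:
  "subtree_count T' (Node ts) = of_bool (T' = Node ts) + (\<Sum>t\<leftarrow>ts. subtree_count T' t)"
proof -
  define A where "A i = (#) i ` {v \<in> nodes (ts ! i). fringe_subtree (ts ! i) v = T'}" for i
  have fA: "finite (A i)" for i by (auto simp: A_def)
  have eq: "{v \<in> nodes (Node ts). fringe_subtree (Node ts) v = T'}
     = (if T' = Node ts then {[]} else {}) \<union> (\<Union>i<length ts. A i)"
    by (auto simp: A_def)
  have "subtree_count T' (Node ts) = card (if T' = Node ts then {[] :: nat list} else {}) + card (\<Union>i<length ts. A i)"
    unfolding subtree_count_def eq by (rule card_Un_disjoint) (auto simp: fA, auto simp: A_def)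
  also have "card (\<Union>i<length ts. A i) = (\<Sum>i<length ts. card (A i))"
    by (intro card_UN_disjoint) (auto simp: fA, auto simp: A_def)
  also have "\<dots> = (\<Sum>i<length ts. subtree_count T' (ts ! i))"
    by (intro sum.cong) (auto simp: A_def subtree_count_def card_image)
  also have "\<dots> = (\<Sum>t\<leftarrow>ts. subtree_count T' t)"
    by (simp add: sum_list_sum_nth atLeast0LessThan)
  finally show ?thesis by simp
qed

lemma tree_order_Node: "tree_order (Node ts) = 1 + (\<Sum>t\<leftarrow>ts. tree_order t)"
proof -
  define A where "A i = (#) i ` nodes (ts ! i)" for i
  have fA: "finite (A i)" for i by (auto simp: A_def)
  have "tree_order (Node ts) = card {[] :: nat list} + card (\<Union>i<length ts. A i)"
    unfolding tree_order_def nodes.simps A_def[symmetric]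
    by (subst card_Un_disjoint[symmetric]) (auto simp: fA, auto simp: A_def)
  also have "card (\<Union>i<length ts. A i) = (\<Sum>i<length ts. card (A i))"
    by (intro card_UN_disjoint) (auto simp: fA, auto simp: A_def)
  also have "\<dots> = (\<Sum>i<length ts. tree_order (ts ! i))"
    by (intro sum.cong) (auto simp: A_def tree_order_def card_image)
  also have "\<dots> = (\<Sum>t\<leftarrow>ts. tree_order t)"
    by (simp add: sum_list_sum_nth atLeast0LessThan)
  finally show ?thesis by simp
qed

lemma length_degree_seq [simp]: "length (degree_seq T) = tree_order T"
proof (induction T)
  case (Node ts)
  have "map (length \<circ> degree_seq) ts = map tree_order ts" using Node by simp
  then show ?case by (simp add: degree_seq.simps tree_order_Node length_concat del: map_eq_conv)
qed

lemma tree_order_pos [simp]: "tree_order T > 0"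
  by (cases T) (simp add: tree_order_Node)

text \<open>Every node except the root is counted once, as a child of its parent. Hence the walk
  with steps \<open>x - 1\<close> ends at -1.\<close>

lemma sum_degree_seq: "sum_list (degree_seq T) + 1 = tree_order T"
proof (induction T)
  case (Node ts)
  have "(\<Sum>t\<leftarrow>ts. sum_list (degree_seq t)) + length ts = (\<Sum>t\<leftarrow>ts. tree_order t)"
    using Node by (induction ts) force+
  moreover have "sum_list (concat (map degree_seq ts)) = (\<Sum>t\<leftarrow>ts. sum_list (degree_seq t))"
    by (induction ts) auto
  ultimately show ?case by (simp add: degree_seq.simps tree_order_Node)
qed

definition occ :: "'a list \<Rightarrow> 'a list \<Rightarrow> nat" where
  "occ e xs = card {i. i < length xs \<and> prefix e (drop i xs)}"

lemma occ_Nil [simp]: "occ e [] = 0"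
  by (simp add: occ_def)

lemma occ_Cons: "occ e (x # xs) = of_bool (prefix e (x # xs)) + occ e xs"
proof -
  have "{i. i < length (x # xs) \<and> prefix e (drop i (x # xs))} =
     (if prefix e (x # xs) then {0} else {}) \<union> Suc ` {i. i < length xs \<and> prefix e (drop i xs)}"
    (is "?L = ?R")
  proof (intro set_eqI)
    fix i show "i \<in> ?L \<longleftrightarrow> i \<in> ?R" by (cases i) auto
  qed
  then have "occ e (x # xs) = card (if prefix e (x # xs) then {0::nat} else {}) +
     card (Suc ` {i. i < length xs \<and> prefix e (drop i xs)})"
    unfolding occ_def by (simp only:) (rule card_Un_disjoint, auto)
  then show ?thesis by (simp add: occ_def card_image)
qed

text \<open>An occurrence that starts inside \<open>degree_seq T\<close> cannot run over into
  \<open>xs\<close>: the codeword of a fringe subtree starts at that position, and prefix-freeness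
  admits no other one. This exact additivity is what later gives the i.i.d. covariances in closed
  form.\<close>

lemma occ_degree_seq_append:
  "occ (degree_seq T') (degree_seq T @ xs) = subtree_count T' T + occ (degree_seq T') xs"
proof (induction T arbitrary: xs)
  case (Node ts)
  have "occ (degree_seq T') (concat (map degree_seq ts) @ xs)
      = (\<Sum>t\<leftarrow>ts. subtree_count T' t) + occ (degree_seq T') xs"
    using Node by (induction ts) (simp_all)
  moreover have "prefix (degree_seq T') (length ts # concat (map degree_seq ts) @ xs) \<longleftrightarrow> T' = Node ts"
    using prefix_degree_seq_append[of T' "Node ts" xs] by (simp add: degree_seq.simps)
  ultimately show ?case
    by (simp add: degree_seq.simps(1)[of ts] occ_Cons subtree_count_Node del: prefix_degree_seq_append)
qed

lemma occ_degree_seq: "occ (degree_seq T') (degree_seq T) = subtree_count T' T"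
  using occ_degree_seq_append[of T' T "[]"] by simp

text \<open>The witness is the fringe subtree at the node that the depth-first search visits at time
  \<open>i\<close>.\<close>

lemma degree_seq_drop_prefix:
  "i < tree_order T \<Longrightarrow> \<exists>u. prefix (degree_seq u) (drop i (degree_seq T))"
proof (induction T arbitrary: i)
  case (Node ts)
  show ?case
  proof (cases i)
    case 0 then show ?thesis by (intro exI[of _ "Node ts"]) simp
  next
    case (Suc j)
    have "j < length (concat (map degree_seq ts))"
      using Node.prems Suc length_degree_seq[of "Node ts"] by (simp add: degree_seq.simps)
    then have "\<exists>u. prefix (degree_seq u) (drop j (concat (map degree_seq ts)))"
      using Node.IH
    proof (induction ts arbitrary: j)
      case (Cons t ts)
      show ?case
      proof (cases "j < tree_order t")
        case True
        then obtain u where "prefix (degree_seq u) (drop j (degree_seq t))" using Cons.prems(2) by auto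
        then show ?thesis using True by (auto intro!: exI[of _ u] prefix_prefix)
      next
        case False
        have "\<exists>u. prefix (degree_seq u) (drop (j - tree_order t) (concat (map degree_seq ts)))"
          using Cons.prems False by (intro Cons.IH) auto
        then show ?thesis using False by simp
      qed
    qed simp
    then show ?thesis by (simp add: Suc degree_seq.simps)
  qed
qed

section \<open>First passages of the walk and rotations\<close>

text \<open>The walk with steps \<open>x - 1\<close> read off \<open>xs\<close> hits \<open>-m\<close> for the first time at its end.\<close>

definition first_passage :: "nat \<Rightarrow> nat list \<Rightarrow> bool" where
  "first_passage m xs \<longleftrightarrow>
     (\<forall>j<length xs. j < sum_list (take j xs) + m) \<and> sum_list xs + m = length xs"

text \<open>Read the parameter as the number of trees still to be decoded: the letter
  \<open>x\<close> closes one of them and opens \<open>x\<close> new ones.\<close>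

lemma first_passage_Cons:
  "first_passage (Suc m) (x # xs) \<longleftrightarrow> first_passage (m + x) xs"
  by (auto simp: first_passage_def less_Suc_eq_0_disj all_conj_distrib) 

lemma first_passage_0: "first_passage 0 xs \<longleftrightarrow> xs = []"
  by (cases xs) (auto simp: first_passage_def)

text \<open>A passage to -m splits at the first visits to -1, -2, ..., one codeword for each. The
  induction on the word regroups a forest: the first letter \<open>x\<close> turns the first
  \<open>x\<close> trees into the children of one root.\<close>

lemma first_passage_iff_forest:
  "first_passage m xs \<longleftrightarrow> (\<exists>ts. length ts = m \<and> xs = concat (map degree_seq ts))"
proof (induction xs arbitrary: m)
  case Nil
  have "ts = []" if "concat (map degree_seq ts) = []" for ts :: "plane_tree list"
    using that by (cases ts) auto
  then show ?case by (fastforce simp: first_passage_def)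
next
  case (Cons x xs)
  show ?case
  proof (cases m)
    case 0 then show ?thesis by (simp add: first_passage_0)
  next
    case (Suc m')
    have "first_passage m (x # xs) \<longleftrightarrow> (\<exists>ts. length ts = m' + x \<and> xs = concat (map degree_seq ts))"
      by (simp add: Suc first_passage_Cons Cons.IH)
    also have "\<dots> \<longleftrightarrow> (\<exists>ts. length ts = m \<and> x # xs = concat (map degree_seq ts))"
    proof safe
      fix ts :: "plane_tree list" assume l: "length ts = m' + x"
      have "concat (map degree_seq ts) = concat (map degree_seq (take x ts)) @ concat (map degree_seq (drop x ts))"
        by (metis append_take_drop_id concat_append map_append)
      then have "x # concat (map degree_seq ts) = concat (map degree_seq (Node (take x ts) # drop x ts))"
        using l by (simp add: degree_seq.simps)
      then show "\<exists>us. length us = m \<and> x # concat (map degree_seq ts) = concat (map degree_seq us)"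
        using l Suc by (intro exI[of _ "Node (take x ts) # drop x ts"]) simp
    next
      fix ts :: "plane_tree list" assume m: "m = length ts" and eq: "x # xs = concat (map degree_seq ts)"
      obtain us vs where ts: "ts = Node us # vs" using Suc m 
        by (metis Zero_not_Suc length_0_conv list.exhaust plane_tree.exhaust)
      show "\<exists>ts. length ts = m' + x \<and> xs = concat (map degree_seq ts)"
        using eq Suc m by (intro exI[of _ "us @ vs"]) (auto simp: ts degree_seq.simps)
    qed
    finally show ?thesis .
  qed
qed

lemma first_passage_1_iff: "first_passage 1 xs \<longleftrightarrow> (\<exists>T. xs = degree_seq T)"
  by (auto simp: first_passage_iff_forest length_Suc_conv)

text \<open>Strict inequality to the left and weak inequality to the right single out the first
  position at which the minimum is attained.\<close>

lemma first_argmin_ex1: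
  fixes s :: "nat \<Rightarrow> int"
  assumes "n > 0"
  shows "\<exists>!r. r < n \<and> (\<forall>i. r < i \<and> i < n \<longrightarrow> s r \<le> s i) \<and> (\<forall>i<r. s r < s i)"
proof -
  define m where "m = Min (s ` {..<n})"
  have m: "m \<in> s ` {..<n}" "\<And>i. i < n \<Longrightarrow> m \<le> s i"
    using assms by (auto simp: m_def intro!: Min_in)
  define r where "r = (LEAST i. i < n \<and> s i = m)"
  have r: "r < n \<and> s r = m" unfolding r_def by (rule LeastI_ex) (use m in auto)
  have less: "s r < s i" if "i < r" for i
  proof -
    have "\<not> (i < n \<and> s i = m)" using not_less_Least[of i "\<lambda>i. i < n \<and> s i = m"] that by (simp add: r_def)
    then show ?thesis using r m(2)[of i] that by fastforce
  qed
  show ?thesis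
  proof (rule ex1I[of _ r])
    show "r < n \<and> (\<forall>i. r < i \<and> i < n \<longrightarrow> s r \<le> s i) \<and> (\<forall>i<r. s r < s i)"
      using r m less by auto
  next
    fix q assume q: "q < n \<and> (\<forall>i. q < i \<and> i < n \<longrightarrow> s q \<le> s i) \<and> (\<forall>i<q. s q < s i)"
    show "q = r"
    proof (rule ccontr)
      assume "q \<noteq> r"
      then consider "q < r" | "r < q" by linarith
      then show False using q r less m(2)[of q] by cases force+
    qed
  qed
qed

lemma sum_list_take_le: "j \<le> k \<Longrightarrow> sum_list (take j xs) + sum_list (take (k - j) (drop j xs)) = sum_list (take k (xs :: nat list))"
  by (metis le_add_diff_inverse sum_list_append take_add)

text \<open>Up to the end of \<open>xs\<close> the rotated walk is the old one relative to level
  \<open>s r\<close>. Once it wraps around it has also picked up the total displacement -1, and this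
  turns the weak inequality into a strict one.\<close>

lemma first_passage_rotate_iff:
  assumes n: "length xs = n" "sum_list xs + 1 = n" and r: "r < n"
  defines "s \<equiv> \<lambda>j. int (sum_list (take j xs)) - int j"
  shows "first_passage 1 (rotate r xs) \<longleftrightarrow> (\<forall>i. r < i \<and> i < n \<longrightarrow> s r \<le> s i) \<and> (\<forall>i<r. s r < s i)"
proof -
  have rot: "rotate r xs = drop r xs @ take r xs" using n r by (simp add: rotate_drop_take)
  have tot: "sum_list (drop r xs) + sum_list (take r xs) = sum_list xs"
    by (metis add.commute append_take_drop_id sum_list_append)
  have A: "j < sum_list (take j (rotate r xs)) + 1 \<longleftrightarrow> s r \<le> s (r + j)" if "r + j < n" for j
  proof -
    have "take j (rotate r xs) = take j (drop r xs)" using that n by (simp add: rot)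
    then show ?thesis using sum_list_take_le[of r "r + j" xs] by (auto simp: s_def)
  qed
  have B: "j < sum_list (take j (rotate r xs)) + 1 \<longleftrightarrow> s r < s (r + j - n)"
    if "n \<le> r + j" "j < n" for j
  proof -
    have *: "j - (n - r) = r + j - n" using that r by simp
    have "take j (rotate r xs) = drop r xs @ take (j - (n - r)) xs" using that n r by (simp add: rot min_def)
    then show ?thesis using tot n that r unfolding * by (auto simp: s_def)
  qed
  have "first_passage 1 (rotate r xs) \<longleftrightarrow> (\<forall>j<n. j < sum_list (take j (rotate r xs)) + 1)"
    using n tot by (simp add: first_passage_def) (simp add: rot)
  also have "\<dots> \<longleftrightarrow> (\<forall>j<n. (r + j < n \<longrightarrow> s r \<le> s (r + j)) \<and> (n \<le> r + j \<longrightarrow> s r < s (r + j - n)))"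
    using A B by (metis leI linorder_not_le)
  also have "\<dots> \<longleftrightarrow> (\<forall>i. r < i \<and> i < n \<longrightarrow> s r \<le> s i) \<and> (\<forall>i<r. s r < s i)"
  proof (intro iffI conjI allI impI)
    assume H: "\<forall>j<n. (r + j < n \<longrightarrow> s r \<le> s (r + j)) \<and> (n \<le> r + j \<longrightarrow> s r < s (r + j - n))"
    show "s r \<le> s i" if "r < i \<and> i < n" for i using H[rule_format, of "i - r"] that by auto
    show "s r < s i" if "i < r" for i using H[rule_format, of "n + i - r"] that r by auto
  next
    assume H: "(\<forall>i. r < i \<and> i < n \<longrightarrow> s r \<le> s i) \<and> (\<forall>i<r. s r < s i)"
    fix j assume j: "j < n"
    show "s r \<le> s (r + j)" if "r + j < n" using H that by (cases "j = 0") auto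
    show "s r < s (r + j - n)" if "n \<le> r + j" using H that j by auto
  qed
  finally show ?thesis .
qed

lemma cycle_lemma:
  assumes "length xs = n" "sum_list xs + 1 = n"
  shows "\<exists>!r. r < n \<and> first_passage 1 (rotate r xs)"
proof -
  have "n > 0" using assms by simp
  from first_argmin_ex1[OF this, of "\<lambda>j. int (sum_list (take j xs)) - int j"]
  show ?thesis using first_passage_rotate_iff[OF assms] by (metis (no_types, lifting))
qed

text \<open>Writing \<open>sum_list xs + 1 = n\<close> instead of \<open>n - 1\<close> makes the set
  empty for \<open>n = 0\<close>, in accordance with the absence of trees of order 0.\<close>

definition bridges :: "nat \<Rightarrow> nat list set" where
  "bridges n = {xs. length xs = n \<and> sum_list xs + 1 = n}"

lemma finite_bridges: "finite (bridges n)"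
proof (rule finite_subset)
  show "bridges n \<subseteq> {xs. set xs \<subseteq> {..n} \<and> length xs = n}"
    using member_le_sum_list by (fastforce simp: bridges_def)
qed (simp add: finite_lists_length_eq)

lemma degree_seq_image: "degree_seq ` {T. tree_order T = n} = {xs \<in> bridges n. first_passage 1 xs}"
proof -
  have "length xs = n \<and> first_passage 1 xs \<Longrightarrow> xs \<in> bridges n" for xs
    by (auto simp: bridges_def first_passage_def)
  then show ?thesis
    using sum_degree_seq by (auto simp: first_passage_1_iff image_iff bridges_def simp del: One_nat_def)
qed

lemma finite_trees_of_order: "finite {T. tree_order T = n}"
proof (rule finite_imageD)
  show "finite (degree_seq ` {T. tree_order T = n})"
    unfolding degree_seq_image by (simp add: finite_bridges)
qed (auto simp: inj_on_def degree_seq_inject)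

lemma sum_list_rotate: "sum_list (rotate r xs) = sum_list (xs :: nat list)"
proof -
  have "sum_list (rotate1 xs) = sum_list xs" for xs :: "nat list"
    by (cases xs) auto
  then show ?thesis by (induction r) auto
qed

lemma bij_betw_rotate_bridges: "bij_betw (rotate r) (bridges n) (bridges n)"
\<comment> \<open>The rotation by \<open>r * (n - 1)\<close> completes the one by \<open>r\<close>
  to \<open>r\<close> full turns, so it is an inverse for every \<open>r\<close>, also beyond
  \<open>n\<close>.\<close>
proof (rule bij_betw_byWitness[where f' = "rotate (r * (n - 1))"])
  have *: "r + r * (n - 1) = r * n" if "xs \<in> bridges n" for xs
    using that by (cases n) (auto simp: bridges_def)
  have id: "rotate (r * n) xs = xs" if "xs \<in> bridges n" for xs
    using that by (intro rotate_id) (simp add: bridges_def)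
  show "\<forall>xs\<in>bridges n. rotate (r * (n - 1)) (rotate r xs) = xs"
    "\<forall>xs\<in>bridges n. rotate r (rotate (r * (n - 1)) xs) = xs"
    by (auto simp only: rotate_rotate * add.commute[of "r * (n - 1)"] id)
qed (auto simp: bridges_def sum_list_rotate)

text \<open>Double counting of pairs of a bridge and a rotation index: the cycle lemma inserts a
  factor 1 as a sum over \<open>r < n\<close>, and since rotation permutes the bridges and fixes
  \<open>F\<close>, each index \<open>r\<close> contributes the same sum over trees.\<close>

lemma sum_trees_eq_sum_bridges:
  fixes F :: "nat list \<Rightarrow> real"
  assumes inv: "\<And>r xs. F (rotate r xs) = F xs"
  shows "real n * (\<Sum>T | tree_order T = n. F (degree_seq T)) = (\<Sum>xs\<in>bridges n. F xs)"
proof -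
  have one: "(\<Sum>r<n. of_bool (first_passage 1 (rotate r xs))) = (1::real)" if "xs \<in> bridges n" for xs
  proof -
    have "\<exists>!r. r < n \<and> first_passage 1 (rotate r xs)"
      using that by (intro cycle_lemma) (simp_all add: bridges_def)
    then obtain r where "{q. q < n \<and> first_passage 1 (rotate q xs)} = {r}"
      by (elim ex1E) blast
    then have "{..<n} \<inter> {q. first_passage 1 (rotate q xs)} = {r}" by auto
    then show ?thesis by (simp add: of_bool_def sum.If_cases del: One_nat_def)
  qed
  have "(\<Sum>xs\<in>bridges n. F xs) = (\<Sum>xs\<in>bridges n. \<Sum>r<n. of_bool (first_passage 1 (rotate r xs)) * F xs)"
    by (simp only: sum_distrib_right[symmetric]) (intro sum.cong refl, simp only: one mult_1)
  also have "\<dots> = (\<Sum>r<n. \<Sum>xs\<in>bridges n. of_bool (first_passage 1 (rotate r xs)) * F (rotate r xs))"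
    by (subst sum.swap) (simp add: inv)
  also have "\<dots> = (\<Sum>r<n. \<Sum>xs\<in>bridges n. of_bool (first_passage 1 xs) * F xs)"
    by (intro sum.cong refl sum.reindex_bij_betw[OF bij_betw_rotate_bridges])
  also have "\<dots> = real n * (\<Sum>xs | xs \<in> bridges n \<and> first_passage 1 xs. F xs)"
    by (simp add: of_bool_def if_distrib[of "\<lambda>x. x * _"] sum.If_cases finite_bridges Int_def cong: if_cong)
  also have "(\<Sum>xs | xs \<in> bridges n \<and> first_passage 1 xs. F xs) = (\<Sum>T | tree_order T = n. F (degree_seq T))"
    unfolding degree_seq_image[symmetric]
    by (subst sum.reindex) (auto simp: inj_on_def degree_seq_inject)
  finally show ?thesis by simp
qed

text \<open>Windows may wrap around the end, which makes the count rotation invariant;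
  \<open>sum_trees_eq_sum_bridges\<close> applies only to such statistics.\<close>

definition cyclic_occ :: "'a list \<Rightarrow> 'a list \<Rightarrow> nat" where
  "cyclic_occ e xs =
     card {i. i < length xs \<and> (\<forall>j<length e. e ! j = xs ! ((i + j) mod length xs))}"

lemma cyclic_occ_rotate: "cyclic_occ e (rotate r xs) = cyclic_occ e xs"
proof (cases "xs = []")
  case False
  define n where "n = length xs"
  have n: "n > 0" using False by (simp add: n_def)
  let ?A = "{i. i < n \<and> (\<forall>j<length e. e ! j = rotate r xs ! ((i + j) mod n))}"
  let ?B = "{i. i < n \<and> (\<forall>j<length e. e ! j = xs ! ((i + j) mod n))}"
  have *: "rotate r xs ! ((i + j) mod n) = xs ! (((i + r) mod n + j) mod n)" for i j
    using n by (simp add: nth_rotate n_def mod_simps ac_simps)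
  have inj: "inj_on (\<lambda>i. (i + r) mod n) {..<n}"
  proof (rule inj_onI)
    fix x y assume *: "x \<in> {..<n}" "y \<in> {..<n}" "(x + r) mod n = (y + r) mod n"
    \<comment> \<open>The shift by \<open>r\<close> is undone by the nonnegative shift
      \<open>n - r mod n\<close>.\<close>
    have inv: "((z + r) mod n + (n - r mod n)) mod n = z mod n" for z
    proof -
      have "z + r + (n - r mod n) = z + n * (r div n) + n"
        using mod_less_divisor[OF n, of r] mult_div_mod_eq[of n r] by linarith
      then have "(z + r + (n - r mod n)) mod n = z mod n"
        by (simp only: mod_mult_self2 mod_add_self2)
      then show ?thesis by (simp add: mod_add_left_eq)
    qed
    show "x = y" using * inv[of x] inv[of y] by simp
  qed
  have surj: "(\<lambda>i. (i + r) mod n) ` {..<n} = {..<n}"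
    by (rule endo_inj_surj) (use inj n in auto)
  have "?B = (\<lambda>i. (i + r) mod n) ` ?A"
  proof (intro set_eqI iffI)
    fix i assume i: "i \<in> ?B"
    then obtain k where k: "k < n" "i = (k + r) mod n" using surj by (auto simp: image_iff set_eq_iff)
    show "i \<in> (\<lambda>i. (i + r) mod n) ` ?A" using i k by (auto simp: *)
  qed (use n in \<open>auto simp: *\<close>)
  moreover have "inj_on (\<lambda>i. (i + r) mod n) ?A" using inj by (rule inj_on_subset) auto
  ultimately have "card ?B = card ?A" by (simp add: card_image)
  then show ?thesis by (simp add: cyclic_occ_def n_def)
qed simp

lemma prefix_drop_iff:
  "prefix e (drop i xs) \<longleftrightarrow> (i + length e \<le> length xs \<or> e = []) \<and> (\<forall>j<length e. e ! j = xs ! (i + j))"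
proof
  assume "prefix e (drop i xs)"
  then obtain zs where zs: "drop i xs = e @ zs" by (auto elim: prefixE)
  have "length e \<le> length xs - i" using zs by (metis length_append length_drop le_add1)
  moreover have "e ! j = xs ! (i + j)" if "j < length e" for j
  proof -
    have "i \<le> length xs" using that calculation by linarith
    then show ?thesis using arg_cong[OF zs, of "\<lambda>l. l ! j"] that by (simp add: nth_append)
  qed
  ultimately show "(i + length e \<le> length xs \<or> e = []) \<and> (\<forall>j<length e. e ! j = xs ! (i + j))"
    by (cases "e = []"; cases "i \<le> length xs") auto
next
  assume A: "(i + length e \<le> length xs \<or> e = []) \<and> (\<forall>j<length e. e ! j = xs ! (i + j))"
  then have "e = take (length e) (drop i xs)"
    by (intro nth_equalityI) auto
  then show "prefix e (drop i xs)" by (metis take_is_prefix)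
qed

lemma occ_le_cyclic_occ: "e \<noteq> [] \<Longrightarrow> occ e xs \<le> cyclic_occ e xs"
  unfolding occ_def cyclic_occ_def by (rule card_mono) (auto simp: prefix_drop_iff)

lemma cyclic_occ_le_occ: "cyclic_occ e xs \<le> occ e xs + length e"
proof -
  let ?n = "length xs"
  have "{i. i < ?n \<and> (\<forall>j<length e. e ! j = xs ! ((i + j) mod ?n))}
     \<subseteq> {i. i < ?n \<and> prefix e (drop i xs)} \<union> {?n - length e..<?n}"
    by (auto simp: prefix_drop_iff)
  then have "cyclic_occ e xs \<le> card ({i. i < ?n \<and> prefix e (drop i xs)} \<union> {?n - length e..<?n})"
    unfolding cyclic_occ_def by (rule card_mono[rotated]) simp
  also have "\<dots> \<le> occ e xs + card {?n - length e..<?n}"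
    unfolding occ_def by (rule card_Un_le)
  finally show ?thesis by simp
qed

text \<open>No occurrence wraps around in the degree sequence of a tree. A wrapping window would
  begin with the complete codeword of the fringe subtree at \<open>i\<close>; by prefix-freeness it
  would equal that codeword, which ends inside the list.\<close>

lemma cyclic_occ_degree_seq: "cyclic_occ (degree_seq T') (degree_seq T) = subtree_count T' T"
proof -
  let ?e = "degree_seq T'" and ?xs = "degree_seq T"
  have "prefix ?e (drop i ?xs)"
    if i: "i < tree_order T" and *: "\<forall>j<length ?e. ?e ! j = ?xs ! ((i + j) mod length ?xs)" for i
  proof -
    obtain u zs where u: "drop i ?xs = degree_seq u @ zs"
      using degree_seq_drop_prefix[OF i] by (auto elim: prefixE)
    show ?thesis
    proof (cases "i + length ?e \<le> length ?xs")
      case True then show ?thesis using * by (auto simp: prefix_drop_iff)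
    next
      case False
      have le: "length (degree_seq u) \<le> length ?xs - i" using u by (metis length_append length_drop le_add1)
      have "prefix (degree_seq u) (drop 0 ?e)"
        unfolding prefix_drop_iff
      proof (intro conjI allI impI)
        fix j assume j: "j < length (degree_seq u)"
        have "degree_seq u ! j = drop i ?xs ! j" using u j by (simp add: nth_append)
        also have "\<dots> = ?xs ! (i + j)" using i by simp
        also have "\<dots> = ?e ! j" using * j le i False by simp
        finally show "degree_seq u ! j = ?e ! (0 + j)" by simp
      qed (use False le in auto)
      then have "u = T'" by simp
      then show ?thesis using u by simp
    qed
  qed
  then have "cyclic_occ ?e ?xs \<le> occ ?e ?xs"
    unfolding cyclic_occ_def occ_def by (intro card_mono) auto
  then show ?thesis using occ_le_cyclic_occ[of ?e ?xs] by (simp add: occ_degree_seq)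
qed

section \<open>Galton--Watson trees and bridges\<close>

instance plane_tree :: countable
  by countable_datatype

text \<open>\<open>gw_nodes\<close> grows addresses at the end, generation by generation, whereas
  \<open>nodes\<close> recurses from the root. This equivalence translates between the two and
  exposes the process restarted at the child \<open>i\<close>.\<close>

lemma gw_nodes_Cons_iff: "i # v \<in> gw_nodes c \<longleftrightarrow> i < c [] \<and> v \<in> gw_nodes (\<lambda>u. c (i # u))"
proof
  have "v \<noteq> [] \<Longrightarrow> hd v < c [] \<and> tl v \<in> gw_nodes (\<lambda>u. c (hd v # u))" if "v \<in> gw_nodes c" for v
    using that
  proof (induction rule: gw_nodes.induct)
    case (child v i)
    show ?case
    proof (cases "v = []")
      case True then show ?thesis using child by (auto intro: gw_nodes.root)
    next
      case False
      then show ?thesis using child by (auto intro!: gw_nodes.child)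
    qed
  qed simp
  from this[of "i # v"] show "i # v \<in> gw_nodes c \<Longrightarrow> i < c [] \<and> v \<in> gw_nodes (\<lambda>u. c (i # u))"
    by simp
next
  assume *: "i < c [] \<and> v \<in> gw_nodes (\<lambda>u. c (i # u))"
  then have "v \<in> gw_nodes (\<lambda>u. c (i # u))" by simp
  then show "i # v \<in> gw_nodes c"
  proof (induction rule: gw_nodes.induct)
    case root
    show ?case using * gw_nodes.child[OF gw_nodes.root, of i c] by simp
  next
    case (child v j)
    then show ?case using gw_nodes.child[of "i # v" c j] by simp
  qed
qed

lemma nodes_Cons_iff: "i # v \<in> nodes (Node ts) \<longleftrightarrow> i < length ts \<and> v \<in> nodes (ts ! i)"
  by auto

lemma Nil_in_nodes [simp]: "[] \<in> nodes T"
  by (cases T) simp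

lemma address_set_eq_iff:
  fixes A B :: "nat list set"
  shows "A = B \<longleftrightarrow> ([] \<in> A \<longleftrightarrow> [] \<in> B) \<and> (\<forall>i v. i # v \<in> A \<longleftrightarrow> i # v \<in> B)"
  by (metis neq_Nil_conv set_eqI)

lemma nodes_eq_gw_nodes_Node:
  "nodes (Node ts) = gw_nodes c \<longleftrightarrow>
     c [] = length ts \<and> (\<forall>i<length ts. nodes (ts ! i) = gw_nodes (\<lambda>v. c (i # v)))"
proof
  assume *: "nodes (Node ts) = gw_nodes c"
  have eq: "i < length ts \<and> v \<in> nodes (ts ! i) \<longleftrightarrow> i < c [] \<and> v \<in> gw_nodes (\<lambda>u. c (i # u))" for i v
    using * nodes_Cons_iff gw_nodes_Cons_iff by blast
  have "i < length ts \<longleftrightarrow> i < c []" for i using eq[of i "[]"] by (simp add: gw_nodes.root)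
  then have "c [] = length ts" by (metis linorder_neqE_nat less_irrefl)
  moreover have "nodes (ts ! i) = gw_nodes (\<lambda>v. c (i # v))" if "i < length ts" for i
    using eq[of i] that calculation by (intro set_eqI) simp
  ultimately show "c [] = length ts \<and> (\<forall>i<length ts. nodes (ts ! i) = gw_nodes (\<lambda>v. c (i # v)))"
    by simp
next
  assume "c [] = length ts \<and> (\<forall>i<length ts. nodes (ts ! i) = gw_nodes (\<lambda>v. c (i # v)))"
  then show "nodes (Node ts) = gw_nodes c"
    unfolding address_set_eq_iff[of "nodes (Node ts)"]
    by (auto simp: nodes_Cons_iff gw_nodes_Cons_iff gw_nodes.root simp del: nodes.simps)
qed

fun degree_at :: "plane_tree \<Rightarrow> nat list \<Rightarrow> nat" where
  "degree_at (Node ts) [] = length ts"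
| "degree_at (Node ts) (i # v) = degree_at (ts ! i) v"

lemma nodes_eq_gw_nodes_iff: "nodes T = gw_nodes c \<longleftrightarrow> (\<forall>v\<in>nodes T. c v = degree_at T v)"
proof (induction T arbitrary: c)
  case (Node ts)
  show ?case unfolding nodes_eq_gw_nodes_Node using Node by auto
qed

lemma inj_nodes: "nodes T = nodes T' \<Longrightarrow> T = T'"
proof (induction T arbitrary: T')
  case (Node ts)
  obtain ts' where T': "T' = Node ts'" by (cases T')
  have eq: "i < length ts \<and> v \<in> nodes (ts ! i) \<longleftrightarrow> i < length ts' \<and> v \<in> nodes (ts' ! i)" for i v
    using Node.prems nodes_Cons_iff T' by blast
  have "i < length ts \<longleftrightarrow> i < length ts'" for i using eq[of i "[]"] by simp
  then have l: "length ts = length ts'" by (metis linorder_neqE_nat less_irrefl)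
  have "ts ! i = ts' ! i" if "i < length ts" for i
    using that eq l by (intro Node.IH) auto
  then show ?case using l T' by (auto intro: nth_equalityI)
qed

text \<open>Induction on the number of born nodes: the family of each child embeds into the whole
  family without its root.\<close>

lemma ex_tree_nodes_eq: "finite (gw_nodes c) \<Longrightarrow> \<exists>T. nodes T = gw_nodes c"
proof (induction "card (gw_nodes c)" arbitrary: c rule: less_induct)
  case less
  let ?c = "\<lambda>i v. c (i # v)"
  have "\<exists>T. nodes T = gw_nodes (?c i)" if i: "i < c []" for i
  proof (rule less.hyps)
    have sub: "(#) i ` gw_nodes (?c i) \<subseteq> gw_nodes c - {[]}"
      using i by (auto simp: gw_nodes_Cons_iff)
    have "card ((#) i ` gw_nodes (?c i)) \<le> card (gw_nodes c - {[]})"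
      using less.prems sub by (intro card_mono) auto
    also have "\<dots> < card (gw_nodes c)"
      using less.prems by (intro card_Diff1_less gw_nodes.root)
    finally show "card (gw_nodes (?c i)) < card (gw_nodes c)" by (simp add: card_image)
    have "finite ((#) i ` gw_nodes (?c i))" using sub less.prems by (meson finite_Diff finite_subset)
    then show "finite (gw_nodes (?c i))" by (rule finite_imageD) auto
  qed
  then obtain t where t: "\<And>i. i < c [] \<Longrightarrow> nodes (t i) = gw_nodes (?c i)" by metis
  have "nodes (Node (map t [0..<c []])) = gw_nodes c"
    unfolding nodes_eq_gw_nodes_Node using t by auto
  then show ?case ..
qed

lemma gw_tree_eq_Some_iff: "gw_tree c = Some T \<longleftrightarrow> (\<forall>v\<in>nodes T. c v = degree_at T v)"
proof -
  have "gw_tree c = Some T \<longleftrightarrow> nodes T = gw_nodes c"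
  proof
    assume *: "gw_tree c = Some T"
    then have "finite (gw_nodes c)" by (auto simp: gw_tree_def split: if_splits)
    then obtain T' where T': "nodes T' = gw_nodes c" using ex_tree_nodes_eq by blast
    then have "(THE T. nodes T = gw_nodes c) = T'" by (intro the_equality) (auto intro: inj_nodes)
    then show "nodes T = gw_nodes c" using * T' by (auto simp: gw_tree_def split: if_splits)
  next
    assume *: "nodes T = gw_nodes c"
    then have "(THE T. nodes T = gw_nodes c) = T" by (intro the_equality) (auto intro: inj_nodes)
    then show "gw_tree c = Some T" using * finite_nodes[of T] by (simp add: gw_tree_def)
  qed
  then show ?thesis by (simp add: nodes_eq_gw_nodes_iff)
qed

lemma prod_degree_at: "(\<Prod>v\<in>nodes T. g (degree_at T v)) = prod_list (map (g :: nat \<Rightarrow> real) (degree_seq T))"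
proof (induction T)
  case (Node ts)
  have "(\<Prod>v\<in>nodes (Node ts). g (degree_at (Node ts) v)) =
     g (length ts) * (\<Prod>v\<in>(\<Union>i<length ts. (#) i ` nodes (ts ! i)). g (degree_at (Node ts) v))"
    unfolding nodes.simps by (subst prod.insert) auto
  also have "(\<Prod>v\<in>(\<Union>i<length ts. (#) i ` nodes (ts ! i)). g (degree_at (Node ts) v)) =
      (\<Prod>i<length ts. \<Prod>v\<in>(#) i ` nodes (ts ! i). g (degree_at (Node ts) v))"
    by (intro prod.UNION_disjoint) auto
  also have "\<dots> = (\<Prod>i<length ts. \<Prod>v\<in>nodes (ts ! i). g (degree_at (ts ! i) v))"
    by (rule prod.cong[OF refl]) (subst prod.reindex, auto)
  also have "\<dots> = (\<Prod>i<length ts. prod_list (map g (degree_seq (ts ! i))))"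
    using Node by (intro prod.cong) auto
  also have "\<dots> = prod_list (map (\<lambda>t. prod_list (map g (degree_seq t))) ts)"
    by (simp add: prod.list_conv_set_nth atLeast0LessThan)
  also have "\<dots> = prod_list (map g (concat (map degree_seq ts)))"
    by (induction ts) auto
  finally show ?case by (simp add: degree_seq.simps)
qed

lemma pmf_replicate_pmf:
  "pmf (replicate_pmf n p) xs = (if length xs = n then prod_list (map (pmf p) xs) else 0)"
proof (induction n arbitrary: xs)
  case (Suc n)
  have eq: "replicate_pmf (Suc n) p = map_pmf (\<lambda>(x, xs). x # xs) (pair_pmf p (replicate_pmf n p))"
    by (simp add: pair_pmf_def map_bind_pmf)
  show ?case
  proof (cases xs)
    case Nil
    have "[] \<notin> set_pmf (replicate_pmf (Suc n) p)" by (simp add: set_replicate_pmf)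
    then show ?thesis by (simp add: Nil pmf_eq_0_set_pmf del: replicate_pmf.simps)
  next
    case (Cons y ys)
    have "pmf (replicate_pmf (Suc n) p) xs = pmf (pair_pmf p (replicate_pmf n p)) (y, ys)"
      unfolding eq Cons by (subst pmf_map_inj'[symmetric, of "\<lambda>(x, xs). x # xs"]) (auto simp: inj_def)
    then show ?thesis by (simp add: Suc Cons pmf_pair)
  qed
qed auto

text \<open>The event of a given finite tree involves only the finitely many coordinates at its
  nodes, and infinite trees form the complement of a countable union of such events.\<close>

lemma measurable_gw_tree [measurable]:
  "gw_tree \<in> (\<Pi>\<^sub>M v\<in>UNIV. measure_pmf (p :: nat pmf)) \<rightarrow>\<^sub>M count_space UNIV"
proof -
  let ?M = "\<Pi>\<^sub>M v\<in>(UNIV::nat list set). measure_pmf p"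
  have S: "gw_tree -` {Some T} \<inter> space ?M \<in> sets ?M" for T
  proof -
    have "{c \<in> space ?M. \<forall>v\<in>nodes T. c v = degree_at T v} \<in> sets ?M"
      by measurable
    also have "{c \<in> space ?M. \<forall>v\<in>nodes T. c v = degree_at T v} = gw_tree -` {Some T} \<inter> space ?M"
      by (auto simp: gw_tree_eq_Some_iff)
    finally show ?thesis .
  qed
  have N: "gw_tree -` {None} \<inter> space ?M = space ?M - (\<Union>T. gw_tree -` {Some T} \<inter> space ?M)"
    by (auto simp: not_Some_eq[symmetric] simp del: not_Some_eq)
  have "gw_tree -` {x} \<inter> space ?M \<in> sets ?M" for x
  proof (cases x)
    case None
    show ?thesis unfolding None N using S by (intro sets.Diff sets.countable_UN) auto
  qed (use S in auto)
  then show ?thesis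
    by (subst measurable_count_space_eq2_countable) auto
qed

lemma prob_space_gw_law: "prob_space (gw_law p)"
  unfolding gw_law_def by (intro prob_space.prob_space_distr prob_space_PiM measure_pmf.prob_space_axioms) simp

lemma sets_gw_law [simp]: "sets (gw_law p) = UNIV" and space_gw_law [simp]: "space (gw_law p) = UNIV"
  by (auto simp: gw_law_def)

text \<open>The event is a cylinder over the nodes of \<open>T\<close>; listed in depth-first order,
  its product of offspring probabilities is the probability of an i.i.d. word.\<close>

lemma tree_prob_eq_pmf:
  "tree_prob p T = pmf (replicate_pmf (tree_order T) p) (degree_seq T)"
proof -
  let ?M = "\<Pi>\<^sub>M v\<in>(UNIV::nat list set). measure_pmf p"
  interpret product_prob_space "\<lambda>v::nat list. measure_pmf p" UNIV
    by unfold_locales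
  have "tree_prob p T = measure ?M (gw_tree -` {Some T} \<inter> space ?M)"
    by (simp add: tree_prob_def gw_law_def measure_distr)
  also have "gw_tree -` {Some T} \<inter> space ?M = prod_emb UNIV (\<lambda>_. measure_pmf p) (nodes T) (Pi\<^sub>E (nodes T) (\<lambda>v. {degree_at T v}))"
    by (auto simp: gw_tree_eq_Some_iff prod_emb_def space_PiM PiE_iff)
  also have "measure ?M \<dots> = (\<Prod>v\<in>nodes T. measure (measure_pmf p) {degree_at T v})"
    by (intro measure_PiM_emb) auto
  also have "\<dots> = prod_list (map (pmf p) (degree_seq T))"
    by (simp add: measure_pmf_single prod_degree_at)
  finally show ?thesis by (simp add: pmf_replicate_pmf)
qed

lemma pmf_replicate_rotate:
  "pmf (replicate_pmf n p) (rotate r xs) = pmf (replicate_pmf n p) xs"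
proof -
  have "prod_list (rotate1 ys) = prod_list ys" for ys :: "real list"
    by (cases ys) auto
  then have "prod_list (map (pmf p) (rotate r xs)) = prod_list (map (pmf p) xs)"
    by (induction r) (auto simp: rotate1_map[symmetric])
  then show ?thesis by (simp add: pmf_replicate_pmf)
qed

lemma measure_order_event:
  "measure (gw_law p) (order_event n) = (\<Sum>T | tree_order T = n. tree_prob p T)"
proof -
  interpret prob_space "gw_law p" by (rule prob_space_gw_law)
  have "order_event n = (\<Union>T\<in>{T. tree_order T = n}. {Some T})"
    by (auto simp: order_event_def)
  then have "prob (order_event n) = prob (\<Union>T\<in>{T. tree_order T = n}. {Some T})" by simp
  also have "\<dots> = (\<Sum>T | tree_order T = n. prob {Some T})"
    by (intro finite_measure_finite_Union) (auto simp: finite_trees_of_order disjoint_family_on_def)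
  finally show ?thesis by (simp add: tree_prob_def)
qed

definition bridge_prob :: "nat pmf \<Rightarrow> nat \<Rightarrow> real" where
  "bridge_prob p n = measure_pmf.prob (replicate_pmf n p) (bridges n)"

text \<open>This is the Otter-Dwass formula; the summand is the probability of the word, which does
  not depend on the order of its letters.\<close>

lemma measure_order_event_eq: "real n * measure (gw_law p) (order_event n) = bridge_prob p n"
proof -
  have "measure (gw_law p) (order_event n) = (\<Sum>T | tree_order T = n. pmf (replicate_pmf n p) (degree_seq T))"
    unfolding measure_order_event by (intro sum.cong) (auto simp: tree_prob_eq_pmf)
  then show ?thesis
    using sum_trees_eq_sum_bridges[of "pmf (replicate_pmf n p)" n]
    by (simp add: pmf_replicate_rotate bridge_prob_def measure_measure_pmf_finite[OF finite_bridges])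
qed

definition bridge_pmf :: "nat pmf \<Rightarrow> nat \<Rightarrow> nat list pmf" where
  "bridge_pmf p n = cond_pmf (replicate_pmf n p) (bridges n)"

lemma bridge_prob_pos_imp_nonempty:
  "bridge_prob p n > 0 \<Longrightarrow> set_pmf (replicate_pmf n p) \<inter> bridges n \<noteq> {}"
  unfolding bridge_prob_def by (metis measure_pmf_zero_iff less_irrefl)

lemma expectation_bridge_pmf_sum:
  assumes "bridge_prob p n > 0"
  shows "measure_pmf.expectation (bridge_pmf p n) H =
           (\<Sum>xs\<in>bridges n. pmf (replicate_pmf n p) xs * (H xs :: real)) / bridge_prob p n"
proof -
  note ne = bridge_prob_pos_imp_nonempty[OF assms]
  have "measure_pmf.expectation (bridge_pmf p n) H = (\<Sum>xs\<in>bridges n. H xs * pmf (bridge_pmf p n) xs)"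
    by (rule integral_measure_pmf_real) (auto simp: finite_bridges bridge_pmf_def set_cond_pmf[OF ne])
  also have "\<dots> = (\<Sum>xs\<in>bridges n. pmf (replicate_pmf n p) xs * H xs / bridge_prob p n)"
    by (intro sum.cong) (auto simp: bridge_pmf_def pmf_cond[OF ne] bridge_prob_def)
  finally show ?thesis by (simp add: sum_divide_distrib)
qed

text \<open>This form keeps the i.i.d. law and moves the conditioning into an indicator, on which
  Fourier inversion and Fubini can act.\<close>

lemma expectation_bridge_pmf:
  fixes H :: "nat list \<Rightarrow> 'a :: {banach, second_countable_topology}"
  assumes "bridge_prob p n > 0"
  shows "measure_pmf.expectation (bridge_pmf p n) H =
           measure_pmf.expectation (replicate_pmf n p) (\<lambda>xs. indicator (bridges n) xs *\<^sub>R H xs) /\<^sub>R bridge_prob p n"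
proof -
  note ne = bridge_prob_pos_imp_nonempty[OF assms]
  have "measure_pmf.expectation (bridge_pmf p n) H = (\<Sum>xs\<in>bridges n. pmf (bridge_pmf p n) xs *\<^sub>R H xs)"
    by (rule integral_measure_pmf) (auto simp: finite_bridges bridge_pmf_def set_cond_pmf[OF ne])
  also have "\<dots> = (\<Sum>xs\<in>bridges n. pmf (replicate_pmf n p) xs *\<^sub>R H xs) /\<^sub>R bridge_prob p n"
    unfolding scaleR_sum_right
    by (intro sum.cong) (auto simp: bridge_pmf_def pmf_cond[OF ne] bridge_prob_def divide_inverse)
  also have "(\<Sum>xs\<in>bridges n. pmf (replicate_pmf n p) xs *\<^sub>R H xs) =
     (\<Sum>xs\<in>bridges n. pmf (replicate_pmf n p) xs *\<^sub>R (indicator (bridges n) xs *\<^sub>R H xs))"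
    by (intro sum.cong) auto
  also have "\<dots> = measure_pmf.expectation (replicate_pmf n p) (\<lambda>xs. indicator (bridges n) xs *\<^sub>R H xs)"
    by (rule integral_measure_pmf[symmetric]) (auto simp: finite_bridges indicator_def split: if_splits)
  finally show ?thesis .
qed

section \<open>From the conditioned tree to the bridge law\<close>

lemma prob_space_cond_gw_law:
  assumes "measure (gw_law p) (order_event n) > 0"
  shows "prob_space (cond_gw_law p n)"
proof -
  interpret G: prob_space "gw_law p" by (rule prob_space_gw_law)
  have "prob_space (uniform_measure (gw_law p) (order_event n))"
    using assms by (intro prob_space_uniform_measure) (auto simp: G.emeasure_eq_measure)
  then show ?thesis unfolding cond_gw_law_def
    by (rule prob_space.prob_space_distr) (simp add: measurable_def)
qed

text \<open>The bridge law does not know which rotation is the tree, so only rotation invariant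
  statistics \<open>H\<close> transfer. The factor \<open>n\<close> from the choice of the rotation
  appears in the sum and in \<open>bridge_prob\<close> and cancels.\<close>

lemma expectation_cond_gw_law:
  assumes pos: "measure (gw_law p) (order_event n) > 0"
    and rot: "\<And>r xs. H (rotate r xs) = H xs"
    and eq: "\<And>T. tree_order T = n \<Longrightarrow> H (degree_seq T) = G T"
  shows "(\<integral>t. G t \<partial>cond_gw_law p n) = measure_pmf.expectation (bridge_pmf p n) (H :: nat list \<Rightarrow> real)"
proof -
  interpret G: prob_space "gw_law p" by (rule prob_space_gw_law)
  let ?m = "measure (gw_law p) (order_event n)"
  have n: "n > 0"
  proof (rule ccontr)
    assume "\<not> n > 0"
    then have "tree_order T \<noteq> n" for T using tree_order_pos[of T] by linarith
    then have "{T. tree_order T = n} = {}" by blast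
    then show False using pos by (simp add: measure_order_event)
  qed
  have bp: "bridge_prob p n > 0" using pos n by (simp add: measure_order_event_eq[symmetric])
  have "(\<integral>t. G t \<partial>cond_gw_law p n) = (\<integral>x. G (the x) \<partial>uniform_measure (gw_law p) (order_event n))"
    unfolding cond_gw_law_def by (intro integral_distr) (auto simp: measurable_def)
  also have "\<dots> = (\<integral>x. (indicator (order_event n) x / ?m) * G (the x) \<partial>gw_law p)"
  proof -
    have "uniform_measure (gw_law p) (order_event n) =
        density (gw_law p) (\<lambda>x. ennreal (indicator (order_event n) x / ?m))"
      unfolding uniform_measure_def using pos
      by (intro arg_cong[where f = "density (gw_law p)"] ext)
        (auto simp: G.emeasure_eq_measure divide_ennreal indicator_def 
           simp flip: ennreal_1)
    then show ?thesis using pos by (simp add: integral_density measurable_def)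
  qed
  also have "\<dots> = (\<integral>x. (\<Sum>T | tree_order T = n. (G T / ?m) * indicator {Some T} x) \<partial>gw_law p)"
  proof (intro Bochner_Integration.integral_cong refl)
    fix x :: "plane_tree option"
    have "(\<Sum>T | tree_order T = n. (G T / ?m) * indicator {Some T} x) =
       (\<Sum>T | tree_order T = n. if x = Some T then G (the x) / ?m else 0)"
      by (intro sum.cong) auto
    also have "\<dots> = (indicator (order_event n) x / ?m) * G (the x)"
      by (cases x) (auto simp: order_event_def sum.delta finite_trees_of_order indicator_def)
    finally show "(indicator (order_event n) x / ?m) * G (the x) = (\<Sum>T | tree_order T = n. (G T / ?m) * indicator {Some T} x)" ..
  qed
  also have "\<dots> = (\<Sum>T | tree_order T = n. (G T / ?m) * tree_prob p T)"
  proof (subst Bochner_Integration.integral_sum)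
    show "integrable (gw_law p) (\<lambda>x. (G T / ?m) * indicator {Some T} x)" for T
      by (intro integrable_mult_right G.integrable_const_bound[of _ 1]) (auto simp: measurable_def indicator_def)
  qed (simp add: tree_prob_def)
  also have "\<dots> = (\<Sum>T | tree_order T = n. pmf (replicate_pmf n p) (degree_seq T) * H (degree_seq T)) / ?m"
    unfolding sum_divide_distrib by (intro sum.cong) (auto simp: eq tree_prob_eq_pmf)
  also have "\<dots> = (\<Sum>xs\<in>bridges n. pmf (replicate_pmf n p) xs * H xs) / (n * ?m)"
    using sum_trees_eq_sum_bridges[of "\<lambda>xs. pmf (replicate_pmf n p) xs * H xs" n, symmetric] n
    by (simp add: pmf_replicate_rotate rot)
  also have "\<dots> = measure_pmf.expectation (bridge_pmf p n) H"
    by (simp add: expectation_bridge_pmf_sum[OF bp] measure_order_event_eq)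
  finally show ?thesis .
qed

text \<open>Countability makes both sigma-algebras the full power set, so comparing singletons
  suffices. The identity gives access to Fubini.\<close>

lemma pair_pmf_eq_pair_measure:
  fixes A :: "'a :: countable pmf" and B :: "'b :: countable pmf"
  shows "measure_pmf (pair_pmf A B) = measure_pmf A \<Otimes>\<^sub>M measure_pmf B"
proof (rule measure_eqI_countable[of _ UNIV])
  have "sets (measure_pmf A \<Otimes>\<^sub>M measure_pmf B) = sets (count_space (UNIV :: 'a set) \<Otimes>\<^sub>M count_space (UNIV :: 'b set))"
    by (rule sets_pair_measure_cong) auto
  then show "sets (measure_pmf A \<Otimes>\<^sub>M measure_pmf B) = Pow UNIV"
    by (simp only: pair_measure_countable[OF countableI_type countableI_type] sets_count_space UNIV_Times_UNIV)
next
  fix x :: "'a \<times> 'b"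
  obtain a b where x: "x = (a, b)" by (cases x)
  have "emeasure (measure_pmf A \<Otimes>\<^sub>M measure_pmf B) {x} = emeasure (measure_pmf A \<Otimes>\<^sub>M measure_pmf B) ({a} \<times> {b})"
    by (simp add: x)
  also have "\<dots> = emeasure (measure_pmf (pair_pmf A B)) {x}"
    by (subst measure_pmf.emeasure_pair_measure_Times) (auto simp: x emeasure_pmf_single pmf_pair ennreal_mult)
  finally show "emeasure (measure_pmf (pair_pmf A B)) {x} = emeasure (measure_pmf A \<Otimes>\<^sub>M measure_pmf B) {x}" ..
qed auto

lemma replicate_pmf_add:
  "replicate_pmf (m + n) p = map_pmf (\<lambda>(xs, ys). xs @ ys) (pair_pmf (replicate_pmf m p) (replicate_pmf n p))"
  by (simp add: replicate_pmf_distrib pair_pmf_def map_bind_pmf)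

lemma expectation_pair_pmf_mult:
  fixes A :: "'a :: countable pmf" and B :: "'b :: countable pmf"
    and f :: "'a \<Rightarrow> 'c :: {real_normed_field, banach, second_countable_topology}"
  assumes f: "integrable A f" and g: "integrable B g"
  shows "integrable (pair_pmf A B) (\<lambda>(x, y). f x * g y)"
    and "measure_pmf.expectation (pair_pmf A B) (\<lambda>(x, y). f x * g y) =
           measure_pmf.expectation A f * measure_pmf.expectation B g"
proof -
  interpret pair_sigma_finite "measure_pmf A" "measure_pmf B" ..
  have m: "(\<lambda>(x, y). f x * g y) \<in> borel_measurable (measure_pmf A \<Otimes>\<^sub>M measure_pmf B)"
    by (simp flip: pair_pmf_eq_pair_measure)
  show int: "integrable (pair_pmf A B) (\<lambda>(x, y). f x * g y)"
    unfolding pair_pmf_eq_pair_measure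
  proof (rule Fubini_integrable[OF m])
    show "AE x in measure_pmf A. integrable (measure_pmf B) (\<lambda>y. case (x, y) of (x, y) \<Rightarrow> f x * g y)"
      using g by simp
    have "(\<lambda>x. \<integral>y. norm (case (x, y) of (x, y) \<Rightarrow> f x * g y) \<partial>measure_pmf B) = (\<lambda>x. norm (f x) * (\<integral>y. norm (g y) \<partial>measure_pmf B))"
      by (simp add: norm_mult)
    then show "integrable (measure_pmf A) (\<lambda>x. \<integral>y. norm (case (x, y) of (x, y) \<Rightarrow> f x * g y) \<partial>measure_pmf B)"
      using f by simp
  qed
  have "measure_pmf.expectation (pair_pmf A B) (\<lambda>(x, y). f x * g y) = (\<integral>x. \<integral>y. f x * g y \<partial>measure_pmf B \<partial>measure_pmf A)"
    using integral_fst'[of "\<lambda>(x, y). f x * g y"] int by (simp add: pair_pmf_eq_pair_measure)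
  then show "measure_pmf.expectation (pair_pmf A B) (\<lambda>(x, y). f x * g y) =
           measure_pmf.expectation A f * measure_pmf.expectation B g"
    by simp
qed

lemma expectation_replicate_split:
  fixes f g :: "'a :: countable list \<Rightarrow> 'c :: {real_normed_field, banach, second_countable_topology}"
  assumes f: "integrable (replicate_pmf m p) f" and g: "integrable (replicate_pmf n p) g"
  shows "integrable (replicate_pmf (m + n) p) (\<lambda>xs. f (take m xs) * g (drop m xs))" (is ?A)
    and "measure_pmf.expectation (replicate_pmf (m + n) p) (\<lambda>xs. f (take m xs) * g (drop m xs)) =
           measure_pmf.expectation (replicate_pmf m p) f * measure_pmf.expectation (replicate_pmf n p) g" (is ?B)
proof -
  let ?P = "pair_pmf (replicate_pmf m p) (replicate_pmf n p)"
  let ?h = "\<lambda>xs. f (take m xs) * g (drop m xs)"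
  have AE: "AE z in ?P. ?h (case z of (xs, ys) \<Rightarrow> xs @ ys) = (case z of (xs, ys) \<Rightarrow> f xs * g ys)"
    by (auto simp: AE_measure_pmf_iff set_replicate_pmf)
  have "integrable ?P (\<lambda>z. ?h (case z of (xs, ys) \<Rightarrow> xs @ ys))"
    using expectation_pair_pmf_mult(1)[OF f g] AE by (subst integrable_cong_AE) auto
  then show ?A by (simp add: replicate_pmf_add)
  have "measure_pmf.expectation (replicate_pmf (m + n) p) ?h = measure_pmf.expectation ?P (\<lambda>z. ?h (case z of (xs, ys) \<Rightarrow> xs @ ys))"
    by (simp add: replicate_pmf_add)
  also have "\<dots> = measure_pmf.expectation ?P (\<lambda>(xs, ys). f xs * g ys)"
    by (intro integral_cong_AE AE) auto
  finally show ?B using expectation_pair_pmf_mult(2)[OF f g] by simp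
qed

section \<open>Characteristic functions\<close>

text \<open>One positive \<open>k0\<close> already makes \<open>\<alpha>\<close> rational. In lowest
  terms its denominator divides every element of \<open>A\<close>, hence their gcd; \<open>A\<close>
  may be infinite.\<close>

lemma Gcd_mult_Ints:
  fixes \<alpha> :: real and A :: "nat set"
  assumes A: "\<And>k. k \<in> A \<Longrightarrow> \<alpha> * real k \<in> \<int>" and ne: "k0 \<in> A" "k0 > 0"
  shows "\<alpha> * real (Gcd A) \<in> \<int>"
proof -
  have "\<alpha> * real k0 \<in> \<rat>" using A[OF ne(1)] Ints_subset_Rats by blast
  then have "\<alpha> * real k0 / real k0 \<in> \<rat>" by (intro Rats_divide) auto
  then have "\<alpha> \<in> \<rat>" using ne by simp
  then obtain a b where b: "b > 0" "coprime a b" and \<alpha>: "\<alpha> = of_int a / of_int b"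
    by (elim Rats_cases') auto
  have "nat b dvd k" if k: "k \<in> A" for k
  proof -
    obtain z where "\<alpha> * real k = of_int z" using A[OF k] by (elim Ints_cases)
    then have "real_of_int (a * int k) = real_of_int (b * z)" using b by (simp add: \<alpha> field_simps)
    then have "a * int k = b * z" by (simp only: of_int_eq_iff)
    then have "b dvd a * int k" by simp
    then have "b dvd int k" using b by (simp add: coprime_dvd_mult_right_iff coprime_commute)
    then show ?thesis using b by (simp add: nat_dvd_iff)
  qed
  then have "nat b dvd Gcd A" by (rule Gcd_greatest)
  then obtain m where "Gcd A = nat b * m" by blast
  then have "\<alpha> * real (Gcd A) = of_int (a * int m)" using b by (simp add: \<alpha>)
  then show ?thesis by (metis Ints_of_int)
qed

text \<open>The constant is 1/2 - 1/6: the quadratic Taylor term minus the cubic error, where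
  \<open>\<bar>x\<bar> ^ 3\<close> is at most the square.\<close>

lemma one_minus_cos_ge: "\<bar>x\<bar> \<le> 1 \<Longrightarrow> 1 - cos x \<ge> x\<^sup>2 / (3::real)"
proof -
  assume x: "\<bar>x\<bar> \<le> 1"
  have "\<bar>Re (iexp x - (\<Sum>k\<le>2. (\<i> * x) ^ k / fact k))\<bar> \<le> \<bar>x\<bar> ^ Suc 2 / fact (Suc 2)"
    by (rule order_trans[OF abs_Re_le_cmod iexp_approx1])
  then have "\<bar>cos x - (1 - x\<^sup>2 / 2)\<bar> \<le> \<bar>x\<bar> ^ 3 / 6"
    by (simp add: eval_nat_numeral Re_exp)
  moreover have "\<bar>x\<bar> ^ 3 \<le> x\<^sup>2"
    using power_decreasing[of 2 3 "\<bar>x\<bar>"] x by simp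
  ultimately show ?thesis by linarith
qed

lemma integrable_iexp_pmf [simp]: "integrable (measure_pmf M) (\<lambda>x. iexp (f x))"
  by (rule measure_pmf.integrable_const_bound[of _ 1]) auto

lemma norm_expectation_iexp_le_1: "norm (measure_pmf.expectation M (\<lambda>x. iexp (f x))) \<le> 1"
proof -
  have "norm (measure_pmf.expectation M (\<lambda>x. iexp (f x))) \<le> measure_pmf.expectation M (\<lambda>x. norm (iexp (f x)))"
    by (rule integral_norm_bound)
  then show ?thesis by simp
qed

text \<open>The two atoms enter with different phases and partly cancel, which costs the stated
  amount of modulus; all remaining mass is estimated by its total.\<close>

lemma norm_charfun_two_atoms:
  assumes "a \<noteq> b"
  shows "norm (measure_pmf.expectation M (\<lambda>x. iexp (f x))) \<le> 1 - pmf M a * pmf M b * (1 - cos (f a - f b))"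
proof -
  let ?s = "pmf M a + pmf M b" and ?q = "pmf M a * pmf M b * (1 - cos (f a - f b))"
  let ?A = "{a, b}"
  have s: "measure_pmf.prob M ?A = ?s" using assms by (simp add: measure_measure_pmf_finite)
  have s1: "?s \<le> 1" using measure_pmf.prob_le_1[of M ?A] s by simp
  have q0: "?q \<ge> 0" by simp
  have "?q \<le> pmf M a * pmf M b * 2" by (intro mult_left_mono) (use cos_ge_minus_one[of "f a - f b"] in auto)
  also have "\<dots> \<le> ?s * ?s" by (simp add: field_simps)
  also have "\<dots> \<le> ?s" using s1 mult_left_mono[OF s1, of ?s] by simp
  finally have qs: "?q \<le> ?s" .
  let ?z = "of_real (pmf M a) * iexp (f a) + of_real (pmf M b) * iexp (f b)"
  have "measure_pmf.expectation M (\<lambda>x. iexp (f x)) =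
     measure_pmf.expectation M (\<lambda>x. indicator ?A x *\<^sub>R iexp (f x)) + measure_pmf.expectation M (\<lambda>x. indicator (- ?A) x *\<^sub>R iexp (f x))"
    by (subst Bochner_Integration.integral_add[symmetric])
      (auto intro!: measure_pmf.integrable_const_bound[of _ 1] Bochner_Integration.integral_cong simp: indicator_def)
  also have "measure_pmf.expectation M (\<lambda>x. indicator ?A x *\<^sub>R iexp (f x)) = (\<Sum>x\<in>?A. pmf M x *\<^sub>R (indicator ?A x *\<^sub>R iexp (f x)))"
    by (rule integral_measure_pmf) (auto simp: indicator_def split: if_splits)
  also have "\<dots> = ?z" using assms by (simp add: scaleR_conv_of_real)
  finally have eq: "measure_pmf.expectation M (\<lambda>x. iexp (f x)) =
     ?z + measure_pmf.expectation M (\<lambda>x. indicator (- ?A) x *\<^sub>R iexp (f x))" .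
  have "norm (measure_pmf.expectation M (\<lambda>x. iexp (f x))) \<le>
     norm ?z + norm (measure_pmf.expectation M (\<lambda>x. indicator (- ?A) x *\<^sub>R iexp (f x)))"
    unfolding eq by (rule norm_triangle_ineq)
  also have "norm (measure_pmf.expectation M (\<lambda>x. indicator (- ?A) x *\<^sub>R iexp (f x))) \<le>
      measure_pmf.expectation M (\<lambda>x. norm (indicator (- ?A) x *\<^sub>R iexp (f x)))"
    by (rule integral_norm_bound)
  also have "\<dots> = measure_pmf.prob M (- ?A)" by simp
  also have "\<dots> = 1 - ?s" using measure_pmf.prob_compl[of ?A M] by (simp add: s Compl_eq_Diff_UNIV)
  also have "norm ?z \<le> ?s - ?q"
  proof (rule power2_le_imp_le)
    have "(norm ?z)\<^sup>2 = (pmf M a * cos (f a) + pmf M b * cos (f b))\<^sup>2 + (pmf M a * sin (f a) + pmf M b * sin (f b))\<^sup>2"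
      by (simp add: cmod_power2 Re_exp Im_exp)
    also have "\<dots> = (pmf M a)\<^sup>2 * ((sin (f a))\<^sup>2 + (cos (f a))\<^sup>2) + (pmf M b)\<^sup>2 * ((sin (f b))\<^sup>2 + (cos (f b))\<^sup>2)
        + 2 * pmf M a * pmf M b * (cos (f a) * cos (f b) + sin (f a) * sin (f b))"
      by (simp add: power2_eq_square algebra_simps del: sin_cos_squared_add sin_cos_squared_add2 sin_cos_squared_add3)
    also have "\<dots> = ?s\<^sup>2 - 2 * ?q" by (simp add: cos_diff power2_eq_square algebra_simps)
    \<comment> \<open>The squared modulus lacks twice \<open>?q\<close>, while the square on the
      right lacks only twice \<open>?s * ?q\<close>; total mass at most 1 makes up for the
      difference.\<close>
    also have "\<dots> \<le> (?s - ?q)\<^sup>2"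
    proof -
      have "s\<^sup>2 - 2 * q \<le> (s - q)\<^sup>2" if "s * q \<le> 1 * q" for s q :: real
        using that zero_le_power2[of q] unfolding power2_diff by linarith
      then show ?thesis using mult_right_mono[OF s1 q0] .
    qed
    finally show "(norm ?z)\<^sup>2 \<le> (?s - ?q)\<^sup>2" .
  qed (use qs in simp)
  finally show ?thesis by simp
qed

text \<open>A central limit theorem for blocks: there are about \<open>n / K\<close> factors but the
  normalisation is by sqrt n, which puts \<open>K\<close> into the limiting exponent. Second moments
  suffice, because the Taylor error is a truncated third moment that vanishes by dominated
  convergence.\<close>

lemma charfun_power_tendsto:
  fixes M :: "'a pmf" and Y :: "'a \<Rightarrow> real"
  assumes sq: "integrable M (\<lambda>x. (Y x)\<^sup>2)" and EY: "measure_pmf.expectation M Y = 0" and K: "K > (0::nat)"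
  shows "(\<lambda>n. measure_pmf.expectation M (\<lambda>x. iexp (Y x / sqrt (real n))) ^ (n div K))
          \<longlonglongrightarrow> of_real (exp (- measure_pmf.expectation M (\<lambda>x. (Y x)\<^sup>2) / (2 * K)))"
proof -
  define v where "v = measure_pmf.expectation M (\<lambda>x. (Y x)\<^sup>2)"
  define D where "D = distr (measure_pmf M) borel Y"
  interpret D: real_distribution D
    unfolding D_def by (rule prob_space.real_distribution_distr[OF measure_pmf.prob_space_axioms]) simp
  have int1: "integrable M Y"
    by (rule measure_pmf.square_integrable_imp_integrable[OF _ sq]) simp
  have D1: "integrable D (\<lambda>x. x)" "D.expectation (\<lambda>x. x) = 0" "integrable D (\<lambda>x. x\<^sup>2)" "D.expectation (\<lambda>x. x\<^sup>2) = v"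
    using int1 sq EY by (simp_all add: D_def integrable_distr_eq integral_distr v_def)
  have v0: "v \<ge> 0" unfolding v_def by simp
  let ?z = "\<lambda>n. measure_pmf.expectation M (\<lambda>x. iexp (Y x / sqrt (real n)))"
  have z_char: "?z n = char D (1 / sqrt n)" for n
    unfolding char_def D_def by (subst integral_distr) auto
  \<comment> \<open>The comparison is with an exponential and not with
    \<open>1 - v / (2 * n)\<close>, because \<open>norm_power_diff\<close> wants both bases in the
    unit disc for every \<open>n > 0\<close>.\<close>
  define w where "w n = exp (- v / (2 * real n))" for n
  define h where "h n = D.expectation (\<lambda>x. min (6 * x\<^sup>2) (\<bar>1 / sqrt (real n)\<bar> * \<bar>x\<bar> ^ 3))" for n
  have h: "h \<longlonglongrightarrow> 0"
  proof -
    have "(\<lambda>n. min (6 * x\<^sup>2) (\<bar>1 / sqrt (real n)\<bar> * \<bar>x\<bar> ^ 3)) \<longlonglongrightarrow> 0" for x :: real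
    proof -
      have "(\<lambda>n. min (6 * x\<^sup>2) (\<bar>1 / sqrt (real n)\<bar> * \<bar>x\<bar> ^ 3)) \<longlonglongrightarrow> min (6 * x\<^sup>2) (\<bar>0\<bar> * \<bar>x\<bar> ^ 3)"
        by (intro tendsto_intros tendsto_divide_0[OF tendsto_const] filterlim_at_top_imp_at_infinity
            filterlim_compose[OF sqrt_at_top] filterlim_real_sequentially)
      then show ?thesis by (simp add: min_absorb2)
    qed
    then have "(\<lambda>n. h n) \<longlonglongrightarrow> D.expectation (\<lambda>x. 0)"
      unfolding h_def
      by (intro integral_dominated_convergence[where w = "\<lambda>x. 6 * x\<^sup>2"]) (simp_all add: D1)
    then show ?thesis by simp
  qed
  have bound: "norm (?z n ^ (n div K) - of_real (w n ^ (n div K))) \<le> h n / 6 + v\<^sup>2 / (4 * real n)" if n: "n > 0" for n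
  proof -
    have "norm (?z n - (1 - (1 / sqrt n)\<^sup>2 * v / 2)) \<le> ((1 / sqrt n)\<^sup>2 / 6) * h n"
      unfolding z_char h_def by (rule D.char_approx3) (use D1 in auto)
    then have 1: "norm (?z n - of_real (1 - v / (2 * n))) \<le> h n / (6 * n)"
      using n by (simp add: power_divide field_simps)
    have "\<bar>exp (- (v / (2 * n))) - (1 - v / (2 * n))\<bar> \<le> (v / (2 * n))\<^sup>2"
    proof -
      have x0: "v / (2 * n) \<ge> 0" using v0 by simp
      define x where "x = v / (2 * n)"
      have "x \<ge> 0" using x0 x_def by simp
      have "1 - x \<le> exp (- x)" using exp_ge_add_one_self[of "- x"] by simp
      moreover have "exp (- x) \<le> 1 - x + x\<^sup>2"
      proof -
        have "(1 + x) * exp (- x) \<le> exp x * exp (- x)" using exp_ge_add_one_self[of x] by (intro mult_right_mono) auto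
        then have "(1 + x) * exp (- x) \<le> 1" by (simp add: exp_minus)
        moreover have "1 \<le> (1 + x) * (1 - x + x\<^sup>2)" using \<open>x \<ge> 0\<close> by (simp add: algebra_simps power2_eq_square)
        ultimately have "(1 + x) * exp (- x) \<le> (1 + x) * (1 - x + x\<^sup>2)" by linarith
        then show ?thesis using \<open>x \<ge> 0\<close> by simp
      qed
      ultimately show ?thesis unfolding x_def[symmetric] by simp
    qed
    then have "norm (of_real (1 - v / (2 * n)) - of_real (w n) :: complex) \<le> (v / (2 * n))\<^sup>2"
      unfolding w_def by (simp flip: of_real_diff add: abs_minus_commute del: of_real_divide)
    with 1 have "norm (?z n - of_real (w n)) \<le> h n / (6 * n) + (v / (2 * n))\<^sup>2"
      by (rule norm_diff_triangle_le)
    moreover have "norm (?z n ^ (n div K) - of_real (w n) ^ (n div K)) \<le> (n div K) * norm (?z n - of_real (w n))"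
      by (rule norm_power_diff[OF norm_expectation_iexp_le_1]) (use v0 in \<open>auto simp: w_def\<close>)
    moreover have "(n div K) * norm (?z n - of_real (w n)) \<le> n * norm (?z n - of_real (w n))"
      by (intro mult_right_mono) auto
    moreover have "n * norm (?z n - of_real (w n)) \<le> n * (h n / (6 * n) + (v / (2 * n))\<^sup>2)"
      using calculation(1) by (intro mult_left_mono) auto
    moreover have "n * (h n / (6 * n) + (v / (2 * n))\<^sup>2) = h n / 6 + v\<^sup>2 / (4 * real n)"
      using n by (simp add: field_simps power2_eq_square)
    ultimately show ?thesis by (simp only: of_real_power)
  qed
  have "(\<lambda>n. h n / 6 + v\<^sup>2 / (4 * real n)) \<longlonglongrightarrow> 0 / 6 + 0"
  proof (intro tendsto_intros h)
    show "(\<lambda>n. v\<^sup>2 / (4 * real n)) \<longlonglongrightarrow> 0"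
      using lim_const_over_n[of "v\<^sup>2 / 4"] by (simp only: divide_divide_eq_left)
  qed simp
  then have "(\<lambda>n. ?z n ^ (n div K) - of_real (w n ^ (n div K))) \<longlonglongrightarrow> 0"
    using Lim_null_comparison[OF eventually_mono[OF eventually_gt_at_top[of 0] bound]] by simp
  moreover have "(\<lambda>n. complex_of_real (w n ^ (n div K))) \<longlonglongrightarrow> of_real (exp (- v / (2 * K)))"
  proof (rule tendsto_of_real)
    have "(\<lambda>n. real (n div K) / real n) \<longlonglongrightarrow> 1 / real K"
    proof (rule tendsto_sandwich)
      show "\<forall>\<^sub>F n in sequentially. 1 / real K - 1 / real n \<le> real (n div K) / real n"
      proof (rule eventually_sequentiallyI[of 1])
        fix n :: nat assume n: "n \<ge> 1"
        have "n < K * (n div K) + K" using K dividend_less_times_div[of K n] by simp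
        then have "real n < real K * real (n div K) + real K" by (metis of_nat_add of_nat_less_iff of_nat_mult)
        then have "real n / real K - 1 \<le> real (n div K)" using K by (simp add: field_simps)
        then have "(real n / real K - 1) / real n \<le> real (n div K) / real n" by (rule divide_right_mono) simp
        moreover have "(real n / real K - 1) / real n = 1 / real K - 1 / real n" using n by (simp add: field_simps)
        ultimately show "1 / real K - 1 / real n \<le> real (n div K) / real n" by simp
      qed
      show "\<forall>\<^sub>F n in sequentially. real (n div K) / real n \<le> 1 / real K"
      proof (rule eventually_sequentiallyI[of 1])
        fix n :: nat assume n: "n \<ge> 1"
        have "real (n div K) \<le> real n / real K" by (rule of_nat_div_le_of_nat)
        then have "real (n div K) / real n \<le> real n / real K / real n" by (rule divide_right_mono) simp
        then show "real (n div K) / real n \<le> 1 / real K" using n by simp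
      qed
    next
      show "(\<lambda>n. 1 / real K - 1 / real n) \<longlonglongrightarrow> 1 / real K"
        using tendsto_diff[OF tendsto_const lim_const_over_n[of 1]] by simp
    qed simp
    then have "(\<lambda>n. exp ((- v / 2) * (real (n div K) / real n))) \<longlonglongrightarrow> exp ((- v / 2) * (1 / real K))"
      by (rule tendsto_exp[OF tendsto_mult[OF tendsto_const]])
    moreover have "exp ((- v / 2) * (real (n div K) / real n)) = w n ^ (n div K)" for n
      unfolding w_def exp_of_nat_mult[symmetric] by (simp add: field_simps)
    ultimately show "(\<lambda>n. w n ^ (n div K)) \<longlonglongrightarrow> exp (- v / (2 * K))" by simp
  qed
  ultimately show ?thesis unfolding v_def[symmetric] by (rule Lim_transform[rotated])
qed

section \<open>Lattice span and characteristic function of the offspring law\<close>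

locale critical_offspring =
  fixes p :: "nat pmf"
  assumes square_integrable: "integrable (measure_pmf p) (\<lambda>k. (real k)\<^sup>2)"
    and mean: "measure_pmf.expectation p real = 1"
    and variance_pos: "measure_pmf.variance p real > 0"
begin

definition "\<sigma>2 = measure_pmf.variance p real"

lemma \<sigma>2_pos: "\<sigma>2 > 0" using variance_pos by (simp add: \<sigma>2_def)

lemma integrable_real: "integrable p real"
  by (rule measure_pmf.square_integrable_imp_integrable[OF _ square_integrable]) simp

text \<open>Mean one without the value 0 would force exactly one child almost surely, against
  positive variance.\<close>

lemma zero_in_support: "0 \<in> set_pmf p"
proof (rule ccontr)
  assume "0 \<notin> set_pmf p"
  then have nn: "AE k in p. real k - 1 \<ge> 0"
    by (auto simp: AE_measure_pmf_iff Suc_le_eq intro!: Nat.gr0I)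
  have int: "integrable p (\<lambda>k. real k - 1)" using integrable_real by simp
  have "measure_pmf.expectation p (\<lambda>k. real k - 1) = 0" using integrable_real mean by simp
  then have "AE k in p. real k - 1 = 0" using integral_nonneg_eq_0_iff_AE[OF int nn] by simp
  then have "measure_pmf.variance p real = measure_pmf.expectation p (\<lambda>k. 0)"
    unfolding mean by (intro integral_cong_AE) (auto simp: AE_measure_pmf_iff)
  then show False using variance_pos by simp
qed

lemma ex_positive_in_support: "\<exists>k\<in>set_pmf p. k > 0"
proof (rule ccontr)
  assume "\<not> ?thesis"
  then have "measure_pmf.expectation p real = measure_pmf.expectation p (\<lambda>k. 0)"
    by (intro integral_cong_AE) (auto simp: AE_measure_pmf_iff)
  then show False using mean by simp
qed

text \<open>Since 0 lies in the support, the gcd of the values is also the gcd of their differences,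
  that is, the span of the step lattice.\<close>

definition period :: nat where "period = Gcd (set_pmf p)"

lemma period_dvd: "k \<in> set_pmf p \<Longrightarrow> period dvd k"
  unfolding period_def by (rule Gcd_dvd)

lemma period_pos: "period > 0"
  using ex_positive_in_support period_dvd by (metis dvd_0_left_iff neq0_conv)

text \<open>Division by the span makes any two possible steps differ by an integer, so that the
  frequencies range over \<open>{-pi..pi}\<close> for every offspring law.\<close>

definition step :: "nat \<Rightarrow> real" where "step k = (real k - 1) / real period"

definition \<phi> :: "real \<Rightarrow> complex" where "\<phi> \<theta> = measure_pmf.expectation p (\<lambda>k. iexp (\<theta> * step k))"

lemma norm_\<phi>_le: "k > 0 \<Longrightarrow> norm (\<phi> \<theta>) \<le> 1 - pmf p k * pmf p 0 * (1 - cos (\<theta> * real k / real period))"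
  using norm_charfun_two_atoms[of k 0 p "\<lambda>k. \<theta> * step k"]
  by (simp add: \<phi>_def step_def diff_divide_distrib algebra_simps)

lemma norm_\<phi>_le_1: "norm (\<phi> \<theta>) \<le> 1"
  unfolding \<phi>_def by (rule norm_expectation_iexp_le_1)

text \<open>Modulus one would align the phase of every atom with that of the atom 0, hence, through
  the gcd, make \<open>\<theta>\<close> a multiple of 2 pi. The absence of such frequencies is the
  aperiodicity of the rescaled steps.\<close>

lemma norm_\<phi>_less_1: "norm (\<phi> \<theta>) < 1" if "\<theta> \<noteq> 0" "\<bar>\<theta>\<bar> \<le> pi"
proof (rule ccontr)
  assume "\<not> norm (\<phi> \<theta>) < 1"
  then have 1: "norm (\<phi> \<theta>) \<ge> 1" by simp
  have "\<theta> / (2 * pi * period) * real k \<in> \<int>" if k: "k \<in> set_pmf p" for k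
  proof (cases "k = 0")
    case False
    have "pmf p k * pmf p 0 > 0" using k zero_in_support by (simp add: pmf_positive)
    moreover have "pmf p k * pmf p 0 * (1 - cos (\<theta> * real k / real period)) \<le> 0"
      using norm_\<phi>_le[of k \<theta>] 1 False by simp
    ultimately have "1 - cos (\<theta> * real k / real period) \<le> 0"
      using mult_pos_pos[of "pmf p k * pmf p 0" "1 - cos (\<theta> * real k / real period)"] by linarith
    then have "cos (\<theta> * real k / real period) = 1" using cos_le_one[of "\<theta> * real k / real period"] by linarith
    then obtain m :: int where "\<theta> * real k / real period = real_of_int m * 2 * pi"
      using cos_one_2pi_int[THEN iffD1] by blast
    then have "\<theta> / (2 * pi * period) * real k = m" using period_pos by (simp add: field_simps)
    then show ?thesis by simp
  qed simp
  then have "\<theta> / (2 * pi * period) * real period \<in> \<int>"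
  proof -
    assume *: "\<theta> / (2 * pi * period) * real k \<in> \<int>" if "k \<in> set_pmf p" for k
    obtain k0 where "k0 \<in> set_pmf p" "k0 > 0" using ex_positive_in_support by blast
    from Gcd_mult_Ints[OF * this] show ?thesis by (simp add: period_def)
  qed
  then obtain z :: int where "\<theta> / (2 * pi * period) * real period = z" by (elim Ints_cases)
  then have z: "\<theta> = 2 * pi * z" using period_pos by (simp add: field_simps)
  then have "2 * pi * \<bar>real_of_int z\<bar> \<le> pi" using that(2) by (simp add: abs_mult)
  then have "pi * (2 * \<bar>real_of_int z\<bar>) \<le> pi * 1" by (simp add: ac_simps)
  then have "2 * \<bar>real_of_int z\<bar> \<le> 1" by (rule mult_left_le_imp_le) simp
  then have "z = 0" by linarith
  then show False using z that by simp
qed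

lemma continuous_\<phi>: "continuous_on A \<phi>"
proof -
  interpret D: real_distribution "distr (measure_pmf p) borel step"
    by (rule prob_space.real_distribution_distr[OF measure_pmf.prob_space_axioms]) simp
  have "\<phi> = char (distr (measure_pmf p) borel step)"
    unfolding char_def by (intro ext, subst integral_distr) (auto simp: \<phi>_def)
  then show ?thesis using D.isCont_char by (simp add: continuous_at_imp_continuous_on)
qed

text \<open>Near 0 the two-atom bound decays quadratically; on the compact rest \<open>S\<close> the
  modulus stays below 1 by continuity. The threshold \<open>1 / r\<close> is where
  \<open>one_minus_cos_ge\<close> stops applying, and it may exceed pi, in which case
  \<open>S\<close> is empty.\<close>

lemma \<phi>_gaussian_bound: "\<exists>c>0. \<forall>\<theta>. \<bar>\<theta>\<bar> \<le> pi \<longrightarrow> norm (\<phi> \<theta>) \<le> exp (- c * \<theta>\<^sup>2)"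
proof -
  obtain k where k: "k \<in> set_pmf p" "k > 0" using ex_positive_in_support by blast
  define q where "q = pmf p k * pmf p 0"
  have q: "q > 0" using k zero_in_support by (simp add: q_def pmf_positive)
  define r where "r = real k / real period"
  have r: "r > 0" using k period_pos by (simp add: r_def)
  have near: "norm (\<phi> \<theta>) \<le> 1 - q * r\<^sup>2 / 3 * \<theta>\<^sup>2" if "\<bar>\<theta>\<bar> \<le> 1 / r" for \<theta>
  proof -
    have "\<bar>\<theta> * r\<bar> \<le> 1" using that r by (simp add: abs_mult field_simps)
    then have "(\<theta> * r)\<^sup>2 / 3 \<le> 1 - cos (\<theta> * r)" by (rule one_minus_cos_ge)
    then have "q * ((\<theta> * r)\<^sup>2 / 3) \<le> q * (1 - cos (\<theta> * r))" using q by simp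
    moreover have "norm (\<phi> \<theta>) \<le> 1 - q * (1 - cos (\<theta> * r))"
      using norm_\<phi>_le[OF k(2), of \<theta>] by (simp add: q_def r_def)
    moreover have "q * ((\<theta> * r)\<^sup>2 / 3) = q * r\<^sup>2 / 3 * \<theta>\<^sup>2" by (simp add: power_mult_distrib)
    ultimately show ?thesis by linarith
  qed
  define S where "S = {\<theta>. 1 / r \<le> \<bar>\<theta>\<bar> \<and> \<bar>\<theta>\<bar> \<le> pi}"
  have "closed S" unfolding S_def by (intro closed_Collect_conj closed_Collect_le continuous_intros)
  moreover have "bounded S" unfolding S_def by (rule boundedI[of _ pi]) auto
  ultimately have S: "compact S" by (simp add: compact_eq_bounded_closed)
  obtain \<eta> where \<eta>: "\<eta> > 0" "\<And>\<theta>. \<theta> \<in> S \<Longrightarrow> norm (\<phi> \<theta>) \<le> 1 - \<eta>"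
  proof (cases "S = {}")
    case False
    have "continuous_on S (\<lambda>\<theta>. norm (\<phi> \<theta>))" by (intro continuous_intros continuous_\<phi>)
    from continuous_attains_sup[OF S False this]
    obtain \<theta>0 where \<theta>0: "\<theta>0 \<in> S" "\<And>\<theta>. \<theta> \<in> S \<Longrightarrow> norm (\<phi> \<theta>) \<le> norm (\<phi> \<theta>0)" by blast
    have "norm (\<phi> \<theta>0) < 1" using \<theta>0(1) r by (intro norm_\<phi>_less_1) (auto simp: S_def)
    then show ?thesis using \<theta>0 by (intro that[of "1 - norm (\<phi> \<theta>0)"]) auto
  qed (auto intro: that[of 1])
  define c where "c = min (q * r\<^sup>2 / 3) (\<eta> / pi\<^sup>2)"
  have c: "c > 0" using q r \<eta> by (simp add: c_def)
  have "norm (\<phi> \<theta>) \<le> exp (- c * \<theta>\<^sup>2)" if \<theta>: "\<bar>\<theta>\<bar> \<le> pi" for \<theta>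
  proof -
    have "norm (\<phi> \<theta>) \<le> 1 - c * \<theta>\<^sup>2"
    proof (cases "\<bar>\<theta>\<bar> \<le> 1 / r")
      case True
      have "c \<le> q * r\<^sup>2 / 3" unfolding c_def by (rule min.cobounded1)
      then have "c * \<theta>\<^sup>2 \<le> q * r\<^sup>2 / 3 * \<theta>\<^sup>2" by (intro mult_right_mono) auto
      then show ?thesis using near[OF True] by linarith
    next
      case False
      have "c \<le> \<eta> / pi\<^sup>2" unfolding c_def by (rule min.cobounded2)
      then have "c * \<theta>\<^sup>2 \<le> \<eta> / pi\<^sup>2 * \<theta>\<^sup>2" by (intro mult_right_mono) auto
      also have "\<theta>\<^sup>2 \<le> pi\<^sup>2" using \<theta> by (metis abs_le_square_iff abs_of_nonneg pi_ge_zero)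
      then have "\<eta> / pi\<^sup>2 * \<theta>\<^sup>2 \<le> \<eta> / pi\<^sup>2 * pi\<^sup>2" using \<eta> by (intro mult_left_mono) auto
      also have "\<dots> = \<eta>" by simp
      finally show ?thesis using \<eta>(2)[of \<theta>] False \<theta> by (simp add: S_def)
    qed
    also have "\<dots> \<le> exp (- c * \<theta>\<^sup>2)" using exp_ge_add_one_self[of "- c * \<theta>\<^sup>2"] by simp
    finally show ?thesis .
  qed
  then show ?thesis using c by blast
qed

end

section \<open>Fourier inversion for block functionals\<close>

lemma integral_iexp_period:
  "(\<integral>\<theta>. indicator {-pi..pi} \<theta> *\<^sub>R iexp (\<theta> * real_of_int z) \<partial>lborel) = (if z = 0 then 2 * pi else 0)"
proof (cases "z = 0")
  case True
  then show ?thesis by (simp add: scaleR_conv_of_real)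
next
  case False
  let ?F = "\<lambda>\<theta>. iexp (\<theta> * real_of_int z) / (\<i> * of_int z)"
  have "(\<integral>\<theta>. indicator {-pi..pi} \<theta> *\<^sub>R iexp (\<theta> * real_of_int z) \<partial>lborel) = ?F pi - ?F (- pi)"
  proof (rule integral_FTC_Icc)
    fix x :: real
    have "((\<lambda>\<theta>. exp (\<i> * of_real \<theta> * of_int z) / (\<i> * of_int z)) has_vector_derivative exp (\<i> * of_real x * of_int z)) (at x within {-pi..pi})"
      using False by (auto intro!: derivative_eq_intros has_vector_derivative_real_field simp: field_simps)
    then show "(?F has_vector_derivative iexp (x * real_of_int z)) (at x within {-pi..pi})"
      by (simp add: mult.assoc)
  qed (auto intro!: continuous_intros)
  also have "iexp (pi * real_of_int z) = iexp (- pi * real_of_int z)"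
  proof -
    have "sin (pi * real_of_int z) = 0" by (metis sin_zero_iff_int2 mult.commute)
    then show ?thesis by (simp add: complex_eq_iff Re_exp Im_exp)
  qed
  finally show ?thesis using False by simp
qed

lemma expectation_replicate_Suc:
  fixes f :: "'a :: countable \<Rightarrow> 'c :: {real_normed_field, banach, second_countable_topology}"
  assumes f: "integrable (measure_pmf p) f" and g: "integrable (measure_pmf (replicate_pmf n p)) g"
  shows "integrable (replicate_pmf (Suc n) p) (\<lambda>xs. f (hd xs) * g (tl xs))" (is ?A)
    and "measure_pmf.expectation (replicate_pmf (Suc n) p) (\<lambda>xs. f (hd xs) * g (tl xs)) =
           measure_pmf.expectation p f * measure_pmf.expectation (replicate_pmf n p) g" (is ?B)
proof -
  have eq: "replicate_pmf (Suc n) p = map_pmf (\<lambda>(x, xs). x # xs) (pair_pmf p (replicate_pmf n p))"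
    by (simp add: pair_pmf_def map_bind_pmf)
  show ?A ?B using expectation_pair_pmf_mult[OF f g] unfolding eq by (simp_all add: case_prod_unfold)
qed

context critical_offspring
begin

definition "\<tau> = \<sigma>2 / (real period)\<^sup>2"

lemma \<tau>_pos: "\<tau> > 0" using \<sigma>2_pos period_pos by (simp add: \<tau>_def)

lemma integrable_step: "integrable p step" "integrable p (\<lambda>k. (step k)\<^sup>2)"
  and expectation_step: "measure_pmf.expectation p step = 0"
  and expectation_step_square: "measure_pmf.expectation p (\<lambda>k. (step k)\<^sup>2) = \<tau>"
proof -
  have eq: "step = (\<lambda>k. (real k - 1) / real period)" "(\<lambda>k. (step k)\<^sup>2) = (\<lambda>k. (real k - 1)\<^sup>2 / (real period)\<^sup>2)"
    by (auto simp: step_def power_divide fun_eq_iff)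
  have int2: "integrable p (\<lambda>k. (real k - 1)\<^sup>2)"
    using square_integrable integrable_real unfolding power2_diff by simp
  show "integrable p step" unfolding eq(1) using integrable_real by simp
  show "integrable p (\<lambda>k. (step k)\<^sup>2)" unfolding eq(2) using int2 by simp
  show "measure_pmf.expectation p step = 0" unfolding eq(1) using integrable_real mean by simp
  show "measure_pmf.expectation p (\<lambda>k. (step k)\<^sup>2) = \<tau>" unfolding eq(2) by (simp add: \<tau>_def \<sigma>2_def mean)
qed

definition walk :: "nat list \<Rightarrow> real" where "walk xs = (\<Sum>x\<leftarrow>xs. step x)"

lemma walk_eq: "walk xs = (real (sum_list xs) - real (length xs)) / real period"
  by (induction xs) (auto simp: walk_def step_def add_divide_distrib diff_divide_distrib)

lemma walk_append [simp]: "walk (xs @ ys) = walk xs + walk ys"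
  by (simp add: walk_def)

lemma walk_Nil [simp]: "walk [] = 0" and walk_Cons [simp]: "walk (x # xs) = step x + walk xs"
  by (simp_all add: walk_def)

lemma integrable_walk: "integrable (replicate_pmf n p) walk" "integrable (replicate_pmf n p) (\<lambda>xs. (walk xs)\<^sup>2)"
  and expectation_walk: "measure_pmf.expectation (replicate_pmf n p) walk = 0"
  and expectation_walk_square: "measure_pmf.expectation (replicate_pmf n p) (\<lambda>xs. (walk xs)\<^sup>2) = real n * \<tau>"
proof (induction n)
  case 0
  { case 1 show ?case by (simp add: integrable_measure_pmf_finite) }
  { case 2 show ?case by (simp add: integrable_measure_pmf_finite) }
  { case 3 show ?case by simp }
  { case 4 show ?case by simp }
next
  case (Suc n)
  let ?P = "replicate_pmf (Suc n) p"
  have AE1: "AE xs in ?P. step (hd xs) * 1 + 1 * walk (tl xs) = walk xs"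
    by (auto simp: AE_measure_pmf_iff set_replicate_pmf length_Suc_conv)
  have AE2: "AE xs in ?P. (step (hd xs))\<^sup>2 * 1 + 2 * (step (hd xs) * walk (tl xs)) + 1 * (walk (tl xs))\<^sup>2 = (walk xs)\<^sup>2"
    using AE1 by eventually_elim (drule sym, simp add: power2_eq_square algebra_simps)
  have c: "integrable p (\<lambda>_. 1 :: real)" "integrable (replicate_pmf n p) (\<lambda>_. 1 :: real)" by simp_all
  note a = expectation_replicate_Suc[OF integrable_step(1) c(2)] 
  note b = expectation_replicate_Suc[OF c(1) Suc(1)]
  note aa = expectation_replicate_Suc[OF integrable_step(2) c(2)]
  note ab = expectation_replicate_Suc[OF integrable_step(1) Suc(1)]
  note bb = expectation_replicate_Suc[OF c(1) Suc(2)]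
  have i1: "integrable ?P (\<lambda>xs. step (hd xs) * 1 + 1 * walk (tl xs))"
    using a(1) b(1) by (intro Bochner_Integration.integrable_add)
  have i2: "integrable ?P (\<lambda>xs. (step (hd xs))\<^sup>2 * 1 + 2 * (step (hd xs) * walk (tl xs)) + 1 * (walk (tl xs))\<^sup>2)"
    by (intro Bochner_Integration.integrable_add integrable_mult_right aa(1) bb(1) ab(1))
  { case 1 show ?case using i1 by (subst integrable_cong_AE[OF _ _ AE1, symmetric]) (simp_all del: replicate_pmf.simps) }
  { case 2 show ?case using i2 by (subst integrable_cong_AE[OF _ _ AE2, symmetric]) (simp_all del: replicate_pmf.simps) }
  { case 3
    have "measure_pmf.expectation ?P walk = measure_pmf.expectation ?P (\<lambda>xs. step (hd xs) * 1 + 1 * walk (tl xs))"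
      by (intro integral_cong_AE) (use AE1 in auto)
    also have "\<dots> = measure_pmf.expectation ?P (\<lambda>xs. step (hd xs) * 1) + measure_pmf.expectation ?P (\<lambda>xs. 1 * walk (tl xs))"
      by (intro Bochner_Integration.integral_add a(1) b(1))
    also have "\<dots> = 0" unfolding a(2) b(2) by (simp add: expectation_step Suc)
    finally show ?case . }
  { case 4
    have "measure_pmf.expectation ?P (\<lambda>xs. (walk xs)\<^sup>2) = measure_pmf.expectation ?P (\<lambda>xs. (step (hd xs))\<^sup>2 * 1 + 2 * (step (hd xs) * walk (tl xs)) + 1 * (walk (tl xs))\<^sup>2)"
      by (intro integral_cong_AE) (use AE2 in auto)
    also have "\<dots> = measure_pmf.expectation ?P (\<lambda>xs. (step (hd xs))\<^sup>2 * 1 + 2 * (step (hd xs) * walk (tl xs))) + measure_pmf.expectation ?P (\<lambda>xs. 1 * (walk (tl xs))\<^sup>2)"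
      by (intro Bochner_Integration.integral_add Bochner_Integration.integrable_add integrable_mult_right aa(1) bb(1) ab(1))
    also have "measure_pmf.expectation ?P (\<lambda>xs. (step (hd xs))\<^sup>2 * 1 + 2 * (step (hd xs) * walk (tl xs))) =
       measure_pmf.expectation ?P (\<lambda>xs. (step (hd xs))\<^sup>2 * 1) + measure_pmf.expectation ?P (\<lambda>xs. 2 * (step (hd xs) * walk (tl xs)))"
      by (intro Bochner_Integration.integral_add integrable_mult_right aa(1) ab(1))
    also have "measure_pmf.expectation ?P (\<lambda>xs. 2 * (step (hd xs) * walk (tl xs))) = 2 * (measure_pmf.expectation ?P (\<lambda>xs. step (hd xs) * walk (tl xs)))"
      by (rule integral_mult_right_zero)
    finally show ?case unfolding aa(2) bb(2) ab(2)
      by (simp add: expectation_step expectation_step_square Suc algebra_simps del: replicate_pmf.simps) }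
qed

lemma period_dvd_sum_list:
  assumes "xs \<in> set_pmf (replicate_pmf n p)"
  shows "period dvd sum_list xs"
proof -
  have "\<forall>x\<in>set xs. period dvd x" using assms period_dvd by (auto simp: set_replicate_pmf)
  then show ?thesis by (induction xs) auto
qed

text \<open>Orthogonality of characters under the expectation. Both \<open>x\<close> and the
  possible sums are multiples of the span, so the exponent is an integer multiple of
  \<open>\<theta>\<close>; the bound on \<open>f\<close> justifies the exchange of
  integrals.\<close>

lemma fourier_inversion:
  assumes x: "period dvd x" and f: "\<And>xs. norm (f xs) \<le> (1 :: real)"
  shows "measure_pmf.expectation (replicate_pmf n p) (\<lambda>xs. indicator {xs. sum_list xs = x} xs *\<^sub>R (f xs :: complex)) * (2 * pi) =
    (\<integral>\<theta>. indicator {-pi..pi} \<theta> *\<^sub>R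
        measure_pmf.expectation (replicate_pmf n p) (\<lambda>xs. f xs * iexp (\<theta> * ((real (sum_list xs) - real x) / real period))) \<partial>lborel)"
proof -
  let ?P = "replicate_pmf n p"
  let ?g = "\<lambda>xs. (real (sum_list xs) - real x) / real period"
  let ?h = "\<lambda>xs \<theta>. indicator {-pi..pi} \<theta> *\<^sub>R (f xs * iexp (\<theta> * ?g xs))"
  interpret pair_sigma_finite "measure_pmf ?P" lborel ..
  have inner: "(\<integral>\<theta>. ?h xs \<theta> \<partial>lborel) = indicator {xs. sum_list xs = x} xs *\<^sub>R f xs * (2 * pi)"
    if xs: "xs \<in> set_pmf ?P" for xs
  proof -
    obtain a b where a: "sum_list xs = period * a" and b: "x = period * b"
      using x period_dvd_sum_list[OF xs] by blast
    have g: "?g xs = real_of_int (int a - int b)"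
      using period_pos by (simp add: a b field_simps)
    have "(\<integral>\<theta>. ?h xs \<theta> \<partial>lborel) = (\<integral>\<theta>. f xs * (indicator {-pi..pi} \<theta> *\<^sub>R iexp (\<theta> * real_of_int (int a - int b))) \<partial>lborel)"
      unfolding g by (simp add: mult_scaleR_right)
    also have "\<dots> = f xs * (if int a - int b = 0 then 2 * pi else 0)"
      unfolding integral_mult_right_zero integral_iexp_period ..
    finally show ?thesis using period_pos by (auto simp: a b)
  qed
  have int: "integrable (measure_pmf ?P \<Otimes>\<^sub>M lborel) (\<lambda>(xs, \<theta>). ?h xs \<theta>)"
  proof (rule Fubini_integrable)
    show "(\<lambda>(xs, \<theta>). ?h xs \<theta>) \<in> borel_measurable (measure_pmf ?P \<Otimes>\<^sub>M lborel)"
      by measurable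
    have "(\<lambda>xs. \<integral>\<theta>. norm (case (xs, \<theta>) of (xs, \<theta>) \<Rightarrow> ?h xs \<theta>) \<partial>lborel) = (\<lambda>xs. norm (f xs) * (\<integral>\<theta>. indicator {-pi..pi} \<theta> \<partial>lborel))"
      by (simp add: norm_mult mult.commute)
    then show "integrable (measure_pmf ?P) (\<lambda>xs. \<integral>\<theta>. norm (case (xs, \<theta>) of (xs, \<theta>) \<Rightarrow> ?h xs \<theta>) \<partial>lborel)"
      using f by (auto intro!: measure_pmf.integrable_const_bound[of _ 1])
    show "AE xs in measure_pmf ?P. integrable lborel (\<lambda>\<theta>. case (xs, \<theta>) of (xs, \<theta>) \<Rightarrow> ?h xs \<theta>)"
    proof (rule AE_I2)
      fix xs
      have "integrable lborel (\<lambda>\<theta>. indicator {-pi..pi} \<theta> *\<^sub>R (f xs * iexp (\<theta> * ?g xs)))"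
        using period_pos by (intro borel_integrable_compact) (auto intro!: continuous_intros)
      then show "integrable lborel (\<lambda>\<theta>. case (xs, \<theta>) of (xs, \<theta>) \<Rightarrow> ?h xs \<theta>)" by simp
    qed
  qed
  have "(\<integral>\<theta>. (\<integral>xs. ?h xs \<theta> \<partial>measure_pmf ?P) \<partial>lborel) = (\<integral>xs. (\<integral>\<theta>. ?h xs \<theta> \<partial>lborel) \<partial>measure_pmf ?P)"
    by (rule Fubini_integral[OF int])
  also have "\<dots> = (\<integral>xs. indicator {xs. sum_list xs = x} xs *\<^sub>R f xs * (2 * pi) \<partial>measure_pmf ?P)"
  proof (intro integral_cong_AE)
    show "AE xs in ?P. (\<integral>\<theta>. ?h xs \<theta> \<partial>lborel) = indicator {xs. sum_list xs = x} xs *\<^sub>R f xs * (2 * pi)"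
      unfolding AE_measure_pmf_iff using inner by blast
  qed auto
  also have "\<dots> = measure_pmf.expectation ?P (\<lambda>xs. indicator {xs. sum_list xs = x} xs *\<^sub>R f xs) * (2 * pi)"
    by (rule integral_mult_left_zero)
  finally show ?thesis by simp
qed

end

primrec block_sum :: "('a list \<Rightarrow> real) \<Rightarrow> nat \<Rightarrow> nat \<Rightarrow> 'a list \<Rightarrow> real" where
  "block_sum B K 0 xs = 0"
| "block_sum B K (Suc N) xs = B (take (K - 1) xs) + block_sum B K N (drop K xs)"

text \<open>Leaving the last letter of each block free makes the characteristic function of a block a
  multiple of \<open>\<phi>\<close>, which provides an integrable majorant for the inversion integral.\<close>

locale block_functional = critical_offspring +
  fixes B :: "nat list \<Rightarrow> real" and K :: nat and M :: real
  assumes K_pos: "K > 0" and B_bound: "\<And>xs. \<bar>B (take (K - 1) xs)\<bar> \<le> M"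
    and B_centered: "measure_pmf.expectation (replicate_pmf (K - 1) p) (\<lambda>xs. B (take (K - 1) xs)) = 0"
begin

abbreviation "Bl xs \<equiv> B (take (K - 1) xs)"

lemma K_eq: "K = (K - 1) + 1" using K_pos by simp

definition \<psi> :: "real \<Rightarrow> real \<Rightarrow> complex" where
  "\<psi> s \<theta> = measure_pmf.expectation (replicate_pmf K p) (\<lambda>xs. iexp (s * Bl xs + \<theta> * walk xs))"

lemma expectation_iexp_walk: "measure_pmf.expectation (replicate_pmf n p) (\<lambda>xs. iexp (\<theta> * walk xs)) = \<phi> \<theta> ^ n"
proof (induction n)
  case (Suc n)
  have "measure_pmf.expectation (replicate_pmf (Suc n) p) (\<lambda>xs. iexp (\<theta> * walk xs)) =
    measure_pmf.expectation (replicate_pmf (Suc n) p) (\<lambda>xs. iexp (\<theta> * step (hd xs)) * iexp (\<theta> * walk (tl xs)))"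
    by (intro integral_cong_AE)
      (auto simp: AE_measure_pmf_iff set_replicate_pmf length_Suc_conv exp_add[symmetric] algebra_simps simp del: replicate_pmf.simps)
  also have "\<dots> = \<phi> \<theta> * \<phi> \<theta> ^ n"
    by (subst expectation_replicate_Suc) (simp_all only: integrable_iexp_pmf Suc \<phi>_def)
  finally show ?case by simp
qed simp

lemma norm_\<psi>_le: "norm (\<psi> s \<theta>) \<le> norm (\<phi> \<theta>)"
proof -
  have "\<psi> s \<theta> = measure_pmf.expectation (replicate_pmf K p)
      (\<lambda>xs. iexp (s * Bl (take (K - 1) xs) + \<theta> * walk (take (K - 1) xs)) * iexp (\<theta> * walk (drop (K - 1) xs)))"
    unfolding \<psi>_def
  proof (intro Bochner_Integration.integral_cong refl)
    fix xs :: "nat list"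
    have "walk xs = walk (take (K - 1) xs) + walk (drop (K - 1) xs)" by (metis append_take_drop_id walk_append)
    then show "iexp (s * Bl xs + \<theta> * walk xs) =
      iexp (s * Bl (take (K - 1) xs) + \<theta> * walk (take (K - 1) xs)) * iexp (\<theta> * walk (drop (K - 1) xs))"
      by (simp add: exp_add[symmetric] algebra_simps)
  qed
  also have "\<dots> = measure_pmf.expectation (replicate_pmf ((K - 1) + 1) p)
      (\<lambda>xs. iexp (s * Bl (take (K - 1) xs) + \<theta> * walk (take (K - 1) xs)) * iexp (\<theta> * walk (drop (K - 1) xs)))"
    by (simp only: K_eq[symmetric])
  also have "\<dots> = measure_pmf.expectation (replicate_pmf (K - 1) p) (\<lambda>xs. iexp (s * Bl xs + \<theta> * walk xs)) * \<phi> \<theta> ^ 1"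
    by (subst expectation_replicate_split) (simp_all only: integrable_iexp_pmf expectation_iexp_walk)
  finally have "norm (\<psi> s \<theta>) = norm (measure_pmf.expectation (replicate_pmf (K - 1) p) (\<lambda>xs. iexp (s * Bl xs + \<theta> * walk xs))) * norm (\<phi> \<theta>)"
    by (simp add: norm_mult)
  also have "\<dots> \<le> 1 * norm (\<phi> \<theta>)" by (intro mult_right_mono norm_expectation_iexp_le_1) simp
  finally show ?thesis by simp
qed

lemma expectation_iexp_block_sum:
  "measure_pmf.expectation (replicate_pmf (N * K + r) p) (\<lambda>xs. iexp (s * block_sum B K N xs + \<theta> * walk xs)) = \<psi> s \<theta> ^ N * \<phi> \<theta> ^ r"
proof (induction N)
  case (Suc N)
  have "measure_pmf.expectation (replicate_pmf (K + (N * K + r)) p) (\<lambda>xs. iexp (s * block_sum B K (Suc N) xs + \<theta> * walk xs))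
    = measure_pmf.expectation (replicate_pmf (K + (N * K + r)) p) 
      (\<lambda>xs. iexp (s * Bl (take K xs) + \<theta> * walk (take K xs)) * iexp (s * block_sum B K N (drop K xs) + \<theta> * walk (drop K xs)))"
  proof (intro Bochner_Integration.integral_cong refl)
    fix xs :: "nat list"
    have "walk xs = walk (take K xs) + walk (drop K xs)" by (metis append_take_drop_id walk_append)
    then show "iexp (s * block_sum B K (Suc N) xs + \<theta> * walk xs) = 
       iexp (s * Bl (take K xs) + \<theta> * walk (take K xs)) * iexp (s * block_sum B K N (drop K xs) + \<theta> * walk (drop K xs))"
      by (simp add: exp_add[symmetric] algebra_simps min_def)
  qed
  also have "\<dots> = \<psi> s \<theta> * (\<psi> s \<theta> ^ N * \<phi> \<theta> ^ r)"
    by (subst expectation_replicate_split) (simp_all only: integrable_iexp_pmf Suc \<psi>_def)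
  finally show ?case by (simp add: algebra_simps)
qed (simp add: expectation_iexp_walk del: of_real_mult)

text \<open>The shift \<open>1 / real period\<close> accounts for the endpoint: bridges have sum
  \<open>n - 1\<close>, whereas \<open>walk\<close> is centred at sum \<open>n\<close>.\<close>

definition F :: "nat \<Rightarrow> real \<Rightarrow> real \<Rightarrow> complex" where
  "F n s \<theta> = measure_pmf.expectation (replicate_pmf n p)
     (\<lambda>xs. iexp (s * block_sum B K (n div K) xs) * iexp (\<theta> * (walk xs + 1 / real period)))"

lemma F_eq: "F n s \<theta> = iexp (\<theta> / real period) * (\<psi> s \<theta> ^ (n div K) * \<phi> \<theta> ^ (n mod K))"
proof -
  have "F n s \<theta> = measure_pmf.expectation (replicate_pmf (n div K * K + n mod K) p)
     (\<lambda>xs. iexp (\<theta> / real period) * iexp (s * block_sum B K (n div K) xs + \<theta> * walk xs))"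
    unfolding F_def by (simp add: exp_add[symmetric] algebra_simps)
  also have "\<dots> = iexp (\<theta> / real period) * measure_pmf.expectation (replicate_pmf (n div K * K + n mod K) p)
     (\<lambda>xs. iexp (s * block_sum B K (n div K) xs + \<theta> * walk xs))"
    by (rule integral_mult_right_zero)
  finally show ?thesis by (simp only: expectation_iexp_block_sum)
qed

lemma norm_F_le: "norm (F n s \<theta>) \<le> norm (\<phi> \<theta>) ^ (n div K)"
proof -
  have "norm (F n s \<theta>) = norm (\<psi> s \<theta>) ^ (n div K) * norm (\<phi> \<theta>) ^ (n mod K)"
    by (simp add: F_eq norm_mult norm_power)
  also have "\<dots> \<le> norm (\<phi> \<theta>) ^ (n div K) * 1"
    by (intro mult_mono power_mono norm_\<psi>_le power_le_one norm_\<phi>_le_1) auto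
  finally show ?thesis by simp
qed

lemma measurable_F [measurable]: "(\<lambda>u. F n s (f u)) \<in> borel_measurable borel" if [measurable]: "f \<in> borel_measurable borel"
  unfolding F_def by measurable

text \<open>The inversion integral after the substitution of \<open>u / sqrt n\<close> for the
  frequency, the scale on which the integrand has a nondegenerate Gaussian limit.\<close>

definition I :: "nat \<Rightarrow> real \<Rightarrow> complex" where
  "I n s = (\<integral>u. indicator {-pi..pi} (u / sqrt n) *\<^sub>R F n (s / sqrt n) (u / sqrt n) \<partial>lborel)"

lemma bridge_expectation_eq_I:
  assumes n: "n \<ge> 1" "period dvd n - 1"
  shows "measure_pmf.expectation (replicate_pmf n p)
           (\<lambda>xs. indicator (bridges n) xs *\<^sub>R iexp (s / sqrt n * block_sum B K (n div K) xs)) * (2 * pi * sqrt n) = I n s"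
proof -
  let ?P = "replicate_pmf n p" and ?f = "\<lambda>xs. iexp (s / sqrt n * block_sum B K (n div K) xs)"
  have "measure_pmf.expectation ?P (\<lambda>xs. indicator (bridges n) xs *\<^sub>R ?f xs) =
        measure_pmf.expectation ?P (\<lambda>xs. indicator {xs. sum_list xs = n - 1} xs *\<^sub>R ?f xs)"
    using n(1) by (intro integral_cong_AE) (auto simp: AE_measure_pmf_iff set_replicate_pmf bridges_def indicator_def)
  then have "measure_pmf.expectation ?P (\<lambda>xs. indicator (bridges n) xs *\<^sub>R ?f xs) * (2 * pi) =
     (\<integral>\<theta>. indicator {-pi..pi} \<theta> *\<^sub>R
        measure_pmf.expectation ?P (\<lambda>xs. ?f xs * iexp (\<theta> * ((real (sum_list xs) - real (n - 1)) / real period))) \<partial>lborel)"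
    using fourier_inversion[OF n(2), of ?f n] by simp
  also have "\<dots> = (\<integral>\<theta>. indicator {-pi..pi} \<theta> *\<^sub>R F n (s / sqrt n) \<theta> \<partial>lborel)"
  proof (intro Bochner_Integration.integral_cong refl arg_cong2[where f = "(*\<^sub>R)"])
    fix \<theta> :: real
    show "measure_pmf.expectation ?P (\<lambda>xs. ?f xs * iexp (\<theta> * ((real (sum_list xs) - real (n - 1)) / real period))) = F n (s / sqrt n) \<theta>"
      unfolding F_def
    proof (intro integral_cong_AE)
      have "(real (sum_list xs) - real (n - 1)) / real period = walk xs + 1 / real period" if "length xs = n" for xs
        using n(1) that by (simp add: walk_eq add_divide_distrib diff_divide_distrib of_nat_diff)
      then have "?f xs * iexp (\<theta> * ((real (sum_list xs) - real (n - 1)) / real period)) =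
           ?f xs * iexp (\<theta> * (walk xs + 1 / real period))" if "length xs = n" for xs
        using that by (simp only:)
      then show "AE xs in ?P. ?f xs * iexp (\<theta> * ((real (sum_list xs) - real (n - 1)) / real period)) =
           ?f xs * iexp (\<theta> * (walk xs + 1 / real period))"
        by (simp only: AE_measure_pmf_iff set_replicate_pmf mem_Collect_eq) simp
    qed auto
  qed
  also have "\<dots> = \<bar>1 / sqrt n\<bar> *\<^sub>R (\<integral>u. indicator {-pi..pi} (0 + 1 / sqrt n * u) *\<^sub>R F n (s / sqrt n) (0 + 1 / sqrt n * u) \<partial>lborel)"
    using n(1) by (intro lborel_integral_real_affine) auto
  also have "\<dots> = I n s / sqrt n"
    using n(1) by (simp add: I_def scaleR_conv_of_real)
  finally have eq: "measure_pmf.expectation ?P (\<lambda>xs. indicator (bridges n) xs *\<^sub>R ?f xs) * (2 * pi) = I n s / sqrt n" .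
  have "measure_pmf.expectation ?P (\<lambda>xs. indicator (bridges n) xs *\<^sub>R ?f xs) * (2 * pi * sqrt n) = 
     measure_pmf.expectation ?P (\<lambda>xs. indicator (bridges n) xs *\<^sub>R ?f xs) * (2 * pi) * sqrt n" by simp
  also have "\<dots> = I n s" unfolding eq using n(1) by simp
  finally show ?thesis .
qed

lemma integrable_Bl: "integrable (replicate_pmf n p) Bl" "integrable (replicate_pmf n p) (\<lambda>xs. (Bl xs)\<^sup>2)"
  "integrable (replicate_pmf n p) (\<lambda>xs. Bl xs * walk xs)"
proof -
  show "integrable (replicate_pmf n p) Bl"
    by (rule measure_pmf.integrable_const_bound[of _ M]) (use B_bound in auto)
  show "integrable (replicate_pmf n p) (\<lambda>xs. (Bl xs)\<^sup>2)"
  proof (rule measure_pmf.integrable_const_bound[of _ "M\<^sup>2"])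
    have "norm ((Bl xs)\<^sup>2) \<le> M\<^sup>2" for xs
      using power_mono[OF B_bound[of xs], of 2] by simp
    then show "AE xs in replicate_pmf n p. norm ((Bl xs)\<^sup>2) \<le> M\<^sup>2" by simp
  qed simp
  show "integrable (replicate_pmf n p) (\<lambda>xs. Bl xs * walk xs)"
  proof (rule Bochner_Integration.integrable_bound)
    show "integrable (replicate_pmf n p) (\<lambda>xs. M * walk xs)" using integrable_walk by simp
    have "norm (Bl xs * walk xs) \<le> norm (M * walk xs)" for xs
      using B_bound[of xs] by (simp add: abs_mult mult_right_mono)
    then show "AE xs in replicate_pmf n p. norm (Bl xs * walk xs) \<le> norm (M * walk xs)" by simp
  qed simp
qed

lemma expectation_Bl: "measure_pmf.expectation (replicate_pmf K p) Bl = 0"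
proof -
  have "measure_pmf.expectation (replicate_pmf ((K - 1) + 1) p) (\<lambda>xs. Bl (take (K - 1) xs) * 1) = 0"
    by (subst expectation_replicate_split) (use B_centered integrable_Bl in auto)
  then show ?thesis using K_pos by simp
qed

section \<open>The Gaussian limit of the inversion integral\<close>

definition "\<beta> = measure_pmf.expectation (replicate_pmf K p) (\<lambda>xs. (Bl xs)\<^sup>2) / K"
definition "\<kappa> = measure_pmf.expectation (replicate_pmf K p) (\<lambda>xs. Bl xs * walk xs) / K"

lemma expectation_block_square:
  "measure_pmf.expectation (replicate_pmf K p) (\<lambda>xs. (s * Bl xs + u * walk xs)\<^sup>2) = real K * (s\<^sup>2 * \<beta> + 2 * s * u * \<kappa> + u\<^sup>2 * \<tau>)"
  "integrable (replicate_pmf K p) (\<lambda>xs. (s * Bl xs + u * walk xs)\<^sup>2)"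
proof -
  let ?P = "replicate_pmf K p"
  have eq: "(s * Bl xs + u * walk xs)\<^sup>2 = s\<^sup>2 * (Bl xs)\<^sup>2 + 2 * s * u * (Bl xs * walk xs) + u\<^sup>2 * (walk xs)\<^sup>2" for xs
    by (simp add: power2_eq_square algebra_simps)
  note i = integrable_mult_right[OF integrable_Bl(2)[of K]] integrable_mult_right[OF integrable_Bl(3)[of K]] integrable_mult_right[OF integrable_walk(2)[of K]]
  show "integrable ?P (\<lambda>xs. (s * Bl xs + u * walk xs)\<^sup>2)"
    unfolding eq by (intro Bochner_Integration.integrable_add i)
  have "measure_pmf.expectation ?P (\<lambda>xs. (s * Bl xs + u * walk xs)\<^sup>2) = measure_pmf.expectation ?P (\<lambda>xs. s\<^sup>2 * (Bl xs)\<^sup>2)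
    + measure_pmf.expectation ?P (\<lambda>xs. 2 * s * u * (Bl xs * walk xs)) + measure_pmf.expectation ?P (\<lambda>xs. u\<^sup>2 * (walk xs)\<^sup>2)"
    unfolding eq by (subst Bochner_Integration.integral_add Bochner_Integration.integrable_add i, 
      (intro Bochner_Integration.integrable_add i)+)+ (rule refl)
  then show "measure_pmf.expectation ?P (\<lambda>xs. (s * Bl xs + u * walk xs)\<^sup>2) = real K * (s\<^sup>2 * \<beta> + 2 * s * u * \<kappa> + u\<^sup>2 * \<tau>)"
    using K_pos by (simp add: \<beta>_def \<kappa>_def expectation_walk_square algebra_simps)
qed

text \<open>The variance per letter that remains after linear regression of the block sum on the
  walk: fixing the endpoint removes the component along the walk.\<close>

definition "limit_var = \<beta> - \<kappa>\<^sup>2 / \<tau>"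

lemma gaussian_integral:
  "integrable lborel (\<lambda>u. exp (- (s\<^sup>2 * \<beta> + 2 * s * u * \<kappa> + u\<^sup>2 * \<tau>) / 2))"
  "(\<integral>u. exp (- (s\<^sup>2 * \<beta> + 2 * s * u * \<kappa> + u\<^sup>2 * \<tau>) / 2) \<partial>lborel) = exp (- s\<^sup>2 * limit_var / 2) * sqrt (2 * pi / \<tau>)"
proof -
  \<comment> \<open>Completing the square in \<open>u\<close> gives this mean and the variance
    \<open>1 / \<tau>\<close>; what is left over is the exponent with
    \<open>limit_var\<close>.\<close>
  let ?\<mu> = "- s * \<kappa> / \<tau>" and ?\<sigma> = "1 / sqrt \<tau>"
  have "exp (- (s\<^sup>2 * \<beta> + 2 * s * u * \<kappa> + u\<^sup>2 * \<tau>) / 2) =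
    exp (- s\<^sup>2 * limit_var / 2) * sqrt (2 * pi / \<tau>) * normal_density ?\<mu> ?\<sigma> u" for u
  proof -
    have e: "- (s\<^sup>2 * \<beta> + 2 * s * u * \<kappa> + u\<^sup>2 * \<tau>) / 2 = - s\<^sup>2 * limit_var / 2 + - (u - ?\<mu>)\<^sup>2 / (2 * ?\<sigma>\<^sup>2)"
      using \<tau>_pos by (simp add: limit_var_def power2_eq_square field_simps)
    have "sqrt (2 * pi / \<tau>) / sqrt (2 * pi * ?\<sigma>\<^sup>2) = 1"
      using \<tau>_pos by (simp add: power_divide)
    then show ?thesis unfolding e exp_add normal_density_def by (simp add: field_simps)
  qed
  note eq = this
  show "integrable lborel (\<lambda>u. exp (- (s\<^sup>2 * \<beta> + 2 * s * u * \<kappa> + u\<^sup>2 * \<tau>) / 2))"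
    unfolding eq using \<tau>_pos by (intro integrable_mult_right integrable_normal_density) simp
  show "(\<integral>u. exp (- (s\<^sup>2 * \<beta> + 2 * s * u * \<kappa> + u\<^sup>2 * \<tau>) / 2) \<partial>lborel) = exp (- s\<^sup>2 * limit_var / 2) * sqrt (2 * pi / \<tau>)"
    unfolding eq using \<tau>_pos by simp
qed

lemma F_tendsto:
  "(\<lambda>n. F n (s / sqrt n) (u / sqrt n)) \<longlonglongrightarrow> of_real (exp (- (s\<^sup>2 * \<beta> + 2 * s * u * \<kappa> + u\<^sup>2 * \<tau>) / 2))"
proof -
  have u0: "(\<lambda>n. u / sqrt (real n)) \<longlonglongrightarrow> 0"
    by (intro tendsto_divide_0[OF tendsto_const] filterlim_at_top_imp_at_infinity
            filterlim_compose[OF sqrt_at_top] filterlim_real_sequentially)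
  have 1: "(\<lambda>n. \<psi> (s / sqrt n) (u / sqrt n) ^ (n div K)) \<longlonglongrightarrow> of_real (exp (- (real K * (s\<^sup>2 * \<beta> + 2 * s * u * \<kappa> + u\<^sup>2 * \<tau>)) / (2 * real K)))"
  proof -
    have "measure_pmf.expectation (replicate_pmf K p) (\<lambda>xs. s * Bl xs + u * walk xs) = 0"
      using expectation_Bl by (simp add: integrable_Bl[simplified] integrable_walk expectation_walk)
    note lim = charfun_power_tendsto[OF expectation_block_square(2) this K_pos]
    have eq: "\<psi> (s / sqrt n) (u / sqrt n) = measure_pmf.expectation (replicate_pmf K p) (\<lambda>xs. iexp ((s * Bl xs + u * walk xs) / sqrt n))" for n
      by (simp add: \<psi>_def add_divide_distrib)
    show ?thesis using lim unfolding eq expectation_block_square(1) of_nat_mult of_nat_numeral .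
  qed
  \<comment> \<open>The letters behind the last full block number fewer than \<open>K\<close>, so a
    bounded number of factors tending to 1.\<close>
  have 2: "(\<lambda>n. \<phi> (u / sqrt n) ^ (n mod K)) \<longlonglongrightarrow> 1"
  proof -
    have c: "isCont \<phi> 0" using continuous_\<phi>[of UNIV] by (simp add: continuous_on_eq_continuous_at)
    have "\<phi> 0 = 1" by (simp add: \<phi>_def)
    then have l: "(\<lambda>n. \<phi> (u / sqrt n)) \<longlonglongrightarrow> 1" using isCont_tendsto_compose[OF c u0] by simp
    have "(\<lambda>n. K * norm (\<phi> (u / sqrt n) - 1)) \<longlonglongrightarrow> K * norm (1 - 1 :: complex)"
      by (intro tendsto_intros l)
    then have zero: "(\<lambda>n. K * norm (\<phi> (u / sqrt n) - 1)) \<longlonglongrightarrow> 0" by simp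
    have bnd: "norm (\<phi> (u / sqrt n) ^ (n mod K) - 1) \<le> K * norm (\<phi> (u / sqrt n) - 1)" for n
    proof -
      have "norm (\<phi> (u / sqrt n) ^ (n mod K) - 1 ^ (n mod K)) \<le> (n mod K) * norm (\<phi> (u / sqrt n) - 1)"
        by (rule norm_power_diff[OF norm_\<phi>_le_1]) simp
      also have "\<dots> \<le> K * norm (\<phi> (u / sqrt n) - 1)"
        using K_pos by (intro mult_right_mono) (simp_all add: less_imp_le)
      finally show ?thesis by simp
    qed
    have "(\<lambda>n. \<phi> (u / sqrt n) ^ (n mod K) - 1) \<longlonglongrightarrow> 0"
      by (rule Lim_null_comparison[OF always_eventually[OF allI[OF bnd]] zero])
    then show ?thesis by (simp add: LIM_zero_iff)
  qed
  have 3: "(\<lambda>n. iexp (u / sqrt n / real period)) \<longlonglongrightarrow> 1"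
  proof -
    have "(\<lambda>n. iexp (u / sqrt n / real period)) \<longlonglongrightarrow> iexp (0 / real period)"
      using period_pos by (intro tendsto_exp tendsto_mult tendsto_const tendsto_of_real tendsto_divide u0) simp
    then show ?thesis by simp
  qed
  have "(\<lambda>n. iexp (u / sqrt n / real period) * (\<psi> (s / sqrt n) (u / sqrt n) ^ (n div K) * \<phi> (u / sqrt n) ^ (n mod K)))
    \<longlonglongrightarrow> 1 * (of_real (exp (- (real K * (s\<^sup>2 * \<beta> + 2 * s * u * \<kappa> + u\<^sup>2 * \<tau>)) / (2 * real K))) * 1)"
    by (intro tendsto_mult 1 2 3)
  moreover have "- (real K * (s\<^sup>2 * \<beta> + 2 * s * u * \<kappa> + u\<^sup>2 * \<tau>)) / (2 * real K) = - (s\<^sup>2 * \<beta> + 2 * s * u * \<kappa> + u\<^sup>2 * \<tau>) / 2"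
    using K_pos by (simp add: field_simps)
  ultimately show ?thesis by (simp only: F_eq mult_1_left mult_1_right)
qed

lemma I_tendsto: "(\<lambda>n. I n s) \<longlonglongrightarrow> of_real (exp (- s\<^sup>2 * limit_var / 2) * sqrt (2 * pi / \<tau>))"
proof -
  obtain c where c: "c > 0" "\<And>\<theta>. \<bar>\<theta>\<bar> \<le> pi \<Longrightarrow> norm (\<phi> \<theta>) \<le> exp (- c * \<theta>\<^sup>2)"
    using \<phi>_gaussian_bound by blast
  \<comment> \<open>From \<open>n \<ge> K\<close> on there are at least \<open>n / (2 * K)\<close>
    full blocks, each contributing a factor of modulus at most that of \<open>\<phi>\<close>. This
    explains both the exponent and the shift of the sequence by \<open>K\<close>.\<close>
  let ?w = "\<lambda>u. exp (- (c / (2 * real K)) * u\<^sup>2)"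
  let ?L = "\<lambda>u. complex_of_real (exp (- (s\<^sup>2 * \<beta> + 2 * s * u * \<kappa> + u\<^sup>2 * \<tau>) / 2))"
  have w: "integrable lborel ?w"
  proof -
    let ?\<sigma> = "sqrt (real K / c)"
    have "?w u = sqrt (2 * pi * ?\<sigma>\<^sup>2) * normal_density 0 ?\<sigma> u" for u
      using c(1) K_pos by (simp add: normal_density_def field_simps)
    then show ?thesis using c(1) K_pos by simp
  qed
  have "(\<lambda>n. I (n + K) s) \<longlonglongrightarrow> (\<integral>u. ?L u \<partial>lborel)"
    unfolding I_def
  proof (rule integral_dominated_convergence[OF _ _ w])
    show "AE u in lborel. (\<lambda>n. indicator {-pi..pi} (u / sqrt (real (n + K))) *\<^sub>R F (n + K) (s / sqrt (real (n + K))) (u / sqrt (real (n + K)))) \<longlonglongrightarrow> ?L u"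
    proof (rule AE_I2)
      fix u :: real
      have u0: "(\<lambda>n. u / sqrt (real n)) \<longlonglongrightarrow> 0"
        by (intro tendsto_divide_0[OF tendsto_const] filterlim_at_top_imp_at_infinity
            filterlim_compose[OF sqrt_at_top] filterlim_real_sequentially)
      have "\<forall>\<^sub>F n in sequentially. u / sqrt (real n) \<in> {-pi<..<pi}"
        by (rule topological_tendstoD[OF u0]) auto
      then have "\<forall>\<^sub>F n in sequentially. F n (s / sqrt n) (u / sqrt n) = indicator {-pi..pi} (u / sqrt n) *\<^sub>R F n (s / sqrt n) (u / sqrt n)"
        by eventually_elim auto
      then have "(\<lambda>n. indicator {-pi..pi} (u / sqrt n) *\<^sub>R F n (s / sqrt n) (u / sqrt n)) \<longlonglongrightarrow> ?L u"
        by (rule Lim_transform_eventually[OF F_tendsto])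
      then show "(\<lambda>n. indicator {-pi..pi} (u / sqrt (real (n + K))) *\<^sub>R F (n + K) (s / sqrt (real (n + K))) (u / sqrt (real (n + K)))) \<longlonglongrightarrow> ?L u"
        by (rule LIMSEQ_ignore_initial_segment)
    qed
    fix n :: nat
    show "AE u in lborel. norm (indicator {-pi..pi} (u / sqrt (real (n + K))) *\<^sub>R F (n + K) (s / sqrt (real (n + K))) (u / sqrt (real (n + K)))) \<le> ?w u"
    proof (rule AE_I2)
      fix u :: real
      let ?m = "n + K" and ?\<theta> = "u / sqrt (real (n + K))"
      show "norm (indicator {-pi..pi} ?\<theta> *\<^sub>R F ?m (s / sqrt (real ?m)) ?\<theta>) \<le> ?w u"
      proof (cases "\<bar>?\<theta>\<bar> \<le> pi")
        case True
        have "norm (indicator {-pi..pi} ?\<theta> *\<^sub>R F ?m (s / sqrt (real ?m)) ?\<theta>) \<le> norm (F ?m (s / sqrt (real ?m)) ?\<theta>)"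
          by (simp add: indicator_def)
        also have "\<dots> \<le> norm (\<phi> ?\<theta>) ^ (?m div K)" by (rule norm_F_le)
        also have "\<dots> \<le> exp (- c * ?\<theta>\<^sup>2) ^ (?m div K)" by (intro power_mono c(2) True) simp
        also have "\<dots> = exp (- (c * u\<^sup>2 * (real (?m div K) / real ?m)))"
          unfolding exp_of_nat_mult[symmetric] by (simp add: power_divide)
        also have "\<dots> \<le> ?w u"
        proof -
          have "?m < K * (?m div K) + K" using K_pos dividend_less_times_div[of K ?m] by simp
          moreover have "K \<le> K * (?m div K)" using K_pos by (simp add: div_add_self2)
          ultimately have "?m \<le> K * (?m div K) + K * (?m div K)" by linarith
          then have "real ?m \<le> real (K * (?m div K) + K * (?m div K))" by (simp only: of_nat_le_iff)
          then have "real ?m \<le> 2 * real K * real (?m div K)" by simp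
          then have "1 / (2 * real K) \<le> real (?m div K) / real ?m" using K_pos by (simp add: field_simps)
          then have "c * u\<^sup>2 * (1 / (2 * real K)) \<le> c * u\<^sup>2 * (real (?m div K) / real ?m)"
            using c(1) by (intro mult_left_mono) auto
          then show ?thesis by simp
        qed
        finally show ?thesis .
      next
        case False
        then have "?\<theta> \<notin> {-pi..pi}" by auto
        then show ?thesis by simp
      qed
    qed
  qed measurable
  also have "(\<integral>u. ?L u \<partial>lborel) = of_real (exp (- s\<^sup>2 * limit_var / 2) * sqrt (2 * pi / \<tau>))"
    by (simp only: integral_complex_of_real gaussian_integral(2))
  finally show ?thesis by (rule LIMSEQ_offset)
qed

lemma bridge_prob_eq_I:
  assumes n: "n \<ge> 1" "period dvd n - 1"
  shows "of_real (bridge_prob p n * (2 * pi * sqrt n)) = I n 0"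
  using bridge_expectation_eq_I[OF n, of 0]
  by (simp add: bridge_prob_def scaleR_conv_of_real)

end

section \<open>Moments under the bridge law\<close>

text \<open>Cauchy-Schwarz applied twice. The factors 8 and 27 in later estimates are its cases of
  two and three summands.\<close>

lemma sum_power4_le: "(\<Sum>i\<in>A. x i) ^ 4 \<le> real (card A) ^ 3 * (\<Sum>i\<in>A. (x i) ^ 4)"
proof -
  have sq: "(\<Sum>i\<in>A. y i)\<^sup>2 \<le> real (card A) * (\<Sum>i\<in>A. (y i)\<^sup>2)" for y :: "_ \<Rightarrow> real"
    using Cauchy_Schwarz_ineq_sum[of "\<lambda>_. 1" y A] by simp
  have "(\<Sum>i\<in>A. x i) ^ 4 = ((\<Sum>i\<in>A. x i)\<^sup>2)\<^sup>2" by (simp flip: power_mult)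
  also have "\<dots> \<le> (real (card A) * (\<Sum>i\<in>A. (x i)\<^sup>2))\<^sup>2"
    by (intro power_mono sq) auto
  also have "\<dots> = (real (card A))\<^sup>2 * (\<Sum>i\<in>A. (x i)\<^sup>2)\<^sup>2" by (rule power_mult_distrib)
  also have "\<dots> \<le> (real (card A))\<^sup>2 * (real (card A) * (\<Sum>i\<in>A. ((x i)\<^sup>2)\<^sup>2))"
    by (intro mult_left_mono sq) auto
  also have "\<dots> = real (card A) ^ 3 * (\<Sum>i\<in>A. (x i) ^ 4)"
    by (simp add: power2_eq_square[of "real (card A)"] power3_eq_cube flip: power_mult)
  finally show ?thesis .
qed

lemma expectation_replicate_append:
  fixes p :: "'a :: countable pmf" and f :: "'a list \<Rightarrow> 'c :: {banach, second_countable_topology}"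
  assumes f: "integrable (replicate_pmf (m + n) p) f"
  shows "measure_pmf.expectation (replicate_pmf (m + n) p) f =
      (\<integral>xs. (\<integral>ys. f (xs @ ys) \<partial>replicate_pmf n p) \<partial>replicate_pmf m p)" (is ?A)
    and "measure_pmf.expectation (replicate_pmf (m + n) p) f =
      (\<integral>ys. (\<integral>xs. f (xs @ ys) \<partial>replicate_pmf m p) \<partial>replicate_pmf n p)" (is ?B)
proof -
  let ?P = "replicate_pmf m p" and ?Q = "replicate_pmf n p"
  interpret pair_sigma_finite "measure_pmf ?P" "measure_pmf ?Q" ..
  have int: "integrable (measure_pmf ?P \<Otimes>\<^sub>M measure_pmf ?Q) (\<lambda>(xs, ys). f (xs @ ys))"
    using f unfolding replicate_pmf_add by (simp add: case_prod_unfold pair_pmf_eq_pair_measure[symmetric])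
  have eq: "measure_pmf.expectation (replicate_pmf (m + n) p) f = integral\<^sup>L (measure_pmf ?P \<Otimes>\<^sub>M measure_pmf ?Q) (\<lambda>(xs, ys). f (xs @ ys))"
    unfolding replicate_pmf_add by (simp add: case_prod_unfold pair_pmf_eq_pair_measure[symmetric])
  show ?A unfolding eq using integral_fst'[OF int] by simp
  show ?B unfolding eq using integral_snd[OF int] by simp
qed

lemma integrable_bounded_pmf:
  fixes f :: "'a \<Rightarrow> 'b :: {banach, second_countable_topology}"
  assumes "\<And>x. x \<in> set_pmf M \<Longrightarrow> norm (f x) \<le> C"
  shows "integrable (measure_pmf M) f"
  by (rule measure_pmf.integrable_const_bound[of _ C]) (auto simp: AE_measure_pmf_iff assms)

definition letter_dev :: "real \<Rightarrow> 'a list \<Rightarrow> nat \<Rightarrow> 'a list \<Rightarrow> real" where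
  "letter_dev q e i xs = of_bool (prefix e (drop i xs)) - q"

lemma abs_letter_dev_le: "0 \<le> q \<Longrightarrow> q \<le> 1 \<Longrightarrow> \<bar>letter_dev q e i xs\<bar> \<le> 1"
  by (simp add: letter_dev_def)

lemma abs_sum_letter_dev_le:
  assumes "0 \<le> q" "q \<le> 1"
  shows "\<bar>\<Sum>i\<in>I. letter_dev q e i xs\<bar> \<le> card I"
proof -
  have "\<bar>\<Sum>i\<in>I. letter_dev q e i xs\<bar> \<le> (\<Sum>i\<in>I. \<bar>letter_dev q e i xs\<bar>)" by (rule sum_abs)
  also have "\<dots> \<le> (\<Sum>i\<in>I. 1)" by (intro sum_mono abs_letter_dev_le assms)
  finally show ?thesis by simp
qed

lemma prefix_iff_take: "prefix e xs \<longleftrightarrow> take (length e) xs = e"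
  by (metis append_eq_conv_conj prefix_def take_is_prefix)

lemma letter_dev_take:
  assumes "i + length e \<le> m"
  shows "letter_dev q e i (take m xs) = letter_dev q e i xs"
  using assms by (simp add: letter_dev_def prefix_iff_take drop_take min_def)

lemma letter_dev_drop: "m \<le> i \<Longrightarrow> letter_dev q e (i - m) (drop m xs) = letter_dev q e i xs"
  by (simp add: letter_dev_def)

lemma expectation_prefix:
  fixes p :: "'a :: countable pmf" and f :: "'a list \<Rightarrow> real"
  assumes f: "integrable (replicate_pmf n p) f"
  shows "integrable (replicate_pmf (length e + n) p) (\<lambda>xs. of_bool (prefix e xs) * f (drop (length e) xs))"
    and "measure_pmf.expectation (replicate_pmf (length e + n) p) (\<lambda>xs. of_bool (prefix e xs) * f (drop (length e) xs)) =
     pmf (replicate_pmf (length e) p) e * measure_pmf.expectation (replicate_pmf n p) f"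
proof -
  have i: "integrable (replicate_pmf (length e) p) (\<lambda>xs. of_bool (xs = e) :: real)"
    by (rule integrable_bounded_pmf[of _ _ 1]) auto
  have "measure_pmf.expectation (replicate_pmf (length e) p) (\<lambda>xs. of_bool (xs = e) :: real) = pmf (replicate_pmf (length e) p) e"
    by (subst integral_measure_pmf_real[of "{e}"]) auto
  then show "integrable (replicate_pmf (length e + n) p) (\<lambda>xs. of_bool (prefix e xs) * f (drop (length e) xs))"
    "measure_pmf.expectation (replicate_pmf (length e + n) p) (\<lambda>xs. of_bool (prefix e xs) * f (drop (length e) xs)) =
     pmf (replicate_pmf (length e) p) e * measure_pmf.expectation (replicate_pmf n p) f"
    using expectation_replicate_split[OF i f] unfolding prefix_iff_take by simp_all
qed

lemma expectation_letter_dev_0: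
  fixes p :: "'a :: countable pmf"
  assumes "length e \<le> n"
  shows "measure_pmf.expectation (replicate_pmf n p) (letter_dev (pmf (replicate_pmf (length e) p) e) e 0) = 0"
proof -
  have i: "integrable (replicate_pmf n p) (\<lambda>xs. of_bool (prefix e xs) :: real)"
    by (rule integrable_bounded_pmf[of _ _ 1]) auto
  have "measure_pmf.expectation (replicate_pmf (length e + (n - length e)) p) (\<lambda>xs. of_bool (prefix e xs) * 1) = pmf (replicate_pmf (length e) p) e * 1"
    by (subst expectation_prefix) auto
  then have "measure_pmf.expectation (replicate_pmf n p) (\<lambda>xs. of_bool (prefix e xs)) = pmf (replicate_pmf (length e) p) e"
    using assms by simp
  then show ?thesis using i by (simp add: letter_dev_def[abs_def])
qed

text \<open>In the expansions every term with a first power of \<open>X\<close> or \<open>Y\<close>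
  vanishes by independence and centring. The mixed term with coefficient 6 and the pure powers of
  \<open>Y\<close> survive, and for the latter \<open>\<bar>Y\<bar> \<le> 1\<close> is
  enough.\<close>

lemma moments_sum_independent:
  fixes p :: "'a :: countable pmf"
  assumes X: "\<And>xs. \<bar>X xs\<bar> \<le> A" and Y: "\<And>xs. \<bar>Y xs\<bar> \<le> (1 :: real)"
    and EX: "measure_pmf.expectation (replicate_pmf m p) X = 0" and EY: "measure_pmf.expectation (replicate_pmf n p) Y = 0"
  defines "S \<equiv> \<lambda>xs. X (take m xs) + Y (drop m xs)"
  shows "measure_pmf.expectation (replicate_pmf (m + n) p) S = 0"
    and "measure_pmf.expectation (replicate_pmf (m + n) p) (\<lambda>xs. (S xs)\<^sup>2) \<le> measure_pmf.expectation (replicate_pmf m p) (\<lambda>xs. (X xs)\<^sup>2) + 1"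
    and "measure_pmf.expectation (replicate_pmf (m + n) p) (\<lambda>xs. (S xs) ^ 4) \<le>
      measure_pmf.expectation (replicate_pmf m p) (\<lambda>xs. (X xs) ^ 4) + 6 * measure_pmf.expectation (replicate_pmf m p) (\<lambda>xs. (X xs)\<^sup>2) + 1"
proof -
  let ?P = "replicate_pmf m p" and ?Q = "replicate_pmf n p" and ?R = "replicate_pmf (m + n) p"
  have iX: "integrable ?P (\<lambda>xs. (X xs) ^ j)" for j
    by (rule integrable_bounded_pmf[of _ _ "A ^ j"]) (simp add: power_abs power_mono[OF X])
  have iY: "integrable ?Q (\<lambda>xs. (Y xs) ^ j)" for j
    by (rule integrable_bounded_pmf[of _ _ "1 ^ j"]) (simp add: power_abs power_le_one[OF _ Y])
  note sp = expectation_replicate_split[OF iX iY]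
  define E where "E i j = measure_pmf.expectation ?P (\<lambda>xs. (X xs) ^ i) * measure_pmf.expectation ?Q (\<lambda>xs. (Y xs) ^ j)" for i j
  have EE: "measure_pmf.expectation ?R (\<lambda>xs. X (take m xs) ^ i * Y (drop m xs) ^ j) = E i j" for i j
    unfolding E_def by (rule sp(2))
  have z: "E 1 j = 0" "E i 1 = 0" for i j using EX EY by (simp_all add: E_def)
  have Yle: "measure_pmf.expectation ?Q (\<lambda>xs. (Y xs) ^ j) \<le> 1" for j
  proof -
    have "(Y xs) ^ j \<le> 1" for xs
    proof -
      have "(Y xs) ^ j \<le> \<bar>Y xs\<bar> ^ j" by (metis abs_ge_self power_abs)
      also have "\<dots> \<le> 1" using Y by (intro power_le_one) auto
      finally show ?thesis .
    qed
    then have "measure_pmf.expectation ?Q (\<lambda>xs. (Y xs) ^ j) \<le> measure_pmf.expectation ?Q (\<lambda>xs. 1)"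
      by (intro integral_mono iY) auto
    then show ?thesis by simp
  qed
  have S1: "S xs = X (take m xs) ^ 1 * Y (drop m xs) ^ 0 + X (take m xs) ^ 0 * Y (drop m xs) ^ 1" for xs
    by (simp add: S_def)
  have S2: "(S xs)\<^sup>2 = X (take m xs) ^ 2 * Y (drop m xs) ^ 0 + 2 * (X (take m xs) ^ 1 * Y (drop m xs) ^ 1) + X (take m xs) ^ 0 * Y (drop m xs) ^ 2" for xs
    by (simp add: S_def power2_eq_square algebra_simps)
  have S4: "(S xs)^4 = X (take m xs) ^ 4 * Y (drop m xs) ^ 0 + 4 * (X (take m xs) ^ 3 * Y (drop m xs) ^ 1) + 6 * (X (take m xs) ^ 2 * Y (drop m xs) ^ 2)
     + 4 * (X (take m xs) ^ 1 * Y (drop m xs) ^ 3) + X (take m xs) ^ 0 * Y (drop m xs) ^ 4" for xs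
    by (simp add: S_def eval_nat_numeral algebra_simps)
  note ii = Bochner_Integration.integrable_add integrable_mult_right sp(1)
  have "measure_pmf.expectation ?R (\<lambda>xs. X (take m xs) ^ 1 * Y (drop m xs) ^ 0 + X (take m xs) ^ 0 * Y (drop m xs) ^ 1) = E 1 0 + E 0 1"
    unfolding EE[symmetric] by (rule Bochner_Integration.integral_add[OF sp(1) sp(1)])
  then have "measure_pmf.expectation ?R S = E 1 0 + E 0 1" unfolding S1[symmetric] .
  then show "measure_pmf.expectation ?R S = 0" by (simp only: z)
  have "measure_pmf.expectation ?R (\<lambda>xs. (S xs)\<^sup>2) = E 2 0 + 2 * E 1 1 + E 0 2"
    unfolding S2 by (subst Bochner_Integration.integral_add, (intro ii)+)+ (simp only: EE integral_mult_right_zero)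
  then show "measure_pmf.expectation ?R (\<lambda>xs. (S xs)\<^sup>2) \<le> measure_pmf.expectation ?P (\<lambda>xs. (X xs)\<^sup>2) + 1"
    using Yle[of 2] by (simp only: z) (simp add: E_def)
  have "measure_pmf.expectation ?R (\<lambda>xs. (S xs) ^ 4) = E 4 0 + 4 * E 3 1 + 6 * E 2 2 + 4 * E 1 3 + E 0 4"
    unfolding S4 by (subst Bochner_Integration.integral_add, (intro ii)+)+ (simp only: EE integral_mult_right_zero)
  also have "\<dots> = measure_pmf.expectation ?P (\<lambda>xs. (X xs) ^ 4) + 6 * E 2 2 + measure_pmf.expectation ?Q (\<lambda>xs. (Y xs) ^ 4)"
    by (simp only: z) (simp add: E_def)
  also have "E 2 2 \<le> measure_pmf.expectation ?P (\<lambda>xs. (X xs)\<^sup>2) * 1"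
    unfolding E_def by (intro mult_left_mono Yle) simp
  finally show "measure_pmf.expectation ?R (\<lambda>xs. (S xs) ^ 4) \<le>
      measure_pmf.expectation ?P (\<lambda>xs. (X xs) ^ 4) + 6 * measure_pmf.expectation ?P (\<lambda>xs. (X xs)\<^sup>2) + 1"
    using Yle[of 4] by simp
qed

text \<open>Starts at distance at least \<open>length e\<close> have disjoint windows, so the last
  window is independent of the others and can be split off. The bound with 3 is inductive because 3
  m^2 + 6 m + 1 is at most 3 (m + 1)^2.\<close>

lemma letter_dev_moments_separated:
  fixes p :: "'a :: countable pmf" and e :: "'a list"
  defines "q \<equiv> pmf (replicate_pmf (length e) p) e"
  assumes "finite I" and "\<And>i. i \<in> I \<Longrightarrow> i + length e \<le> n"
    and "\<And>i j. i \<in> I \<Longrightarrow> j \<in> I \<Longrightarrow> i < j \<Longrightarrow> i + length e \<le> j"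
  shows "measure_pmf.expectation (replicate_pmf n p) (\<lambda>xs. \<Sum>i\<in>I. letter_dev q e i xs) = 0
     \<and> measure_pmf.expectation (replicate_pmf n p) (\<lambda>xs. (\<Sum>i\<in>I. letter_dev q e i xs)\<^sup>2) \<le> card I
     \<and> measure_pmf.expectation (replicate_pmf n p) (\<lambda>xs. (\<Sum>i\<in>I. letter_dev q e i xs) ^ 4) \<le> 3 * (real (card I))\<^sup>2"
  using assms(2-)
proof (induction I arbitrary: n rule: finite_linorder_max_induct)
  case (insert b A)
  have q: "0 \<le> q" "q \<le> 1" by (simp_all add: q_def pmf_le_1)
  let ?X = "\<lambda>xs. \<Sum>i\<in>A. letter_dev q e i xs" and ?Y = "letter_dev q e 0"
  have IH: "measure_pmf.expectation (replicate_pmf b p) ?X = 0"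
    "measure_pmf.expectation (replicate_pmf b p) (\<lambda>xs. (?X xs)\<^sup>2) \<le> card A"
    "measure_pmf.expectation (replicate_pmf b p) (\<lambda>xs. (?X xs) ^ 4) \<le> 3 * (real (card A))\<^sup>2"
    using insert.IH[of b] insert.hyps insert.prems by auto
  have b: "b + length e \<le> n" using insert.prems by simp
  have eq: "(\<Sum>i\<in>insert b A. letter_dev q e i xs) = ?X (take b xs) + ?Y (drop b xs)" for xs
  proof -
    have "(\<Sum>i\<in>insert b A. letter_dev q e i xs) = letter_dev q e b xs + ?X xs"
      using insert.hyps by (subst sum.insert) auto
    moreover have "?X xs = ?X (take b xs)"
      using insert.hyps insert.prems by (intro sum.cong refl letter_dev_take[symmetric]) auto
    moreover have "letter_dev q e b xs = ?Y (drop b xs)" using letter_dev_drop[of b b q e xs] by simp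
    ultimately show ?thesis by simp
  qed
  have "measure_pmf.expectation (replicate_pmf (n - b) p) ?Y = 0"
    unfolding q_def using b by (intro expectation_letter_dev_0) simp
  note M = moments_sum_independent[of ?X "card A" ?Y b p "n - b", OF abs_sum_letter_dev_le[OF q] abs_letter_dev_le[OF q] IH(1) this]
  have n: "b + (n - b) = n" using b by simp
  have card: "card (insert b A) = card A + 1" using insert.hyps by auto
  show ?case
    using M IH unfolding n eq card by (auto simp: power2_eq_square algebra_simps)
qed simp

text \<open>Overlapping windows are dependent, but starts in one residue class modulo
  \<open>k\<close> have disjoint windows. Recombining the \<open>k\<close> classes costs a factor
  \<open>k ^ 3\<close> and a sum of \<open>k\<close> equal bounds.\<close>

lemma letter_dev_moment4:
  fixes p :: "'a :: countable pmf" and e :: "'a list"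
  defines "q \<equiv> pmf (replicate_pmf (length e) p) e" and "k \<equiv> length e"
  assumes I: "finite I" "\<And>i. i \<in> I \<Longrightarrow> i + k \<le> n" and k: "k > 0"
  shows "measure_pmf.expectation (replicate_pmf n p) (\<lambda>xs. (\<Sum>i\<in>I. letter_dev q e i xs) ^ 4) \<le> 3 * real k ^ 4 * (real (card I))\<^sup>2"
proof -
  let ?P = "replicate_pmf n p"
  have q: "0 \<le> q" "q \<le> 1" by (simp_all add: q_def pmf_le_1)
  define J where "J r = {i \<in> I. i mod k = r}" for r
  have int: "integrable ?P (\<lambda>xs. (\<Sum>i\<in>A. letter_dev q e i xs) ^ 4)" for A
    by (rule integrable_bounded_pmf[of _ _ "real (card A) ^ 4"])
      (use power_mono[OF abs_sum_letter_dev_le[OF q], of _ _ _ 4] in \<open>simp add: power_abs\<close>)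
  have sum_J: "(\<Sum>i\<in>I. letter_dev q e i xs) = (\<Sum>r<k. \<Sum>i\<in>J r. letter_dev q e i xs)" for xs
    unfolding J_def using I(1) k by (intro sum.group[symmetric]) auto
  have bound: "measure_pmf.expectation ?P (\<lambda>xs. (\<Sum>i\<in>J r. letter_dev q e i xs) ^ 4) \<le> 3 * (real (card I))\<^sup>2" for r
  proof -
    have "measure_pmf.expectation ?P (\<lambda>xs. (\<Sum>i\<in>J r. letter_dev q e i xs) ^ 4) \<le> 3 * (real (card (J r)))\<^sup>2"
      unfolding q_def
    proof (rule letter_dev_moments_separated[THEN conjunct2, THEN conjunct2])
      fix i j assume ij: "i \<in> J r" "j \<in> J r" "i < j"
      have "k dvd j - i" using ij by (auto simp: J_def mod_eq_dvd_iff_nat)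
      then show "i + length e \<le> j" using ij(3) dvd_imp_le[of k "j - i"] unfolding k_def by linarith
    qed (use I in \<open>auto simp: J_def k_def\<close>)
    also have "card (J r) \<le> card I" unfolding J_def using I(1) by (intro card_mono) auto
    then have "3 * (real (card (J r)))\<^sup>2 \<le> 3 * (real (card I))\<^sup>2" by simp
    finally show ?thesis .
  qed
  have "measure_pmf.expectation ?P (\<lambda>xs. (\<Sum>i\<in>I. letter_dev q e i xs) ^ 4) \<le>
     measure_pmf.expectation ?P (\<lambda>xs. real k ^ 3 * (\<Sum>r<k. (\<Sum>i\<in>J r. letter_dev q e i xs) ^ 4))"
  proof (intro integral_mono int)
    show "(\<Sum>i\<in>I. letter_dev q e i xs) ^ 4 \<le> real k ^ 3 * (\<Sum>r<k. (\<Sum>i\<in>J r. letter_dev q e i xs) ^ 4)" for xs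
      unfolding sum_J using sum_power4_le[of _ "{..<k}"] by simp
    show "integrable ?P (\<lambda>xs. real k ^ 3 * (\<Sum>r<k. (\<Sum>i\<in>J r. letter_dev q e i xs) ^ 4))"
      by (intro integrable_mult_right Bochner_Integration.integrable_sum int)
  qed
  also have "\<dots> = real k ^ 3 * (\<Sum>r<k. measure_pmf.expectation ?P (\<lambda>xs. (\<Sum>i\<in>J r. letter_dev q e i xs) ^ 4))"
    using int by simp
  also have "\<dots> \<le> real k ^ 3 * (\<Sum>r<k. 3 * (real (card I))\<^sup>2)"
    by (intro mult_left_mono sum_mono bound) simp
  also have "\<dots> = 3 * real k ^ 4 * (real (card I))\<^sup>2" by (simp add: eval_nat_numeral)
  finally show ?thesis .
qed

section \<open>Local limit estimates for the bridge probability\<close>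

context critical_offspring
begin

text \<open>The divisibility is what the support of the offspring law forces on the sizes of
  bridges. Conversely, along this arithmetic filter bridges eventually have positive probability, by
  \<open>eventually_bridge_prob_pos\<close>.\<close>

definition lattice_at_top :: "nat filter" where
  "lattice_at_top = inf sequentially (principal {n. period dvd n - 1})"

lemma eventually_lattice_at_top:
  "eventually P lattice_at_top \<longleftrightarrow> eventually (\<lambda>n. period dvd n - 1 \<longrightarrow> P n) sequentially"
  by (simp add: lattice_at_top_def eventually_inf_principal)

lemma lattice_at_top_le: "lattice_at_top \<le> sequentially"
  by (simp add: lattice_at_top_def)

text \<open>For the zero functional the inversion integral is the bridge probability itself, so the
  limit of \<open>I\<close> becomes a local limit theorem.\<close>

interpretation trivial: block_functional p "\<lambda>_. 0" 1 0
  by unfold_locales auto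

text \<open>The local limit theorem with the constant
  \<open>sqrt (2 * pi / \<tau>) / (2 * pi)\<close>; half of it is an eventual lower bound.\<close>

lemma bridge_prob_lower: "\<exists>c>0. \<forall>\<^sub>F n in lattice_at_top. bridge_prob p n * sqrt n \<ge> c"
proof -
  define c where "c = sqrt (2 * pi / \<tau>) / (2 * pi)"
  have c: "c > 0" using \<tau>_pos by (simp add: c_def)
  have "(\<lambda>n. Re (trivial.I n 0)) \<longlonglongrightarrow> Re (of_real (exp (- 0\<^sup>2 * trivial.limit_var / 2) * sqrt (2 * pi / \<tau>)))"
    by (intro tendsto_Re trivial.I_tendsto)
  then have "(\<lambda>n. Re (trivial.I n 0)) \<longlonglongrightarrow> c * (2 * pi)" by (simp add: c_def)
  moreover have "c * (2 * pi) > c / 2 * (2 * pi)" using c by simp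
  ultimately have "\<forall>\<^sub>F n in sequentially. Re (trivial.I n 0) > c / 2 * (2 * pi)"
    by (rule order_tendstoD)
  then have "\<forall>\<^sub>F n in sequentially. period dvd n - 1 \<longrightarrow> bridge_prob p n * sqrt n \<ge> c / 2"
    using eventually_ge_at_top[of 1]
  proof eventually_elim
    case (elim n)
    show ?case
    proof
      assume "period dvd n - 1"
      from trivial.bridge_prob_eq_I[OF elim(2) this]
      have "Re (trivial.I n 0) = bridge_prob p n * sqrt n * (2 * pi)" by (metis Re_complex_of_real mult.assoc mult.commute)
      then have "c / 2 * (2 * pi) < bridge_prob p n * sqrt n * (2 * pi)" using elim(1) by simp
      then show "bridge_prob p n * sqrt n \<ge> c / 2" by (simp only: mult_less_cancel_right) auto
    qed
  qed
  then show ?thesis using c by (intro exI[of _ "c / 2"]) (simp add: eventually_lattice_at_top)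
qed

lemma eventually_bridge_prob_pos: "\<forall>\<^sub>F n in lattice_at_top. bridge_prob p n > 0"
proof -
  obtain c where c: "c > 0" "\<forall>\<^sub>F n in lattice_at_top. bridge_prob p n * sqrt n \<ge> c"
    using bridge_prob_lower by blast
  from c(2) show ?thesis
  proof eventually_elim
    case (elim n)
    then have "bridge_prob p n * sqrt n > 0" using c by linarith
    then show ?case by (simp add: zero_less_mult_iff bridge_prob_def)
  qed
qed

text \<open>The target \<open>x\<close> enters the inversion integrand only through a phase, so
  integrating the Gaussian majorant of its modulus gives a bound uniform in \<open>x\<close>. Off
  the lattice the probability is zero.\<close>

lemma local_bound: "\<exists>C>0. \<forall>n>0. \<forall>x. measure_pmf.prob (replicate_pmf n p) {xs. sum_list xs = x} * sqrt n \<le> C"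
proof -
  obtain c where c: "c > 0" "\<And>\<theta>. \<bar>\<theta>\<bar> \<le> pi \<Longrightarrow> norm (\<phi> \<theta>) \<le> exp (- c * \<theta>\<^sup>2)"
    using \<phi>_gaussian_bound by blast
  define C where "C = sqrt (pi / c) / (2 * pi)"
  have C: "C > 0" using c by (simp add: C_def)
  have "measure_pmf.prob (replicate_pmf n p) {xs. sum_list xs = x} * sqrt n \<le> C" if n: "n > 0" for n x
  proof (cases "period dvd x")
    case False
    have "measure_pmf.prob (replicate_pmf n p) {xs. sum_list xs = x} = 0"
      using False period_dvd_sum_list by (subst measure_pmf_zero_iff) auto
    then show ?thesis using C by simp
  next
    case True
    let ?P = "replicate_pmf n p"
    let ?\<sigma> = "sqrt (1 / (2 * c * n))"
    have \<sigma>: "?\<sigma> > 0" using c n by simp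
    have gauss: "exp (- c * n * \<theta>\<^sup>2) = sqrt (2 * pi * ?\<sigma>\<^sup>2) * normal_density 0 ?\<sigma> \<theta>" for \<theta>
      using c n by (simp add: normal_density_def field_simps)
    have le: "norm (indicator {-pi..pi} \<theta> *\<^sub>R
        measure_pmf.expectation ?P (\<lambda>xs. 1 * iexp (\<theta> * ((real (sum_list xs) - real x) / real period)))) \<le> exp (- c * n * \<theta>\<^sup>2)" for \<theta>
    proof (cases "\<theta> \<in> {-pi..pi}")
      case True
      have "measure_pmf.expectation ?P (\<lambda>xs. 1 * iexp (\<theta> * ((real (sum_list xs) - real x) / real period))) =
        measure_pmf.expectation ?P (\<lambda>xs. iexp (\<theta> * (real n - real x) / real period) * iexp (\<theta> * walk xs))"
      proof (intro integral_cong_AE)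
        have "1 * iexp (\<theta> * ((real (sum_list xs) - real x) / real period)) = iexp (\<theta> * (real n - real x) / real period) * iexp (\<theta> * walk xs)"
          if "length xs = n" for xs
        proof -
          have "\<theta> * ((real (sum_list xs) - real x) / real period) = \<theta> * (real n - real x) / real period + \<theta> * walk xs"
            using that period_pos by (simp add: walk_eq field_simps)
          then show ?thesis by (simp only: of_real_add distrib_left exp_add mult_1)
        qed
        then show "AE xs in ?P. 1 * iexp (\<theta> * ((real (sum_list xs) - real x) / real period)) = iexp (\<theta> * (real n - real x) / real period) * iexp (\<theta> * walk xs)"
          by (simp only: AE_measure_pmf_iff set_replicate_pmf mem_Collect_eq) blast
      qed auto
      also have "\<dots> = iexp (\<theta> * (real n - real x) / real period) * \<phi> \<theta> ^ n"
        unfolding integral_mult_right_zero trivial.expectation_iexp_walk ..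
      finally have "norm (measure_pmf.expectation ?P (\<lambda>xs. 1 * iexp (\<theta> * ((real (sum_list xs) - real x) / real period)))) = norm (\<phi> \<theta>) ^ n"
        by (simp add: norm_mult norm_power)
      also have "\<dots> \<le> exp (- c * \<theta>\<^sup>2) ^ n" using True by (intro power_mono c(2)) auto
      also have "\<dots> = exp (- c * n * \<theta>\<^sup>2)" unfolding exp_of_nat_mult[symmetric] by (simp add: algebra_simps)
      finally show ?thesis using True by simp
    qed simp
    have "measure_pmf.prob ?P {xs. sum_list xs = x} * (2 * pi) = 
      norm (measure_pmf.expectation ?P (\<lambda>xs. indicator {xs. sum_list xs = x} xs *\<^sub>R (1 :: complex)) * (2 * pi))"
      by (simp add: scaleR_conv_of_real norm_mult)
    also have "\<dots> = norm (\<integral>\<theta>. indicator {-pi..pi} \<theta> *\<^sub>R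
        measure_pmf.expectation ?P (\<lambda>xs. 1 * iexp (\<theta> * ((real (sum_list xs) - real x) / real period))) \<partial>lborel)"
      by (subst fourier_inversion[OF True]) auto
    also have "\<dots> \<le> (\<integral>\<theta>. exp (- c * n * \<theta>\<^sup>2) \<partial>lborel)"
    proof (rule order_trans[OF integral_norm_bound])
      show "(\<integral>\<theta>. norm (indicator {-pi..pi} \<theta> *\<^sub>R
        measure_pmf.expectation ?P (\<lambda>xs. 1 * iexp (\<theta> * ((real (sum_list xs) - real x) / real period)))) \<partial>lborel) \<le> (\<integral>\<theta>. exp (- c * n * \<theta>\<^sup>2) \<partial>lborel)"
        using le unfolding gauss using \<sigma> by (intro integral_mono_AE') (auto intro!: integrable_mult_right)
    qed
    also have "\<dots> = sqrt (2 * pi * ?\<sigma>\<^sup>2)" unfolding gauss using \<sigma> by simp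
    also have "\<dots> = sqrt (pi / c) / sqrt n" using c n by (simp add: real_sqrt_divide real_sqrt_mult field_simps)
    finally have "measure_pmf.prob ?P {xs. sum_list xs = x} * (2 * pi) * sqrt n \<le> sqrt (pi / c) / sqrt n * sqrt n"
      by (rule mult_right_mono) simp
    then show ?thesis using n by (simp add: C_def field_simps)
  qed
  then show ?thesis using C by blast
qed

end

text \<open>Conditioning is the quotient of the inversion integrals at \<open>s\<close> and at 0;
  the factor with sqrt n and the Gaussian normalisation cancel.\<close>

lemma (in block_functional) bridge_block_sum_tendsto:
  "((\<lambda>n. measure_pmf.expectation (bridge_pmf p n) (\<lambda>xs. iexp (s / sqrt n * block_sum B K (n div K) xs)))
      \<longlongrightarrow> of_real (exp (- s\<^sup>2 * limit_var / 2))) lattice_at_top"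
proof -
  have ne: "complex_of_real (exp (- 0\<^sup>2 * limit_var / 2) * sqrt (2 * pi / \<tau>)) \<noteq> 0" using \<tau>_pos by simp
  have "(\<lambda>n. I n s / I n 0) \<longlonglongrightarrow> of_real (exp (- s\<^sup>2 * limit_var / 2) * sqrt (2 * pi / \<tau>)) / of_real (exp (- 0\<^sup>2 * limit_var / 2) * sqrt (2 * pi / \<tau>))"
    by (rule tendsto_divide[OF I_tendsto I_tendsto ne])
  moreover have "complex_of_real (exp (- s\<^sup>2 * limit_var / 2) * sqrt (2 * pi / \<tau>)) / of_real (exp (- 0\<^sup>2 * limit_var / 2) * sqrt (2 * pi / \<tau>))
    = of_real (exp (- s\<^sup>2 * limit_var / 2))" using \<tau>_pos by simp
  ultimately have "(\<lambda>n. I n s / I n 0) \<longlonglongrightarrow> of_real (exp (- s\<^sup>2 * limit_var / 2))" by (simp only:)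
  then have lim: "((\<lambda>n. I n s / I n 0) \<longlongrightarrow> of_real (exp (- s\<^sup>2 * limit_var / 2))) lattice_at_top"
    by (rule tendsto_mono[OF lattice_at_top_le])
  have "\<forall>\<^sub>F n in lattice_at_top. n \<ge> 1 \<and> period dvd n - 1"
    unfolding eventually_lattice_at_top by (rule eventually_mono[OF eventually_ge_at_top[of 1]]) simp
  then have "\<forall>\<^sub>F n in lattice_at_top. I n s / I n 0 =
     measure_pmf.expectation (bridge_pmf p n) (\<lambda>xs. iexp (s / sqrt n * block_sum B K (n div K) xs))"
    using eventually_bridge_prob_pos
  proof eventually_elim
    case (elim n)
    have "I n s / I n 0 = measure_pmf.expectation (replicate_pmf n p)
           (\<lambda>xs. indicator (bridges n) xs *\<^sub>R iexp (s / sqrt n * block_sum B K (n div K) xs)) / of_real (bridge_prob p n)"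
    proof -
      have n: "n \<ge> 1" "period dvd n - 1" "complex_of_real (2 * pi * sqrt n) \<noteq> 0" using elim by auto
      show ?thesis
        unfolding bridge_expectation_eq_I[OF n(1,2), of s, symmetric] bridge_prob_eq_I[OF n(1,2), symmetric] of_real_mult[of "bridge_prob p n"]
        by (rule nonzero_mult_divide_mult_cancel_right[OF n(3)])
    qed
    then show ?case
      by (simp only: expectation_bridge_pmf[OF elim(2)] scaleR_conv_of_real of_real_inverse divide_inverse mult.commute)
  qed
  from Lim_transform_eventually[OF lim this] show ?thesis .
qed


section \<open>Comparison of bridge halves with i.i.d. words\<close>

context critical_offspring
begin

text \<open>The density of one half at \<open>xs\<close> is the probability that the other half has
  the complementary sum, divided by \<open>bridge_prob p n\<close>. Both are of order 1/sqrt n, from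
  above by \<open>local_bound\<close> and from below by \<open>bridge_prob_lower\<close>. The bound
  \<open>M\<close> gives integrability and does not enter \<open>C\<close>.\<close>

lemma bridge_transfer:
  "\<exists>C>0. \<forall>\<^sub>F n in lattice_at_top. \<forall>G :: nat list \<Rightarrow> real. \<forall>M. (\<forall>xs. 0 \<le> G xs \<and> G xs \<le> M) \<longrightarrow>
     measure_pmf.expectation (bridge_pmf p n) (\<lambda>xs. G (take (n div 2) xs)) \<le> C * measure_pmf.expectation (replicate_pmf (n div 2) p) G \<and>
     measure_pmf.expectation (bridge_pmf p n) (\<lambda>xs. G (drop (n div 2) xs)) \<le> C * measure_pmf.expectation (replicate_pmf (n - n div 2) p) G"
proof -
  obtain c where c: "c > 0" "\<forall>\<^sub>F n in lattice_at_top. bridge_prob p n * sqrt n \<ge> c"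
    using bridge_prob_lower by blast
  obtain C where C: "C > 0" "\<And>n x. n > 0 \<Longrightarrow> measure_pmf.prob (replicate_pmf n p) {xs. sum_list xs = x} * sqrt n \<le> C"
    using local_bound by blast
  have n2: "\<forall>\<^sub>F n in lattice_at_top. n \<ge> 2"
    by (rule filter_leD[OF lattice_at_top_le eventually_ge_at_top])
  have "\<forall>\<^sub>F n in lattice_at_top. \<forall>G :: nat list \<Rightarrow> real. \<forall>M. (\<forall>xs. 0 \<le> G xs \<and> G xs \<le> M) \<longrightarrow>
     measure_pmf.expectation (bridge_pmf p n) (\<lambda>xs. G (take (n div 2) xs)) \<le> 2 * C / c * measure_pmf.expectation (replicate_pmf (n div 2) p) G \<and>
     measure_pmf.expectation (bridge_pmf p n) (\<lambda>xs. G (drop (n div 2) xs)) \<le> 2 * C / c * measure_pmf.expectation (replicate_pmf (n - n div 2) p) G"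
    using c(2) n2 eventually_bridge_prob_pos
  proof eventually_elim
    case (elim n)
    define m where "m = n div 2"
    have m: "m > 0" "n - m > 0" "n \<le> 3 * m" "n \<le> 3 * (n - m)" "m + (n - m) = n" using elim(2) by (auto simp: m_def)
    \<comment> \<open>The factor 2 in \<open>2 * C / c\<close> is sqrt 4: a half of length
      \<open>j\<close> has \<open>n \<le> 3 * j\<close>, so sqrt n is at most
      \<open>2 * sqrt j\<close>.\<close>
    have prob: "measure_pmf.prob (replicate_pmf j p) {xs. sum_list xs = x} / bridge_prob p n \<le> 2 * C / c" if j: "j > 0" "n \<le> 3 * j" for j x
    proof -
      have "real n \<le> real (3 * j)" using j by (simp only: of_nat_le_iff)
      then have "real n \<le> 2\<^sup>2 * real j" by simp
      then have "sqrt n \<le> sqrt (2\<^sup>2 * real j)" by (rule real_sqrt_le_mono)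
      then have sq: "sqrt n \<le> 2 * sqrt j" by (simp add: real_sqrt_mult)
      have "measure_pmf.prob (replicate_pmf j p) {xs. sum_list xs = x} * c \<le> measure_pmf.prob (replicate_pmf j p) {xs. sum_list xs = x} * (bridge_prob p n * sqrt n)"
        by (intro mult_left_mono elim(1)) simp
      also have "\<dots> \<le> measure_pmf.prob (replicate_pmf j p) {xs. sum_list xs = x} * (bridge_prob p n * (2 * sqrt j))"
        by (intro mult_left_mono sq) (simp_all add: bridge_prob_def)
      also have "\<dots> = 2 * (measure_pmf.prob (replicate_pmf j p) {xs. sum_list xs = x} * sqrt j) * bridge_prob p n" by simp
      also have "\<dots> \<le> 2 * C * bridge_prob p n"
        using elim(3) by (intro mult_right_mono mult_left_mono C(2) j) auto
      finally show ?thesis using c(1) elim(3) by (simp add: field_simps)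
    qed
    \<comment> \<open>The parameter \<open>app\<close> hides the order of concatenation, so that one
      argument serves the left and the right half.\<close>
    have main: "E \<le> 2 * C / c * measure_pmf.expectation M G"
      if E: "E = (\<integral>xs. (\<integral>ys. indicator (bridges n) (app xs ys) * G xs \<partial>replicate_pmf j p) \<partial>measure_pmf M) / bridge_prob p n"
        and app: "\<And>xs ys. sum_list (app xs ys) = sum_list xs + sum_list ys" and j: "j > 0" "n \<le> 3 * j"
        and G: "\<forall>xs. 0 \<le> G xs \<and> G xs \<le> D"
      for E :: real and M :: "nat list pmf" and app :: "nat list \<Rightarrow> nat list \<Rightarrow> nat list" and j and G :: "nat list \<Rightarrow> real" and D
    proof -
      have inner: "(\<integral>ys. indicator (bridges n) (app xs ys) * G xs \<partial>replicate_pmf j p) / bridge_prob p n \<le> 2 * C / c * G xs" for xs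
      proof -
        \<comment> \<open>Only an inequality: the length condition is dropped, and the subtraction
          truncates at 0 when the sum of \<open>xs\<close> already exceeds
          \<open>n - 1\<close>.\<close>
        have "(\<integral>ys. indicat_real (bridges n) (app xs ys) \<partial>replicate_pmf j p) \<le> (\<integral>ys. indicat_real {ys. sum_list ys = n - 1 - sum_list xs} ys \<partial>replicate_pmf j p)"
          by (intro integral_mono integrable_bounded_pmf[of _ _ 1]) (auto simp: bridges_def app indicator_def)
        also have "\<dots> = measure_pmf.prob (replicate_pmf j p) {ys. sum_list ys = n - 1 - sum_list xs}" by simp
        finally have "(\<integral>ys. indicator (bridges n) (app xs ys) \<partial>replicate_pmf j p) / bridge_prob p n \<le> measure_pmf.prob (replicate_pmf j p) {ys. sum_list ys = n - 1 - sum_list xs} / bridge_prob p n"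
          using elim(3) by (intro divide_right_mono) auto
        also have "\<dots> \<le> 2 * C / c" by (rule prob[OF j])
        finally have "(\<integral>ys. indicator (bridges n) (app xs ys) \<partial>replicate_pmf j p) / bridge_prob p n * G xs \<le> 2 * C / c * G xs"
          using G by (intro mult_right_mono) auto
        then show ?thesis by simp
      qed
      have le1: "\<bar>(\<integral>ys. indicator (bridges n) (app xs ys) * G xs \<partial>replicate_pmf j p)\<bar> \<le> D" for xs
      proof -
        have "\<bar>(\<integral>ys. indicator (bridges n) (app xs ys) * G xs \<partial>replicate_pmf j p)\<bar> \<le> (\<integral>ys. \<bar>indicator (bridges n) (app xs ys) * G xs\<bar> \<partial>replicate_pmf j p)"
          by (rule integral_abs_bound)
        also have "\<dots> \<le> (\<integral>ys. D \<partial>replicate_pmf j p)"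
          using G order_trans[OF G[rule_format, THEN conjunct1] G[rule_format, THEN conjunct2]]
          by (intro integral_mono integrable_bounded_pmf[of _ _ D]) (auto simp: indicator_def)
        finally show ?thesis by simp
      qed
      have "E = (\<integral>xs. (\<integral>ys. indicator (bridges n) (app xs ys) * G xs \<partial>replicate_pmf j p) / bridge_prob p n \<partial>measure_pmf M)"
        unfolding E by (rule integral_divide_zero[symmetric])
      also have "\<dots> \<le> (\<integral>xs. 2 * C / c * G xs \<partial>measure_pmf M)"
      proof (intro integral_mono inner)
        show "integrable M (\<lambda>xs. (\<integral>ys. indicator (bridges n) (app xs ys) * G xs \<partial>replicate_pmf j p) / bridge_prob p n)"
          using le1 by (intro integrable_divide integrable_bounded_pmf[of _ _ D]) auto
        show "integrable M (\<lambda>xs. 2 * C / c * G xs)"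
          using G by (intro integrable_mult_right integrable_bounded_pmf[of _ _ D]) auto
      qed
      finally show ?thesis by simp
    qed
    show ?case
    proof (intro allI impI conjI)
      fix G :: "nat list \<Rightarrow> real" and D assume G: "\<forall>xs. 0 \<le> G xs \<and> G xs \<le> D"
      have int: "integrable (replicate_pmf (m + (n - m)) p) (\<lambda>xs. indicator (bridges n) xs * G (f xs))" for f
        using G order_trans[OF G[rule_format, THEN conjunct1] G[rule_format, THEN conjunct2]]
        by (intro integrable_bounded_pmf[of _ _ D]) (auto simp: indicator_def)
      show "measure_pmf.expectation (bridge_pmf p n) (\<lambda>xs. G (take (n div 2) xs)) \<le> 2 * C / c * measure_pmf.expectation (replicate_pmf (n div 2) p) G"
        unfolding m_def[symmetric]
      proof (rule main[where app = "\<lambda>xs ys. xs @ ys" and j = "n - m", OF _ _ _ _ G])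
        have "measure_pmf.expectation (replicate_pmf (m + (n - m)) p) (\<lambda>xs. indicator (bridges n) xs * G (take m xs)) =
          (\<integral>xs. (\<integral>ys. indicator (bridges n) (xs @ ys) * G (take m (xs @ ys)) \<partial>replicate_pmf (n - m) p) \<partial>replicate_pmf m p)"
          by (rule expectation_replicate_append(1)[OF int])
        also have "\<dots> = (\<integral>xs. (\<integral>ys. indicator (bridges n) (xs @ ys) * G xs \<partial>replicate_pmf (n - m) p) \<partial>replicate_pmf m p)"
          by (intro integral_cong_AE) (auto simp: AE_measure_pmf_iff set_replicate_pmf)
        finally show "measure_pmf.expectation (bridge_pmf p n) (\<lambda>xs. G (take m xs)) =
            (\<integral>xs. (\<integral>ys. indicator (bridges n) (xs @ ys) * G xs \<partial>replicate_pmf (n - m) p) \<partial>replicate_pmf m p) / bridge_prob p n"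
          by (simp add: expectation_bridge_pmf[OF elim(3)] m(5) divide_inverse mult.commute)
      qed (use m in auto)
      show "measure_pmf.expectation (bridge_pmf p n) (\<lambda>xs. G (drop (n div 2) xs)) \<le> 2 * C / c * measure_pmf.expectation (replicate_pmf (n - n div 2) p) G"
        unfolding m_def[symmetric]
      proof (rule main[where app = "\<lambda>ys xs. xs @ ys" and j = m, OF _ _ _ _ G])
        have "measure_pmf.expectation (replicate_pmf (m + (n - m)) p) (\<lambda>xs. indicator (bridges n) xs * G (drop m xs)) =
          (\<integral>ys. (\<integral>xs. indicator (bridges n) (xs @ ys) * G (drop m (xs @ ys)) \<partial>replicate_pmf m p) \<partial>replicate_pmf (n - m) p)"
          by (rule expectation_replicate_append(2)[OF int])
        also have "\<dots> = (\<integral>ys. (\<integral>xs. indicator (bridges n) (xs @ ys) * G ys \<partial>replicate_pmf m p) \<partial>replicate_pmf (n - m) p)"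
          by (intro Bochner_Integration.integral_cong refl integral_cong_AE) (auto simp: AE_measure_pmf_iff set_replicate_pmf)
        finally show "measure_pmf.expectation (bridge_pmf p n) (\<lambda>xs. G (drop m xs)) =
            (\<integral>ys. (\<integral>xs. indicator (bridges n) (xs @ ys) * G ys \<partial>replicate_pmf m p) \<partial>replicate_pmf (n - m) p) / bridge_prob p n"
          by (simp add: expectation_bridge_pmf[OF elim(3)] m(5) divide_inverse mult.commute)
      qed (use m in auto)
    qed
  qed
  then show ?thesis using C(1) c(1) by (intro exI[of _ "2 * C / c"]) auto
qed

text \<open>The starts split into those with window in the left half, those in the right half, and
  at most \<open>k\<close> that straddle the middle. The halves are compared with i.i.d. words; the
  straddling ones are bounded trivially and cause the summand 1.\<close>

lemma bridge_letter_dev_moment4: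
  assumes e: "e \<noteq> []"
  defines "q \<equiv> pmf (replicate_pmf (length e) p) e"
  shows "\<exists>C>0. \<forall>\<^sub>F n in lattice_at_top. \<forall>I. (\<forall>i\<in>I. i + length e \<le> n) \<longrightarrow>
     measure_pmf.expectation (bridge_pmf p n) (\<lambda>xs. (\<Sum>i\<in>I. letter_dev q e i xs) ^ 4) \<le> C * ((real (card I))\<^sup>2 + 1)"
proof -
  define k where "k = length e"
  have k: "k > 0" using e by (simp add: k_def)
  have q: "0 \<le> q" "q \<le> 1" by (simp_all add: q_def pmf_le_1)
  obtain C where C: "C > 0" and ev: "\<forall>\<^sub>F n in lattice_at_top. \<forall>G :: nat list \<Rightarrow> real. \<forall>M. (\<forall>xs. 0 \<le> G xs \<and> G xs \<le> M) \<longrightarrow>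
     measure_pmf.expectation (bridge_pmf p n) (\<lambda>xs. G (take (n div 2) xs)) \<le> C * measure_pmf.expectation (replicate_pmf (n div 2) p) G \<and>
     measure_pmf.expectation (bridge_pmf p n) (\<lambda>xs. G (drop (n div 2) xs)) \<le> C * measure_pmf.expectation (replicate_pmf (n - n div 2) p) G"
    using bridge_transfer by blast
  \<comment> \<open>The 27 comes from splitting into three sums, \<open>6 * C\<close> from two
    halves with \<open>3 * C\<close> each, and the last \<open>real k ^ 4\<close> from the
    straddling windows.\<close>
  define D where "D = 27 * (6 * C * real k ^ 4 + real k ^ 4)"
  have D: "D > 0" using C k by (simp add: D_def add_pos_pos)
  from ev have "\<forall>\<^sub>F n in lattice_at_top. \<forall>I. (\<forall>i\<in>I. i + length e \<le> n) \<longrightarrow>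
     measure_pmf.expectation (bridge_pmf p n) (\<lambda>xs. (\<Sum>i\<in>I. letter_dev q e i xs) ^ 4) \<le> D * ((real (card I))\<^sup>2 + 1)"
  proof eventually_elim
    case (elim n)
    show ?case
    proof (intro allI impI)
      fix I assume I: "\<forall>i\<in>I. i + length e \<le> n"
      have finI: "finite I" by (rule finite_subset[of _ "{..n}"]) (use I in auto)
      define m where "m = n div 2"
      define I1 where "I1 = {i\<in>I. i + k \<le> m}"
      define I2 where "I2 = {i\<in>I. m \<le> i}"
      define I3 where "I3 = I - I1 - I2"
      define I2' where "I2' = (\<lambda>i. i - m) ` I2"
      have fin: "finite I1" "finite I2" "finite I3" "finite I2'" using finI by (auto simp: I1_def I2_def I3_def I2'_def)
      have inj: "inj_on (\<lambda>i. i - m) I2" by (auto simp: I2_def inj_on_def)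
      have cards: "card I1 \<le> card I" "card I2' \<le> card I" "card I3 \<le> k"
      proof -
        show "card I1 \<le> card I" unfolding I1_def using finI by (intro card_mono) auto
        have "card I2' \<le> card I2" unfolding I2'_def by (rule card_image_le) (rule fin)
        also have "\<dots> \<le> card I" unfolding I2_def using finI by (intro card_mono) auto
        finally show "card I2' \<le> card I" .
        have "I3 \<subseteq> {m - k..<m}" using k by (auto simp: I3_def I1_def I2_def)
        then have "card I3 \<le> card {m - k..<m}" by (intro card_mono) auto
        then show "card I3 \<le> k" by simp
      qed
      let ?g = "\<lambda>J xs. \<Sum>i\<in>J. letter_dev q e i xs"
      define G1 where "G1 xs = (?g I1 xs) ^ 4" for xs :: "nat list"
      define G2 where "G2 xs = (?g I2' xs) ^ 4" for xs :: "nat list"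
      have Gb: "0 \<le> (?g J xs) ^ 4" "(?g J xs) ^ 4 \<le> real (card J) ^ 4" for J xs
      proof -
        show "(?g J xs) ^ 4 \<le> real (card J) ^ 4"
          using power_mono[OF abs_sum_letter_dev_le[OF q, of e xs J], of 4] by simp
      qed simp
      have split: "?g I xs = ?g I1 (take m xs) + ?g I2' (drop m xs) + ?g I3 xs" for xs :: "nat list"
      proof -
        have "I = I1 \<union> I2 \<union> I3" "I1 \<inter> I2 = {}" "(I1 \<union> I2) \<inter> I3 = {}"
          using k by (auto simp: I3_def I1_def I2_def)
        then have "?g I xs = ?g I1 xs + ?g I2 xs + ?g I3 xs"
          using fin by (simp add: sum.union_disjoint)
        moreover have "?g I1 (take m xs) = ?g I1 xs"
          by (intro sum.cong refl letter_dev_take) (auto simp: I1_def k_def)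
        moreover have "?g I2' (drop m xs) = ?g I2 xs"
          unfolding I2'_def sum.reindex[OF inj] by (intro sum.cong refl) (auto simp: I2_def intro: letter_dev_drop)
        ultimately show ?thesis by simp
      qed
      have pw: "(a + b + c) ^ 4 \<le> 27 * (a ^ 4 + b ^ 4 + c ^ 4)" for a b c :: real
        using sum_power4_le[of "\<lambda>i. [a, b, c] ! i" "{..<3::nat}"] by (simp add: eval_nat_numeral)
      have le: "(?g I xs) ^ 4 \<le> 27 * (G1 (take m xs) + G2 (drop m xs) + real k ^ 4)" for xs :: "nat list"
      proof -
        have "(?g I xs) ^ 4 \<le> 27 * (G1 (take m xs) + G2 (drop m xs) + (?g I3 xs) ^ 4)"
          unfolding split G1_def G2_def by (rule pw)
        also have "\<dots> \<le> 27 * (G1 (take m xs) + G2 (drop m xs) + real k ^ 4)"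
          using cards(3) by (intro mult_left_mono add_left_mono order_trans[OF Gb(2)] power_mono) auto
        finally show ?thesis .
      qed
      have int: "integrable (bridge_pmf p n) (\<lambda>xs. G1 (f xs))" "integrable (bridge_pmf p n) (\<lambda>xs. G2 (f xs))" for f
        using Gb(2) by (auto intro!: integrable_bounded_pmf simp: G1_def G2_def)
      have "measure_pmf.expectation (bridge_pmf p n) (\<lambda>xs. (?g I xs) ^ 4) \<le>
         measure_pmf.expectation (bridge_pmf p n) (\<lambda>xs. 27 * (G1 (take m xs) + G2 (drop m xs) + real k ^ 4))"
        using Gb(2) int by (intro integral_mono le) (auto intro!: integrable_bounded_pmf)
      also have "\<dots> = 27 * (measure_pmf.expectation (bridge_pmf p n) (\<lambda>xs. G1 (take m xs)) + measure_pmf.expectation (bridge_pmf p n) (\<lambda>xs. G2 (drop m xs)) + real k ^ 4)"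
        using int by simp
      also have "\<dots> \<le> 27 * (C * (3 * real k ^ 4 * (real (card I))\<^sup>2) + C * (3 * real k ^ 4 * (real (card I))\<^sup>2) + real k ^ 4)"
      proof (intro mult_left_mono add_mono order_refl)
        have "measure_pmf.expectation (replicate_pmf m p) G1 \<le> 3 * real k ^ 4 * (real (card I1))\<^sup>2"
          unfolding G1_def q_def k_def
          by (rule letter_dev_moment4) (use fin k in \<open>auto simp: I1_def k_def\<close>)
        also have "\<dots> \<le> 3 * real k ^ 4 * (real (card I))\<^sup>2"
          using cards by (intro mult_left_mono power_mono) auto
        finally have "C * measure_pmf.expectation (replicate_pmf m p) G1 \<le> C * (3 * real k ^ 4 * (real (card I))\<^sup>2)"
          using C by simp
        moreover have "measure_pmf.expectation (bridge_pmf p n) (\<lambda>xs. G1 (take m xs)) \<le> C * measure_pmf.expectation (replicate_pmf m p) G1"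
          unfolding m_def using elim[rule_format, of G1 "real (card I1) ^ 4"] Gb by (simp add: G1_def)
        ultimately show "measure_pmf.expectation (bridge_pmf p n) (\<lambda>xs. G1 (take m xs)) \<le> C * (3 * real k ^ 4 * (real (card I))\<^sup>2)" by simp
        have "measure_pmf.expectation (replicate_pmf (n - m) p) G2 \<le> 3 * real k ^ 4 * (real (card I2'))\<^sup>2"
          unfolding G2_def q_def k_def
        proof (rule letter_dev_moment4)
          show "i + length e \<le> n - m" if "i \<in> I2'" for i using that I by (force simp: I2'_def I2_def)
        qed (use fin k in \<open>auto simp: k_def\<close>)
        also have "\<dots> \<le> 3 * real k ^ 4 * (real (card I))\<^sup>2"
          using cards by (intro mult_left_mono power_mono) auto
        finally have "C * measure_pmf.expectation (replicate_pmf (n - m) p) G2 \<le> C * (3 * real k ^ 4 * (real (card I))\<^sup>2)"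
          using C by simp
        moreover have "measure_pmf.expectation (bridge_pmf p n) (\<lambda>xs. G2 (drop m xs)) \<le> C * measure_pmf.expectation (replicate_pmf (n - m) p) G2"
          unfolding m_def using elim[rule_format, of G2 "real (card I2') ^ 4"] Gb by (simp add: G2_def)
        ultimately show "measure_pmf.expectation (bridge_pmf p n) (\<lambda>xs. G2 (drop m xs)) \<le> C * (3 * real k ^ 4 * (real (card I))\<^sup>2)" by simp
      qed simp
      also have "\<dots> \<le> D * ((real (card I))\<^sup>2 + 1)"
        using C by (simp add: D_def algebra_simps)
      finally show "measure_pmf.expectation (bridge_pmf p n) (\<lambda>xs. (?g I xs) ^ 4) \<le> D * ((real (card I))\<^sup>2 + 1)" .
    qed
  qed
  then show ?thesis using D by blast
qed

end

section \<open>The cost of cutting into blocks\<close>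

lemma card_window_starts: "{i. i + k \<le> n} = {..<n + 1 - k}" "card {i. i + k \<le> (n :: nat)} = n + 1 - k"
proof -
  show "{i. i + k \<le> n} = {..<n + 1 - k}" by auto
  then show "card {i. i + k \<le> n} = n + 1 - k" by simp
qed

lemma occ_eq_sum:
  assumes "e \<noteq> []"
  shows "real (occ e xs) = (\<Sum>i | i + length e \<le> length xs. of_bool (prefix e (drop i xs)))"
proof -
  have "{i. i < length xs \<and> prefix e (drop i xs)} = {i. i + length e \<le> length xs} \<inter> {i. prefix e (drop i xs)}"
  proof (intro set_eqI iffI)
    fix i assume i: "i \<in> {i. i + length e \<le> length xs} \<inter> {i. prefix e (drop i xs)}"
    have "0 < length e" using assms by simp
    moreover have "i + length e \<le> length xs" using i by simp
    ultimately have "i < length xs" by linarith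
    then show "i \<in> {i. i < length xs \<and> prefix e (drop i xs)}" using i by simp
  qed (use assms in \<open>auto simp: prefix_drop_iff\<close>)
  then show ?thesis
    by (simp add: occ_def card_window_starts(1))
qed

lemma occ_le_length: "occ e xs \<le> length xs"
proof -
  have "occ e xs \<le> card {..<length xs}" unfolding occ_def by (rule card_mono) auto
  then show ?thesis by simp
qed

lemma of_bool_prefix_eq: "(of_bool (prefix e (drop i xs)) :: real) = letter_dev q e i xs + q"
  by (simp add: letter_dev_def)

text \<open>The strict inequality keeps a window away from the last letter of its block as well,
  since that letter is to stay free.\<close>

definition block_windows :: "nat \<Rightarrow> nat \<Rightarrow> nat \<Rightarrow> nat set" where
  "block_windows k K N = {i. i < N * K \<and> i mod K + k < K}"

lemma finite_block_windows [simp]: "finite (block_windows k K N)"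
  by (simp add: block_windows_def)

lemma block_windows_Suc:
  assumes "K > 0"
  shows "block_windows k K (Suc N) = {i. i + k < K} \<union> (\<lambda>i. i + K) ` block_windows k K N"
proof (intro set_eqI iffI)
  fix i assume i: "i \<in> block_windows k K (Suc N)"
  show "i \<in> {i. i + k < K} \<union> (\<lambda>i. i + K) ` block_windows k K N"
  proof (cases "i < K")
    case True then show ?thesis using i by (simp add: block_windows_def)
  next
    case False
    then have "i - K \<in> block_windows k K N"
      using i by (auto simp: block_windows_def le_mod_geq)
    then show ?thesis using False by (auto intro!: image_eqI[of _ _ "i - K"])
  qed
next
  fix i assume "i \<in> {i. i + k < K} \<union> (\<lambda>i. i + K) ` block_windows k K N"
  then show "i \<in> block_windows k K (Suc N)"
    by (auto simp: block_windows_def)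
qed

lemma block_windows_disjoint: "{i. i + k < K} \<inter> (\<lambda>i. i + K) ` block_windows k K N = {}"
  by auto

lemma finite_initial_windows: "finite {i. i + k < (K :: nat)}"
  by (rule finite_subset[of _ "{..<K}"]) auto

lemma card_block_windows:
  assumes "K > 0"
  shows "card (block_windows k K N) = N * (K - k)"
proof (induction N)
  case (Suc N)
  have "{i. i + k < K} = {..<K - k}" by auto
  then have "card {i. i + k < K} = K - k" by simp
  moreover have "inj_on (\<lambda>i. i + K) (block_windows k K N)" by (simp add: inj_on_def)
  ultimately show ?case
    unfolding block_windows_Suc[OF assms] using Suc
    by (subst card_Un_disjoint[OF finite_initial_windows _ block_windows_disjoint]) (simp_all add: card_image)
qed (simp add: block_windows_def)

lemma block_sum_occ:
  assumes e: "e \<noteq> []" and K: "K > 0"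
  shows "N * K \<le> length xs \<Longrightarrow> block_sum (\<lambda>ys. real (occ e ys)) K N xs =
     (\<Sum>i\<in>block_windows (length e) K N. of_bool (prefix e (drop i xs)))"
proof (induction N arbitrary: xs)
  case (Suc N)
  have len: "K - 1 \<le> length xs" using Suc.prems by simp
  have w: "{i. i + length e \<le> K - 1} = {i. i + length e < K}" using K by auto
  have "real (occ e (take (K - 1) xs)) = (\<Sum>i | i + length e \<le> K - 1. of_bool (prefix e (drop i (take (K - 1) xs))))"
    using len by (simp add: occ_eq_sum[OF e] min_absorb2)
  also have "\<dots> = (\<Sum>i | i + length e \<le> K - 1. of_bool (prefix e (drop i xs)))"
    using letter_dev_take[of _ e "K - 1" 0 xs] by (intro sum.cong) (auto simp: letter_dev_def)
  finally have 1: "real (occ e (take (K - 1) xs)) = (\<Sum>i | i + length e < K. of_bool (prefix e (drop i xs)))"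
    unfolding w .
  have "block_sum (\<lambda>ys. real (occ e ys)) K N (drop K xs) = (\<Sum>i\<in>block_windows (length e) K N. of_bool (prefix e (drop i (drop K xs))))"
    using Suc.prems by (intro Suc.IH) auto
  also have "\<dots> = (\<Sum>i\<in>(\<lambda>i. i + K) ` block_windows (length e) K N. of_bool (prefix e (drop i xs)))"
    by (subst sum.reindex) (auto simp: inj_on_def)
  finally show ?case
    unfolding block_windows_Suc[OF K] using 1
    by (subst sum.union_disjoint[OF finite_initial_windows _ block_windows_disjoint]) auto
qed (simp add: block_windows_def)

lemma block_sum_linear:
  "block_sum (\<lambda>ys. \<Sum>T\<in>S. a T * (f T ys - c T)) K N xs = (\<Sum>T\<in>S. a T * (block_sum (f T) K N xs - real N * c T))"
  by (induction N arbitrary: xs) (simp_all add: sum.distrib[symmetric] algebra_simps)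

lemma finite_set_bridge_pmf: "bridge_prob p n > 0 \<Longrightarrow> finite (set_pmf (bridge_pmf p n))"
  using finite_bridges by (simp add: bridge_pmf_def set_cond_pmf[OF bridge_prob_pos_imp_nonempty])

lemma integrable_bridge_pmf:
  fixes f :: "nat list \<Rightarrow> 'b :: {banach, second_countable_topology}"
  shows "bridge_prob p n > 0 \<Longrightarrow> integrable (measure_pmf (bridge_pmf p n)) f"
  by (intro integrable_measure_pmf_finite finite_set_bridge_pmf)

lemma set_bridge_pmf_length: "bridge_prob p n > 0 \<Longrightarrow> xs \<in> set_pmf (bridge_pmf p n) \<Longrightarrow> length xs = n"
  using set_cond_pmf[OF bridge_prob_pos_imp_nonempty, of p n] by (auto simp: bridge_pmf_def bridges_def)

lemma expectation_mono_bridge: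
  fixes f g :: "nat list \<Rightarrow> real"
  assumes "bridge_prob p n > 0" "\<And>xs. length xs = n \<Longrightarrow> f xs \<le> g xs"
  shows "measure_pmf.expectation (bridge_pmf p n) f \<le> measure_pmf.expectation (bridge_pmf p n) g"
  by (intro integral_mono_AE integrable_bridge_pmf assms(1))
    (auto simp: AE_measure_pmf_iff intro!: assms(2) set_bridge_pmf_length[OF assms(1)])

text \<open>Turns a fourth moment into a bound for a first moment; \<open>\<delta>\<close> is to be
  taken at the typical size of \<open>y\<close>.\<close>

lemma abs_le_add_power4: "\<delta> > 0 \<Longrightarrow> \<bar>y\<bar> \<le> \<delta> + y ^ 4 / \<delta> ^ 3" for y \<delta> :: real
proof (cases "\<bar>y\<bar> \<le> \<delta>")
  case False
  assume d: "\<delta> > 0"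
  have "\<bar>y\<bar> * \<delta> ^ 3 \<le> \<bar>y\<bar> * \<bar>y\<bar> ^ 3" using False d by (intro mult_left_mono power_mono) auto
  also have "\<dots> = y ^ 4" by (simp add: power_even_abs flip: power_Suc)
  finally have "\<bar>y\<bar> \<le> y ^ 4 / \<delta> ^ 3" using d by (simp add: pos_le_divide_eq)
  then show ?thesis using d by simp
qed (simp add: add_increasing2)

context critical_offspring
begin

definition dev :: "plane_tree \<Rightarrow> nat list \<Rightarrow> real" where
  "dev T xs = real (cyclic_occ (degree_seq T) xs) - real (length xs) * tree_prob p T"

lemma tree_prob_bounds: "0 \<le> tree_prob p T" "tree_prob p T \<le> 1"
  by (simp_all add: tree_prob_eq_pmf pmf_le_1)

abbreviation "tdev T \<equiv> letter_dev (tree_prob p T) (degree_seq T)"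

text \<open>The error collects two boundary effects: at most \<open>tree_order T\<close> wrapping
  windows, and the \<open>tree_order T - 1\<close> starts by which the number of windows falls short
  of the length in the centring. The set \<open>J\<close> is empty for the moment bound and consists
  of the block windows for the block approximation.\<close>

lemma dev_minus_windows:
  assumes J: "J \<subseteq> {i. i + tree_order T \<le> length xs}"
    and ord: "tree_order T \<le> length xs"
  shows "\<bar>(dev T xs - ((\<Sum>i\<in>J. of_bool (prefix (degree_seq T) (drop i xs))) - real (card J) * tree_prob p T)) -
      (\<Sum>i\<in>{i. i + tree_order T \<le> length xs} - J. tdev T i xs)\<bar> \<le> 2 * real (tree_order T)"
proof -
  let ?n = "length xs" and ?k = "tree_order T" and ?q = "tree_prob p T" and ?e = "degree_seq T"
  let ?A = "{i. i + ?k \<le> ?n}"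
  have fin: "finite ?A" by (simp add: card_window_starts(1))
  have "real (occ ?e xs) = (\<Sum>i\<in>?A. of_bool (prefix ?e (drop i xs)))"
    using occ_eq_sum[of ?e xs] by simp
  also have "\<dots> = (\<Sum>i\<in>J. of_bool (prefix ?e (drop i xs))) + (\<Sum>i\<in>?A - J. of_bool (prefix ?e (drop i xs)))"
    using sum.subset_diff[OF J fin, of "\<lambda>i. of_bool (prefix ?e (drop i xs)) :: real"] by simp
  also have "(\<Sum>i\<in>?A - J. of_bool (prefix ?e (drop i xs))) = (\<Sum>i\<in>?A - J. tdev T i xs) + real (card (?A - J)) * ?q"
    by (simp add: of_bool_prefix_eq[of _ _ _ ?q] sum.distrib)
  also have "real (card (?A - J)) = real (?n + 1 - ?k) - real (card J)"
    using card_Diff_subset[OF finite_subset[OF J fin] J] card_mono[OF fin J] by (simp add: card_window_starts(2) of_nat_diff)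
  also have "real (?n + 1 - ?k) = real ?n + 1 - real ?k" using ord by (simp add: of_nat_diff)
  finally have occ: "real (occ ?e xs) = (\<Sum>i\<in>J. of_bool (prefix ?e (drop i xs))) + ((\<Sum>i\<in>?A - J. tdev T i xs) + (real ?n + 1 - real ?k - real (card J)) * ?q)" .
  have c: "real (occ ?e xs) \<le> real (cyclic_occ ?e xs)" "real (cyclic_occ ?e xs) \<le> real (occ ?e xs) + real ?k"
    using occ_le_cyclic_occ[of ?e xs] cyclic_occ_le_occ[of ?e xs] by simp_all
  have k: "0 \<le> (real ?k - 1) * ?q" "(real ?k - 1) * ?q \<le> real ?k"
  proof -
    have "real ?k \<ge> 1" using tree_order_pos[of T] by linarith
    then show "0 \<le> (real ?k - 1) * ?q" using tree_prob_bounds by simp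
    have "(real ?k - 1) * ?q \<le> (real ?k - 1) * 1" using \<open>real ?k \<ge> 1\<close> tree_prob_bounds by (intro mult_left_mono) auto
    then show "(real ?k - 1) * ?q \<le> real ?k" by simp
  qed
  have "(dev T xs - ((\<Sum>i\<in>J. of_bool (prefix ?e (drop i xs))) - real (card J) * ?q)) - (\<Sum>i\<in>?A - J. tdev T i xs)
     = (real (cyclic_occ ?e xs) - real (occ ?e xs)) - (real ?k - 1) * ?q"
    unfolding occ dev_def by (simp add: algebra_simps)
  then show ?thesis using c k by simp
qed

lemma tdev_moment4: "\<exists>C>0. \<forall>\<^sub>F n in lattice_at_top. \<forall>I. (\<forall>i\<in>I. i + tree_order T \<le> n) \<longrightarrow>
     measure_pmf.expectation (bridge_pmf p n) (\<lambda>xs. (\<Sum>i\<in>I. tdev T i xs) ^ 4) \<le> C * ((real (card I))\<^sup>2 + 1)"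
  using bridge_letter_dev_moment4[of "degree_seq T"] by (simp add: tree_prob_eq_pmf)

lemma dev_moment4: "\<exists>C\<ge>0. \<forall>\<^sub>F n in lattice_at_top. measure_pmf.expectation (bridge_pmf p n) (\<lambda>xs. (dev T xs) ^ 4) \<le> C * (real n)\<^sup>2"
proof -
  let ?k = "tree_order T"
  obtain C where C: "C > 0" "\<forall>\<^sub>F n in lattice_at_top. \<forall>I. (\<forall>i\<in>I. i + tree_order T \<le> n) \<longrightarrow>
     measure_pmf.expectation (bridge_pmf p n) (\<lambda>xs. (\<Sum>i\<in>I. tdev T i xs) ^ 4) \<le> C * ((real (card I))\<^sup>2 + 1)"
    using tdev_moment4 by blast
  have n: "\<forall>\<^sub>F n in lattice_at_top. n \<ge> ?k + 1"
    by (rule filter_leD[OF lattice_at_top_le eventually_ge_at_top])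
  \<comment> \<open>The 8 separates the boundary error from the window sum; 16 is the fourth power
    of the 2 in that error, and \<open>2 * C\<close> absorbs the summand 1 next to the squared
    cardinality.\<close>
  define D where "D = 8 * (16 * real ?k ^ 4 + 2 * C)"
  have "\<forall>\<^sub>F n in lattice_at_top. measure_pmf.expectation (bridge_pmf p n) (\<lambda>xs. (dev T xs) ^ 4) \<le> D * (real n)\<^sup>2"
    using C(2) n eventually_bridge_prob_pos
  proof eventually_elim
    case (elim n)
    let ?A = "{i. i + ?k \<le> n}"
    have pw: "(x + y) ^ 4 \<le> 8 * (x ^ 4 + y ^ 4)" for x y :: real
      using sum_power4_le[of "\<lambda>i. [x, y] ! i" "{..<2::nat}"] by (simp add: eval_nat_numeral)
    have "measure_pmf.expectation (bridge_pmf p n) (\<lambda>xs. (dev T xs) ^ 4) \<le>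
       measure_pmf.expectation (bridge_pmf p n) (\<lambda>xs. 8 * ((2 * real ?k) ^ 4 + (\<Sum>i\<in>?A. tdev T i xs) ^ 4))"
    proof (rule expectation_mono_bridge[OF elim(3)])
      fix xs :: "nat list" assume len: "length xs = n"
      let ?y = "\<Sum>i\<in>?A. tdev T i xs"
      have "\<bar>dev T xs - ?y\<bar> \<le> 2 * real ?k"
        using dev_minus_windows[of "{}" T xs] len elim(2) by simp
      then have "\<bar>dev T xs - ?y\<bar> ^ 4 \<le> (2 * real ?k) ^ 4" by (intro power_mono) auto
      then have "(dev T xs - ?y) ^ 4 \<le> (2 * real ?k) ^ 4" by simp
      then have "8 * ((dev T xs - ?y) ^ 4 + ?y ^ 4) \<le> 8 * ((2 * real ?k) ^ 4 + ?y ^ 4)" by simp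
      moreover have "(dev T xs) ^ 4 \<le> 8 * ((dev T xs - ?y) ^ 4 + ?y ^ 4)" using pw[of "dev T xs - ?y" ?y] by simp
      ultimately show "(dev T xs) ^ 4 \<le> 8 * ((2 * real ?k) ^ 4 + ?y ^ 4)" by (rule order_trans[rotated])
    qed
    also have "\<dots> = 8 * (16 * real ?k ^ 4 + measure_pmf.expectation (bridge_pmf p n) (\<lambda>xs. (\<Sum>i\<in>?A. tdev T i xs) ^ 4))"
      unfolding integral_mult_right_zero
      by (subst Bochner_Integration.integral_add[OF _ integrable_bridge_pmf[OF elim(3)]]) (simp_all add: power_mult_distrib)
    also have "\<dots> \<le> 8 * (16 * real ?k ^ 4 * (real n)\<^sup>2 + 2 * C * (real n)\<^sup>2)"
    proof (intro mult_left_mono add_mono)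
      have n1: "1 \<le> (real n)\<^sup>2" using elim(2) by (simp add: one_le_power)
      then show "16 * real ?k ^ 4 \<le> 16 * real ?k ^ 4 * (real n)\<^sup>2" by (simp add: mult_le_cancel_left1)
      have "measure_pmf.expectation (bridge_pmf p n) (\<lambda>xs. (\<Sum>i\<in>?A. tdev T i xs) ^ 4) \<le> C * ((real (card ?A))\<^sup>2 + 1)"
        using elim(1)[rule_format, of ?A] by simp
      also have "real (card ?A) \<le> real n" using tree_order_pos[of T] elim(2) unfolding card_window_starts(2) by linarith
      then have "(real (card ?A))\<^sup>2 + 1 \<le> (real n)\<^sup>2 + (real n)\<^sup>2" using n1 by (intro add_mono power_mono) auto
      then have "C * ((real (card ?A))\<^sup>2 + 1) \<le> C * ((real n)\<^sup>2 + (real n)\<^sup>2)" using C(1) by (intro mult_left_mono) auto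
      finally show "measure_pmf.expectation (bridge_pmf p n) (\<lambda>xs. (\<Sum>i\<in>?A. tdev T i xs) ^ 4) \<le> 2 * C * (real n)\<^sup>2" by simp
    qed simp
    finally show ?case by (simp add: D_def algebra_simps)
  qed
  then show ?thesis using C(1) by (intro exI[of _ D]) (auto simp: D_def)
qed

text \<open>Only the windows that are not contained in the first \<open>K - 1\<close> letters of some block are
  lost; there are \<open>O(n / K)\<close> of them.\<close>

lemma dev_block_error:
  "\<exists>A\<ge>0. \<forall>K>tree_order T. \<forall>\<^sub>F n in lattice_at_top.
     measure_pmf.expectation (bridge_pmf p n)
       (\<lambda>xs. \<bar>dev T xs - (block_sum (\<lambda>ys. real (occ (degree_seq T) ys)) K (n div K) xs - real (n div K) * ((real K - real (tree_order T)) * tree_prob p T))\<bar>)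
     \<le> A * sqrt n / sqrt K"
proof -
  let ?k = "tree_order T"
  obtain C where C: "C > 0" "\<forall>\<^sub>F n in lattice_at_top. \<forall>I. (\<forall>i\<in>I. i + tree_order T \<le> n) \<longrightarrow>
     measure_pmf.expectation (bridge_pmf p n) (\<lambda>xs. (\<Sum>i\<in>I. tdev T i xs) ^ 4) \<le> C * ((real (card I))\<^sup>2 + 1)"
    using tdev_moment4 by blast
  \<comment> \<open>Two multiples of \<open>\<delta>\<close> stem from the boundary error and from
    \<open>abs_le_add_power4\<close>. The 5 is 2^2 + 1: at most \<open>2 * (n * k / K)\<close>
    windows are lost, and \<open>n * k / K\<close> is at least 1.\<close>
  define A where "A = 2 + 5 * C * (real ?k)\<^sup>2"
  have "\<forall>\<^sub>F n in lattice_at_top.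
     measure_pmf.expectation (bridge_pmf p n)
       (\<lambda>xs. \<bar>dev T xs - (block_sum (\<lambda>ys. real (occ (degree_seq T) ys)) K (n div K) xs - real (n div K) * ((real K - real ?k) * tree_prob p T))\<bar>)
     \<le> A * sqrt n / sqrt K" if K: "K > ?k" for K
  proof -
    have K0: "K > 0" using K by simp
    \<comment> \<open>The two summands ensure that the boundary error \<open>2 * ?k\<close> is at
      most \<open>\<delta>\<close> below and that \<open>K\<close> is at most
      \<open>n / K\<close>.\<close>
    have n: "\<forall>\<^sub>F n in lattice_at_top. n \<ge> (2 * ?k)\<^sup>2 * K\<^sup>2 + K\<^sup>2"
      by (rule filter_leD[OF lattice_at_top_le eventually_ge_at_top])
    from C(2) n eventually_bridge_prob_pos show ?thesis
    proof eventually_elim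
      case (elim n)
      let ?N = "n div K"
      define J where "J = block_windows ?k K ?N"
      define I where "I = {i. i + ?k \<le> n} - J"
      have n0: "n > 0" using elim(2) K0 by (metis add_gr_0 gr0I le_zero_eq not_less_zero zero_less_power)
      have KK: "K\<^sup>2 \<le> n" and kk: "(2 * ?k)\<^sup>2 * K \<le> n" using elim(2) K0 by (simp, metis (no_types, lifting) add_leD1 le_trans mult_le_mono2 power2_nat_le_imp_le self_le_power pos2 One_nat_def Suc_leI le_square power2_eq_square)
      have NK: "?N * K \<le> n" by simp
      have nle: "n < ?N * K + K" using dividend_less_div_times[OF K0, of n] by simp
      have kn: "?k \<le> n" using K KK by (metis le_trans less_imp_le_nat power2_nat_le_imp_le)
      have J: "J \<subseteq> {i. i + ?k \<le> n}"
      proof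
        fix i assume "i \<in> J"
        then have i: "i < ?N * K" "i mod K + ?k < K" by (auto simp: J_def block_windows_def)
        then have "i div K < ?N" by (simp add: less_mult_imp_div_less)
        then have "(i div K + 1) * K \<le> ?N * K" by (intro mult_le_mono1) simp
        moreover have "(i div K + 1) * K = i div K * K + K" by simp
          ultimately have "i div K * K + K \<le> n" using NK by linarith
        then have "i + ?k \<le> n" using i(2) div_mult_mod_eq[of i K] by linarith
        then show "i \<in> {i. i + ?k \<le> n}" by simp
      qed
      have cardJ: "card J = ?N * (K - ?k)" unfolding J_def by (rule card_block_windows[OF K0])
      have "card I = n + 1 - ?k - ?N * (K - ?k)"
        unfolding I_def using J cardJ by (simp add: card_Diff_subset J_def card_window_starts(2))
      then have "real (card I) \<le> real n + 1 - real ?k - real ?N * (real K - real ?k)"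
        using K kn card_mono[OF _ J] cardJ by (simp add: of_nat_diff card_window_starts)
      also have "\<dots> \<le> real K + real ?N * real ?k"
      proof -
        have "real n \<le> real (?N * K + K)" using nle by (simp only: of_nat_le_iff)
        moreover have "1 \<le> real ?k" using tree_order_pos[of T] by linarith
        ultimately show ?thesis by (simp add: algebra_simps)
      qed
      also have "\<dots> \<le> 2 * (real n * real ?k / real K)"
      proof -
        have "real K * real K \<le> real n" using KK by (simp add: power2_eq_square flip: of_nat_mult)
        moreover have "real n * 1 \<le> real n * real ?k" using tree_order_pos[of T] by (intro mult_left_mono) linarith+
        ultimately have "real K \<le> real n * real ?k / real K" using K0 by (simp add: pos_le_divide_eq)
        moreover have "real ?N * real ?k \<le> real n / real K * real ?k"
          by (intro mult_right_mono of_nat_div_le_of_nat) simp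
        then have "real ?N * real ?k \<le> real n * real ?k / real K" by simp
        ultimately show ?thesis unfolding mult_2 by (rule add_mono)
      qed
      finally have cardI: "real (card I) \<le> 2 * (real n * real ?k / real K)" .
      let ?x = "\<lambda>xs. \<Sum>i\<in>I. tdev T i xs"
      have m4: "measure_pmf.expectation (bridge_pmf p n) (\<lambda>xs. (?x xs) ^ 4) \<le> 5 * C * (real n * real ?k / real K)\<^sup>2"
      proof -
        have "measure_pmf.expectation (bridge_pmf p n) (\<lambda>xs. (?x xs) ^ 4) \<le> C * ((real (card I))\<^sup>2 + 1)"
          using elim(1)[rule_format, of I] by (auto simp: I_def)
        also have "\<dots> \<le> C * ((2 * (real n * real ?k / real K))\<^sup>2 + (real n * real ?k / real K)\<^sup>2)"
        proof (intro mult_left_mono add_mono power_mono cardI)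
          have "real K \<le> real n * real ?k"
          proof -
            have "K \<le> n" using KK by (metis le_trans power2_nat_le_imp_le order_refl)
            then have "real K * 1 \<le> real n * real ?k" using tree_order_pos[of T] by (intro mult_mono) linarith+
            then show ?thesis by simp
          qed
          then have "1 \<le> real n * real ?k / real K" using K0 by simp
          then show "1 \<le> (real n * real ?k / real K)\<^sup>2" by (rule one_le_power)
        qed (use C(1) in auto)
        finally show ?thesis by (simp only: power_mult_distrib) (simp add: algebra_simps)
      qed
      \<comment> \<open>The order of a centred sum over \<open>n / K\<close> lost windows.\<close>
      define \<delta> where "\<delta> = sqrt n / sqrt K"
      have \<delta>: "\<delta> > 0" using n0 K0 by (simp add: \<delta>_def)
      have \<delta>4: "\<delta> ^ 4 = (real n / real K)\<^sup>2"
      proof -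
        have "\<delta> ^ 4 = (\<delta>\<^sup>2)\<^sup>2" by (simp flip: power_mult)
        also have "\<delta>\<^sup>2 = real n / real K" by (simp add: \<delta>_def power_divide)
        finally show ?thesis .
      qed
      have "measure_pmf.expectation (bridge_pmf p n)
       (\<lambda>xs. \<bar>dev T xs - (block_sum (\<lambda>ys. real (occ (degree_seq T) ys)) K ?N xs - real ?N * ((real K - real ?k) * tree_prob p T))\<bar>)
        \<le> measure_pmf.expectation (bridge_pmf p n) (\<lambda>xs. \<delta> + (\<delta> + (?x xs) ^ 4 / \<delta> ^ 3))"
      proof (rule expectation_mono_bridge[OF elim(3)])
        fix xs :: "nat list" assume len: "length xs = n"
        have bs: "block_sum (\<lambda>ys. real (occ (degree_seq T) ys)) K ?N xs = (\<Sum>i\<in>J. of_bool (prefix (degree_seq T) (drop i xs)))"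
          using block_sum_occ[of "degree_seq T" K ?N xs] K0 len by (simp add: J_def)
        have cJ: "real (card J) = real ?N * (real K - real ?k)" using K by (simp add: cardJ of_nat_diff)
        have "\<bar>(dev T xs - (block_sum (\<lambda>ys. real (occ (degree_seq T) ys)) K ?N xs - real ?N * ((real K - real ?k) * tree_prob p T))) - ?x xs\<bar> \<le> 2 * real ?k"
          using dev_minus_windows[of J T xs] J len kn by (simp add: bs cJ I_def)
        moreover have "2 * real ?k \<le> \<delta>"
        proof (rule power2_le_imp_le)
          have "real ((2 * ?k)\<^sup>2 * K) \<le> real n" using kk by (simp only: of_nat_le_iff)
          then show "(2 * real ?k)\<^sup>2 \<le> \<delta>\<^sup>2" using K0 by (simp add: \<delta>_def power_divide pos_le_divide_eq)
        qed (use \<delta> in simp)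
        moreover have "\<bar>?x xs\<bar> \<le> \<delta> + (?x xs) ^ 4 / \<delta> ^ 3" by (rule abs_le_add_power4[OF \<delta>])
        ultimately show "\<bar>dev T xs - (block_sum (\<lambda>ys. real (occ (degree_seq T) ys)) K ?N xs - real ?N * ((real K - real ?k) * tree_prob p T))\<bar> \<le> \<delta> + (\<delta> + (?x xs) ^ 4 / \<delta> ^ 3)"
          by linarith
      qed
      also have "\<dots> = \<delta> + (\<delta> + measure_pmf.expectation (bridge_pmf p n) (\<lambda>xs. (?x xs) ^ 4) / \<delta> ^ 3)"
      proof -
        have i: "integrable (bridge_pmf p n) f" for f :: "nat list \<Rightarrow> real" by (rule integrable_bridge_pmf[OF elim(3)])
        show ?thesis
          by (simp only: Bochner_Integration.integral_add[OF i i] integral_divide_zero lebesgue_integral_const measure_pmf.prob_space) simp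
      qed
      also have "\<dots> \<le> \<delta> + (\<delta> + 5 * C * (real n * real ?k / real K)\<^sup>2 / \<delta> ^ 3)"
        using \<delta> by (intro add_left_mono divide_right_mono m4) simp
      also have "5 * C * (real n * real ?k / real K)\<^sup>2 / \<delta> ^ 3 = 5 * C * (real ?k)\<^sup>2 * \<delta>"
      proof -
        have "(real n * real ?k / real K)\<^sup>2 = (real ?k)\<^sup>2 * \<delta> ^ 4" unfolding \<delta>4 by (simp add: power_mult_distrib power_divide)
        also have "\<delta> ^ 4 = \<delta> * \<delta> ^ 3" by (simp add: eval_nat_numeral)
        finally show ?thesis using \<delta> by simp
      qed
      also have "\<delta> + (\<delta> + 5 * C * (real ?k)\<^sup>2 * \<delta>) = A * sqrt n / sqrt K" by (simp add: A_def \<delta>_def algebra_simps add_divide_distrib)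
      finally show ?case .
    qed
  qed
  then show ?thesis using C(1) by (intro exI[of _ A]) (auto simp: A_def)
qed

end

section \<open>Covariances of the pattern counts\<close>

context critical_offspring
begin

abbreviation "EE m \<equiv> measure_pmf.expectation (replicate_pmf m p)"

abbreviation "rocc T xs \<equiv> real (occ (degree_seq T) xs)"

lemma integrable_replicate_bounded:
  fixes f :: "nat list \<Rightarrow> real"
  assumes "\<And>xs. length xs = m \<Longrightarrow> \<bar>f xs\<bar> \<le> C"
  shows "integrable (replicate_pmf m p) f"
  by (rule integrable_bounded_pmf[of _ _ C]) (use assms in \<open>auto simp: set_replicate_pmf\<close>)

lemma integrable_rocc: "integrable (replicate_pmf m p) (rocc T)"
  by (rule integrable_replicate_bounded[of _ _ m]) (use occ_le_length in auto)

lemma rocc_mult_le: "length xs = m \<Longrightarrow> \<bar>rocc T xs * rocc T' xs\<bar> \<le> real m * real m"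
  using occ_le_length[of "degree_seq T" xs] occ_le_length[of "degree_seq T'" xs] by (auto intro!: mult_mono simp flip: of_nat_mult)

lemma integrable_rocc_mult: "integrable (replicate_pmf m p) (\<lambda>xs. rocc T xs * rocc T' xs)"
  by (rule integrable_replicate_bounded[of _ _ "real m * real m"]) (rule rocc_mult_le)

lemma integrable_rocc_walk: "integrable (replicate_pmf m p) (\<lambda>xs. rocc T xs * walk xs)"
proof (rule Bochner_Integration.integrable_bound)
  show "integrable (replicate_pmf m p) (\<lambda>xs. real m * walk xs)" using integrable_walk by simp
  have "norm (rocc T xs * walk xs) \<le> norm (real m * walk xs)" if "length xs = m" for xs
    using occ_le_length[of "degree_seq T" xs] that by (simp add: abs_mult mult_right_mono)
  then show "AE xs in replicate_pmf m p. norm (rocc T xs * walk xs) \<le> norm (real m * walk xs)"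
    by (auto simp: AE_measure_pmf_iff set_replicate_pmf)
qed simp

lemma expectation_rocc:
  assumes "tree_order T \<le> m + 1"
  shows "EE m (rocc T) = (real m + 1 - real (tree_order T)) * tree_prob p T"
proof -
  let ?A = "{i. i + tree_order T \<le> m}"
  have fin: "finite ?A" by (simp add: card_window_starts(1))
  have int: "integrable (replicate_pmf m p) (tdev T i)" for i
    by (rule integrable_replicate_bounded[of _ _ 1]) (intro abs_letter_dev_le tree_prob_bounds)
  have "EE m (rocc T) = EE m (\<lambda>xs. (\<Sum>i\<in>?A. tdev T i xs) + real (card ?A) * tree_prob p T)"
  proof (intro integral_cong_AE)
    have "rocc T xs = (\<Sum>i\<in>?A. tdev T i xs) + real (card ?A) * tree_prob p T" if "length xs = m" for xs
      using that by (simp add: occ_eq_sum of_bool_prefix_eq[of _ _ _ "tree_prob p T"] sum.distrib)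
    then show "AE xs in replicate_pmf m p. rocc T xs = (\<Sum>i\<in>?A. tdev T i xs) + real (card ?A) * tree_prob p T"
      by (simp add: AE_measure_pmf_iff set_replicate_pmf)
  qed auto
  also have "\<dots> = (\<Sum>i\<in>?A. EE m (tdev T i)) + real (card ?A) * tree_prob p T"
    using int by simp
  also have "(\<Sum>i\<in>?A. EE m (tdev T i)) = 0"
  proof (intro sum.neutral ballI)
    fix i assume "i \<in> ?A"
    then have "EE m (\<lambda>xs. \<Sum>i\<in>{i}. tdev T i xs) = 0"
      unfolding tree_prob_eq_pmf length_degree_seq[symmetric]
      by (intro letter_dev_moments_separated[THEN conjunct1]) auto
    then show "EE m (tdev T i) = 0" by simp
  qed
  finally show ?thesis using assms by (simp add: card_window_starts(2) of_nat_diff)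
qed

lemma expectation_prefix_tree:
  assumes "tree_order T \<le> m" and f: "integrable (replicate_pmf (m - tree_order T) p) f"
  shows "integrable (replicate_pmf m p) (\<lambda>xs. of_bool (prefix (degree_seq T) xs) * f (drop (tree_order T) xs))"
    "EE m (\<lambda>xs. of_bool (prefix (degree_seq T) xs) * f (drop (tree_order T) xs)) = tree_prob p T * EE (m - tree_order T) f"
  using expectation_prefix[OF f, of "degree_seq T"] assms(1) by (simp_all add: tree_prob_eq_pmf)

lemma expectation_replicate_tl:
  fixes f :: "nat list \<Rightarrow> real"
  assumes f: "integrable (replicate_pmf m p) f"
  shows "integrable (replicate_pmf (Suc m) p) (\<lambda>xs. f (tl xs))" "EE (Suc m) (\<lambda>xs. f (tl xs)) = EE m f"
  using expectation_replicate_Suc[of p "\<lambda>_. 1 :: real", OF _ f] by (simp_all del: replicate_pmf.simps)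

lemma replicate_pmf_Suc_Cons:
  assumes "\<And>x ys. length ys = m \<Longrightarrow> P (x # ys)"
  shows "AE xs in replicate_pmf (Suc m) p. P xs"
  using assms by (auto simp: AE_measure_pmf_iff set_replicate_pmf length_Suc_conv simp del: replicate_pmf.simps)

text \<open>If the word starts with \<open>degree_seq T\<close>, the occurrences of
  \<open>T'\<close> lie either inside that codeword or in the independent rest; none straddles. The
  \<open>of_bool\<close> removes the occurrence at position 0, which \<open>tl\<close> does not
  see.\<close>

lemma expectation_prefix_occ_tl:
  assumes "tree_order T \<le> Suc m" "tree_order T + tree_order T' \<le> m + 2"
  shows "EE (Suc m) (\<lambda>xs. of_bool (prefix (degree_seq T) xs) * rocc T' (tl xs)) =
     tree_prob p T * (real (subtree_count T' T) - of_bool (T = T') + (real m + 2 - real (tree_order T) - real (tree_order T')) * tree_prob p T')"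
proof -
  let ?c = "real (subtree_count T' T) - of_bool (T = T')"
  let ?f = "\<lambda>ys. ?c + rocc T' ys"
  have int: "integrable (replicate_pmf (Suc m - tree_order T) p) ?f"
    by (intro Bochner_Integration.integrable_add integrable_rocc) simp
  have "EE (Suc m) (\<lambda>xs. of_bool (prefix (degree_seq T) xs) * rocc T' (tl xs)) =
    EE (Suc m) (\<lambda>xs. of_bool (prefix (degree_seq T) xs) * ?f (drop (tree_order T) xs))"
  proof (intro integral_cong_AE replicate_pmf_Suc_Cons)
    fix x :: nat and ys :: "nat list"
    show "of_bool (prefix (degree_seq T) (x # ys)) * rocc T' (tl (x # ys)) = of_bool (prefix (degree_seq T) (x # ys)) * ?f (drop (tree_order T) (x # ys))"
    proof (cases "prefix (degree_seq T) (x # ys)")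
      case True
      then obtain zs where zs: "x # ys = degree_seq T @ zs" by (auto elim: prefixE)
      have "of_bool (T' = T) + occ (degree_seq T') ys = subtree_count T' T + occ (degree_seq T') zs"
        using occ_Cons[of "degree_seq T'" x ys] unfolding zs occ_degree_seq_append prefix_degree_seq_append by simp
      then have "of_bool (T' = T) + rocc T' ys = real (subtree_count T' T) + rocc T' zs"
        by (metis of_nat_add of_nat_of_bool)
      moreover have "drop (tree_order T) (x # ys) = zs" unfolding zs by simp
      ultimately show ?thesis using True by (cases "T = T'") simp_all
    qed simp
  qed auto
  also have "\<dots> = tree_prob p T * EE (Suc m - tree_order T) ?f"
    by (rule expectation_prefix_tree(2)[OF assms(1) int])
  also have "EE (Suc m - tree_order T) ?f = ?c + EE (Suc m - tree_order T) (rocc T')"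
    using integrable_rocc by simp
  also have "EE (Suc m - tree_order T) (rocc T') = (real m + 2 - real (tree_order T) - real (tree_order T')) * tree_prob p T'"
    using assms by (subst expectation_rocc) (auto simp: of_nat_diff)
  finally show ?thesis by simp
qed

lemma expectation_prefix_prefix:
  assumes "tree_order T \<le> m"
  shows "EE m (\<lambda>xs. of_bool (prefix (degree_seq T) xs) * of_bool (prefix (degree_seq T') xs)) = of_bool (T = T') * tree_prob p T"
proof -
  have "(\<lambda>xs. of_bool (prefix (degree_seq T) xs) * of_bool (prefix (degree_seq T') xs)) = (\<lambda>xs. of_bool (T = T') * (of_bool (prefix (degree_seq T) xs) * 1 :: real))"
  proof (intro ext)
    fix xs
    have "T = T'" if "prefix (degree_seq T) xs" "prefix (degree_seq T') xs"
      using that degree_seq_prefix_free by (auto elim!: prefixE)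
    then show "of_bool (prefix (degree_seq T) xs) * of_bool (prefix (degree_seq T') xs) = of_bool (T = T') * (of_bool (prefix (degree_seq T) xs) * 1 :: real)"
      by auto
  qed
  moreover have "EE m (\<lambda>xs. of_bool (prefix (degree_seq T) xs) * 1) = tree_prob p T * EE (m - tree_order T) (\<lambda>_. 1)"
    by (rule expectation_prefix_tree(2)[OF assms]) simp
  ultimately show ?thesis by simp
qed

definition "Cv T T' m = EE m (\<lambda>xs. rocc T xs * rocc T' xs) - EE m (rocc T) * EE m (rocc T')"

text \<open>The covariance per letter without conditioning. Since
  \<open>subtree_count T T = 1\<close>, the \<open>of_bool\<close> merges the two cases of
  \<open>subtree_cov\<close>: on the diagonal two equal terms appear and one is taken away.\<close>

definition "\<gamma>0 T T' = real (subtree_count T' T) * tree_prob p T + real (subtree_count T T') * tree_prob p T' - of_bool (T = T') * tree_prob p T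
   - (real (tree_order T) + real (tree_order T') - 1) * tree_prob p T * tree_prob p T'"

lemma subtree_cov_eq: "subtree_cov p T T' = \<gamma>0 T T' - tree_prob p T * tree_prob p T' / \<sigma>2"
proof -
  have self: "subtree_count T T = 1" for T
  proof -
    have "occ (degree_seq T) (degree_seq T) = card {0 :: nat}"
      unfolding occ_def
    proof (rule arg_cong[of _ _ card], intro set_eqI iffI)
      fix i assume "i \<in> {i. i < length (degree_seq T) \<and> prefix (degree_seq T) (drop i (degree_seq T))}"
      then have "i < tree_order T" "tree_order T \<le> tree_order T - i"
        using prefix_length_le[of "degree_seq T" "drop i (degree_seq T)"] by auto
      then show "i \<in> {0}" by simp
    qed auto
    then show ?thesis by (simp add: occ_degree_seq)
  qed
  show ?thesis
    unfolding subtree_cov_def \<sigma>2_def[symmetric]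
    by (auto simp: \<gamma>0_def self power2_eq_square inverse_eq_divide algebra_simps)
qed

text \<open>Peel off the first letter; every product that involves a window at 0 has an explicit
  mean. Its part linear in \<open>m\<close> cancels against the growth of the product of the means,
  so the increment is constant.\<close>

lemma Cv_Suc:
  assumes "tree_order T + tree_order T' \<le> m"
  shows "Cv T T' (Suc m) = Cv T T' m + \<gamma>0 T T'"
proof -
  let ?e = "degree_seq T" and ?e' = "degree_seq T'"
  let ?b = "\<lambda>xs. of_bool (prefix ?e xs) :: real" and ?b' = "\<lambda>xs. of_bool (prefix ?e' xs) :: real"
  let ?P = "replicate_pmf (Suc m) p"
  have bd: "integrable ?P (\<lambda>xs. ?b xs * ?b' xs)" "integrable ?P (\<lambda>xs. ?b xs * rocc T' (tl xs))" "integrable ?P (\<lambda>xs. ?b' xs * rocc T (tl xs))"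
    "integrable ?P (\<lambda>xs. rocc T (tl xs) * rocc T' (tl xs))"
  proof -
    have bound: "\<bar>of_bool b * rocc U (tl xs)\<bar> \<le> real m" if "length xs = Suc m" for b U and xs :: "nat list"
      using occ_le_length[of "degree_seq U" "tl xs"] that by (cases b) auto
    show "integrable ?P (\<lambda>xs. ?b xs * ?b' xs)" by (rule integrable_replicate_bounded[of _ _ 1]) simp
    show "integrable ?P (\<lambda>xs. ?b xs * rocc T' (tl xs))"
      by (rule integrable_replicate_bounded) (rule bound)
    show "integrable ?P (\<lambda>xs. ?b' xs * rocc T (tl xs))"
      by (rule integrable_replicate_bounded) (rule bound)
    show "integrable ?P (\<lambda>xs. rocc T (tl xs) * rocc T' (tl xs))"
      by (rule expectation_replicate_tl(1)[OF integrable_rocc_mult])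
  qed
  have "EE (Suc m) (\<lambda>xs. rocc T xs * rocc T' xs) =
     EE (Suc m) (\<lambda>xs. ?b xs * ?b' xs + ?b xs * rocc T' (tl xs) + ?b' xs * rocc T (tl xs) + rocc T (tl xs) * rocc T' (tl xs))"
  proof (intro integral_cong_AE replicate_pmf_Suc_Cons)
    fix x :: nat and ys :: "nat list"
    show "rocc T (x # ys) * rocc T' (x # ys) = ?b (x # ys) * ?b' (x # ys) + ?b (x # ys) * rocc T' (tl (x # ys)) + ?b' (x # ys) * rocc T (tl (x # ys)) + rocc T (tl (x # ys)) * rocc T' (tl (x # ys))"
      by (simp add: occ_Cons algebra_simps del: of_bool_eq_0_iff)
  qed auto
  also have "\<dots> = EE (Suc m) (\<lambda>xs. ?b xs * ?b' xs) + EE (Suc m) (\<lambda>xs. ?b xs * rocc T' (tl xs)) + EE (Suc m) (\<lambda>xs. ?b' xs * rocc T (tl xs))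
     + EE (Suc m) (\<lambda>xs. rocc T (tl xs) * rocc T' (tl xs))"
    using bd by (simp only: Bochner_Integration.integral_add Bochner_Integration.integrable_add)
  also have "EE (Suc m) (\<lambda>xs. rocc T (tl xs) * rocc T' (tl xs)) = EE m (\<lambda>xs. rocc T xs * rocc T' xs)"
    by (rule expectation_replicate_tl(2)[OF integrable_rocc_mult])
  also have "EE (Suc m) (\<lambda>xs. ?b xs * ?b' xs) = of_bool (T = T') * tree_prob p T"
    using assms by (intro expectation_prefix_prefix) simp
  also have "EE (Suc m) (\<lambda>xs. ?b xs * rocc T' (tl xs)) = tree_prob p T * (real (subtree_count T' T) - of_bool (T = T') + (real m + 2 - real (tree_order T) - real (tree_order T')) * tree_prob p T')"
    using assms by (intro expectation_prefix_occ_tl) auto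
  also have "EE (Suc m) (\<lambda>xs. ?b' xs * rocc T (tl xs)) = tree_prob p T' * (real (subtree_count T T') - of_bool (T' = T) + (real m + 2 - real (tree_order T') - real (tree_order T)) * tree_prob p T)"
    using assms by (intro expectation_prefix_occ_tl) auto
  finally have *: "EE (Suc m) (\<lambda>xs. rocc T xs * rocc T' xs) =
     of_bool (T = T') * tree_prob p T
     + tree_prob p T * (real (subtree_count T' T) - of_bool (T = T') + (real m + 2 - real (tree_order T) - real (tree_order T')) * tree_prob p T')
     + tree_prob p T' * (real (subtree_count T T') - of_bool (T' = T) + (real m + 2 - real (tree_order T') - real (tree_order T)) * tree_prob p T)
     + EE m (\<lambda>xs. rocc T xs * rocc T' xs)" .
  have E: "EE m (rocc T) = (real m + 1 - real (tree_order T)) * tree_prob p T" "EE m (rocc T') = (real m + 1 - real (tree_order T')) * tree_prob p T'"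
    "EE (Suc m) (rocc T) = (real m + 2 - real (tree_order T)) * tree_prob p T" "EE (Suc m) (rocc T') = (real m + 2 - real (tree_order T')) * tree_prob p T'"
    using assms by (simp_all add: expectation_rocc del: replicate_pmf.simps)
  show ?thesis
    unfolding Cv_def * E \<gamma>0_def by (cases "T = T'") (simp_all add: algebra_simps)
qed

lemma Cv_linear: "tree_order T + tree_order T' \<le> m0 \<Longrightarrow> Cv T T' (m0 + j) = Cv T T' m0 + real j * \<gamma>0 T T'"
  by (induction j) (simp_all add: Cv_Suc algebra_simps)

lemma tendsto_linear_over_n:
  assumes "\<And>j. f (m0 + j) = (c :: real) + real j * g"
  shows "(\<lambda>K. f (K - 1) / real K) \<longlonglongrightarrow> g"
proof -
  have l: "(\<lambda>n. a / real n) \<longlonglongrightarrow> 0" for a :: real by (rule lim_const_over_n)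
  have "(\<lambda>n. (c - (real m0 + 1) * g) / real n + g) \<longlonglongrightarrow> 0 + g"
    by (intro tendsto_add l tendsto_const)
  moreover have "\<forall>\<^sub>F K in sequentially. (c - (real m0 + 1) * g) / real K + g = f (K - 1) / real K"
  proof (rule eventually_sequentiallyI[of "m0 + 1"])
    fix K assume K: "m0 + 1 \<le> K"
    then have "f (K - 1) = c + real (K - 1 - m0) * g" using assms[of "K - 1 - m0"] by simp
    also have "real (K - 1 - m0) = real K - 1 - real m0" using K by linarith
    finally show "(c - (real m0 + 1) * g) / real K + g = f (K - 1) / real K" using K by (simp add: field_simps)
  qed
  ultimately show ?thesis using Lim_transform_eventually by fastforce
qed

section \<open>Covariance of the counts with the walk\<close>

definition "Cw T m = EE m (\<lambda>xs. rocc T xs * walk xs)"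

lemma walk_degree_seq: "walk (degree_seq T) = - 1 / real period"
proof -
  have "real (sum_list (degree_seq T)) - real (tree_order T) = - 1"
    using sum_degree_seq[of T] by linarith
  then show ?thesis by (simp add: walk_eq)
qed

text \<open>Given an occurrence at the front, the codeword contributes
  \<open>- 1 / real period\<close> to the walk and the rest is centred and independent. The first
  step is in turn independent of the later occurrences.\<close>

lemma Cw_Suc:
  assumes "tree_order T \<le> m"
  shows "Cw T (Suc m) = Cw T m - tree_prob p T / real period"
proof -
  let ?e = "degree_seq T" and ?P = "replicate_pmf (Suc m) p"
  let ?b = "\<lambda>xs. of_bool (prefix ?e xs) :: real"
  let ?f = "\<lambda>ys. - 1 / real period + walk ys"
  have i1: "integrable ?P (\<lambda>xs. ?b xs * ?f (drop (tree_order T) xs))"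
    using assms integrable_walk by (intro expectation_prefix_tree(1)) auto
  have i2: "integrable ?P (\<lambda>xs. step (hd xs) * rocc T (tl xs))"
    by (rule expectation_replicate_Suc(1)[OF integrable_step(1) integrable_rocc])
  have i3: "integrable ?P (\<lambda>xs. rocc T (tl xs) * walk (tl xs))"
    by (rule expectation_replicate_tl(1)[OF integrable_rocc_walk])
  have "Cw T (Suc m) = EE (Suc m) (\<lambda>xs. ?b xs * ?f (drop (tree_order T) xs) + step (hd xs) * rocc T (tl xs) + rocc T (tl xs) * walk (tl xs))"
    unfolding Cw_def
  proof (intro integral_cong_AE replicate_pmf_Suc_Cons)
    fix x :: nat and ys :: "nat list"
    have "?b (x # ys) * walk (x # ys) = ?b (x # ys) * ?f (drop (tree_order T) (x # ys))"
    proof (cases "prefix ?e (x # ys)")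
      case True
      then obtain zs where zs: "x # ys = ?e @ zs" by (auto elim: prefixE)
      show ?thesis unfolding zs by (simp add: walk_degree_seq)
    qed simp
    then show "rocc T (x # ys) * walk (x # ys) = ?b (x # ys) * ?f (drop (tree_order T) (x # ys)) + step (hd (x # ys)) * rocc T (tl (x # ys)) + rocc T (tl (x # ys)) * walk (tl (x # ys))"
      by (simp add: occ_Cons algebra_simps del: of_bool_eq_0_iff)
  qed auto
  also have "\<dots> = EE (Suc m) (\<lambda>xs. ?b xs * ?f (drop (tree_order T) xs)) + EE (Suc m) (\<lambda>xs. step (hd xs) * rocc T (tl xs)) + EE (Suc m) (\<lambda>xs. rocc T (tl xs) * walk (tl xs))"
    using i1 i2 i3 by (simp only: Bochner_Integration.integral_add Bochner_Integration.integrable_add)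
  also have "EE (Suc m) (\<lambda>xs. ?b xs * ?f (drop (tree_order T) xs)) = tree_prob p T * EE (Suc m - tree_order T) ?f"
    using assms integrable_walk by (intro expectation_prefix_tree(2)) auto
  also have "EE (Suc m - tree_order T) ?f = - 1 / real period"
    using integrable_walk by (simp add: expectation_walk)
  also have "EE (Suc m) (\<lambda>xs. step (hd xs) * rocc T (tl xs)) = 0"
    by (simp only: expectation_replicate_Suc(2)[OF integrable_step(1) integrable_rocc] expectation_step)
  also have "EE (Suc m) (\<lambda>xs. rocc T (tl xs) * walk (tl xs)) = Cw T m"
    unfolding Cw_def by (rule expectation_replicate_tl(2)[OF integrable_rocc_walk])
  finally show ?thesis by simp
qed

lemma Cw_linear: "tree_order T \<le> m0 \<Longrightarrow> Cw T (m0 + j) = Cw T m0 + real j * (- tree_prob p T / real period)"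
  by (induction j) (simp_all add: Cw_Suc algebra_simps add_divide_distrib)

lemma Cv_tendsto: "(\<lambda>K. Cv T T' (K - 1) / real K) \<longlonglongrightarrow> \<gamma>0 T T'"
  using Cv_linear[of T T' "tree_order T + tree_order T'"] by (intro tendsto_linear_over_n) simp

lemma Cw_tendsto: "(\<lambda>K. Cw T (K - 1) / real K) \<longlonglongrightarrow> - tree_prob p T / real period"
  using Cw_linear[of T "tree_order T"] by (intro tendsto_linear_over_n) simp

end

section \<open>Convergence of linear combinations\<close>

lemma norm_iexp_diff_le: "norm (iexp x - iexp y) \<le> \<bar>x - y\<bar>"
proof -
  have "iexp x - iexp y = iexp y * (iexp (x - y) - 1)"
    by (simp add: exp_add[symmetric] algebra_simps)
  then have "norm (iexp x - iexp y) = norm (iexp (x - y) - 1)" by (simp add: norm_mult)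
  also have "\<dots> \<le> \<bar>x - y\<bar>" using iexp_approx1[of "x - y" 0] by simp
  finally show ?thesis .
qed

lemma cos_taylor: "\<bar>cos y - 1 + y\<^sup>2 / 2\<bar> \<le> y ^ 4 / (24 :: real)"
proof -
  have "\<bar>Re (iexp y - (\<Sum>k\<le>3. (\<i> * y) ^ k / fact k))\<bar> \<le> \<bar>y\<bar> ^ Suc 3 / fact (Suc 3)"
    by (rule order_trans[OF abs_Re_le_cmod iexp_approx1])
  moreover have "Re (iexp y - (\<Sum>k\<le>3. (\<i> * y) ^ k / fact k)) = cos y - 1 + y\<^sup>2 / 2"
    by (simp add: eval_nat_numeral Re_exp)
  moreover have "fact (Suc 3) = (24 :: real)" by (simp add: eval_nat_numeral)
  moreover have "\<bar>y\<bar> ^ Suc 3 = y ^ 4" by simp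
  ultimately show ?thesis by (simp only:)
qed

lemma sin_taylor: "\<bar>sin y - y\<bar> \<le> y\<^sup>2 / (2 :: real)"
proof -
  have "\<bar>Im (iexp y - (\<Sum>k\<le>1. (\<i> * y) ^ k / fact k))\<bar> \<le> \<bar>y\<bar> ^ Suc 1 / fact (Suc 1)"
    by (rule order_trans[OF abs_Im_le_cmod iexp_approx1])
  then show ?thesis by (simp add: eval_nat_numeral Im_exp)
qed

lemma exp_minus_taylor: "0 \<le> x \<Longrightarrow> \<bar>1 - exp (- x) - x\<bar> \<le> (x :: real)\<^sup>2"
proof -
  assume "x \<ge> 0"
  have "1 - x \<le> exp (- x)" using exp_ge_add_one_self[of "- x"] by simp
  moreover have "exp (- x) \<le> 1 - x + x\<^sup>2"
  proof -
    have "(1 + x) * exp (- x) \<le> exp x * exp (- x)" using exp_ge_add_one_self[of x] by (intro mult_right_mono) auto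
    then have "(1 + x) * exp (- x) \<le> 1" by (simp add: exp_minus)
    moreover have "1 \<le> (1 + x) * (1 - x + x\<^sup>2)" using \<open>x \<ge> 0\<close> by (simp add: algebra_simps power2_eq_square)
    ultimately have "(1 + x) * exp (- x) \<le> (1 + x) * (1 - x + x\<^sup>2)" by linarith
    then show ?thesis using \<open>x \<ge> 0\<close> by simp
  qed
  ultimately show ?thesis by simp
qed

text \<open>A fourth moment bound upgrades convergence of characteristic functions to convergence of the
  first two moments, by Taylor expansion of the characteristic function at \<open>0\<close>.\<close>

lemma moments_tendsto_of_charfun:
  fixes Q :: "nat \<Rightarrow> 'a pmf" and X :: "nat \<Rightarrow> 'a \<Rightarrow> real"
  assumes fin: "\<forall>\<^sub>F n in F. finite (set_pmf (Q n))"
    and m4: "\<forall>\<^sub>F n in F. measure_pmf.expectation (Q n) (\<lambda>x. (X n x) ^ 4) \<le> C"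
    and cf: "\<And>s. ((\<lambda>n. measure_pmf.expectation (Q n) (\<lambda>x. iexp (s * X n x))) \<longlongrightarrow> of_real (exp (- s\<^sup>2 * v / 2))) F"
    and v: "v \<ge> 0" and C: "C \<ge> 0"
  shows "((\<lambda>n. measure_pmf.expectation (Q n) (X n)) \<longlongrightarrow> 0) F"
    and "((\<lambda>n. measure_pmf.expectation (Q n) (\<lambda>x. (X n x)\<^sup>2)) \<longlongrightarrow> v) F"
proof -
  have E_cos: "((\<lambda>n. measure_pmf.expectation (Q n) (\<lambda>x. cos (s * X n x))) \<longlongrightarrow> exp (- s\<^sup>2 * v / 2)) F" for s
  proof -
    have "Re (measure_pmf.expectation (Q n) (\<lambda>x. iexp (s * X n x))) = measure_pmf.expectation (Q n) (\<lambda>x. cos (s * X n x))" for n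
      by (subst integral_Re[symmetric]) (simp_all add: Re_exp del: of_real_mult)
    then show ?thesis using tendsto_Re[OF cf[of s]] by simp
  qed
  have E_sin: "((\<lambda>n. measure_pmf.expectation (Q n) (\<lambda>x. sin (s * X n x))) \<longlongrightarrow> 0) F" for s
  proof -
    have "Im (measure_pmf.expectation (Q n) (\<lambda>x. iexp (s * X n x))) = measure_pmf.expectation (Q n) (\<lambda>x. sin (s * X n x))" for n
      by (subst integral_Im[symmetric]) (simp_all add: Im_exp del: of_real_mult)
    then show ?thesis using tendsto_Im[OF cf[of s]] by simp
  qed
  \<comment> \<open>For fixed \<open>s\<close> the second moment is read off from the cosine, with
    an error of order \<open>C\<close> times the square of \<open>s\<close>, uniformly in
    \<open>n\<close>. The limit in \<open>n\<close> comes first; \<open>s\<close> is made small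
    afterwards.\<close>
  have second: "\<forall>\<^sub>F n in F. \<bar>measure_pmf.expectation (Q n) (\<lambda>x. (X n x)\<^sup>2) - 2 * (1 - measure_pmf.expectation (Q n) (\<lambda>x. cos (s * X n x))) / s\<^sup>2\<bar> \<le> s\<^sup>2 * C / 12"
    if s: "s > 0" for s
    using fin m4
  proof eventually_elim
    case (elim n)
    have i: "integrable (Q n) f" for f :: "'a \<Rightarrow> real" by (rule integrable_measure_pmf_finite[OF elim(1)])
    let ?E = "measure_pmf.expectation (Q n)"
    have "?E (\<lambda>x. cos (s * X n x) - 1 + s\<^sup>2 / 2 * (X n x)\<^sup>2) = ?E (\<lambda>x. cos (s * X n x)) - 1 + s\<^sup>2 / 2 * ?E (\<lambda>x. (X n x)\<^sup>2)"
      by (simp only: Bochner_Integration.integral_add[OF i i] Bochner_Integration.integral_diff[OF i i] integral_mult_right_zero) simp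
    moreover have "\<bar>?E (\<lambda>x. cos (s * X n x) - 1 + s\<^sup>2 / 2 * (X n x)\<^sup>2)\<bar> \<le> ?E (\<lambda>x. s ^ 4 / 24 * (X n x) ^ 4)"
    proof (rule order_trans[OF integral_abs_bound integral_mono[OF i i]])
      fix x show "\<bar>cos (s * X n x) - 1 + s\<^sup>2 / 2 * (X n x)\<^sup>2\<bar> \<le> s ^ 4 / 24 * (X n x) ^ 4"
        using cos_taylor[of "s * X n x"] by (simp add: power_mult_distrib)
    qed
    moreover have "?E (\<lambda>x. s ^ 4 / 24 * (X n x) ^ 4) \<le> s ^ 4 / 24 * C"
      using mult_left_mono[OF elim(2), of "s ^ 4 / 24"] by simp
    ultimately have *: "\<bar>?E (\<lambda>x. cos (s * X n x)) - 1 + s\<^sup>2 / 2 * ?E (\<lambda>x. (X n x)\<^sup>2)\<bar> \<le> s ^ 4 / 24 * C" by simp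
    have "?E (\<lambda>x. (X n x)\<^sup>2) - 2 * (1 - ?E (\<lambda>x. cos (s * X n x))) / s\<^sup>2 = (2 / s\<^sup>2) * (?E (\<lambda>x. cos (s * X n x)) - 1 + s\<^sup>2 / 2 * ?E (\<lambda>x. (X n x)\<^sup>2))"
      using s by (simp add: field_simps)
    then have "\<bar>?E (\<lambda>x. (X n x)\<^sup>2) - 2 * (1 - ?E (\<lambda>x. cos (s * X n x))) / s\<^sup>2\<bar> = (2 / s\<^sup>2) * \<bar>?E (\<lambda>x. cos (s * X n x)) - 1 + s\<^sup>2 / 2 * ?E (\<lambda>x. (X n x)\<^sup>2)\<bar>"
      by (simp only: abs_mult) simp
    also have "\<dots> \<le> (2 / s\<^sup>2) * (s ^ 4 / 24 * C)" by (intro mult_left_mono *) simp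
    also have "\<dots> = s\<^sup>2 * C / 12" using s by (simp add: field_simps power2_eq_square eval_nat_numeral)
    finally show ?case .
  qed
  show "((\<lambda>n. measure_pmf.expectation (Q n) (\<lambda>x. (X n x)\<^sup>2)) \<longlongrightarrow> v) F"
  proof (rule tendstoI)
    fix \<epsilon> :: real assume \<epsilon>: "\<epsilon> > 0"
    \<comment> \<open>\<open>C / 12\<close> is the error of \<open>second\<close>, the term with
      \<open>v\<close> that of the limiting exponential, and the 1 keeps \<open>D\<close> positive.
      Together they amount to at most half of \<open>\<epsilon>\<close>.\<close>
    define D where "D = C / 12 + v\<^sup>2 / 2 + 1"
    have D: "D > 0" using C by (simp add: D_def add_nonneg_pos)
    define s where "s = sqrt (\<epsilon> / (2 * D))"
    have s: "s > 0" "s\<^sup>2 * D = \<epsilon> / 2" using \<epsilon> D by (simp_all add: s_def)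
    have "\<bar>1 - exp (- (s\<^sup>2 * v / 2)) - s\<^sup>2 * v / 2\<bar> \<le> (s\<^sup>2 * v / 2)\<^sup>2"
      using v by (intro exp_minus_taylor) simp
    then have "2 / s\<^sup>2 * \<bar>1 - exp (- (s\<^sup>2 * v / 2)) - s\<^sup>2 * v / 2\<bar> \<le> 2 / s\<^sup>2 * (s\<^sup>2 * v / 2)\<^sup>2"
      by (intro mult_left_mono) auto
    also have "2 / s\<^sup>2 * (s\<^sup>2 * v / 2)\<^sup>2 = s\<^sup>2 * v\<^sup>2 / 2" using s by (simp add: power2_eq_square field_simps)
    also have "2 / s\<^sup>2 * \<bar>1 - exp (- (s\<^sup>2 * v / 2)) - s\<^sup>2 * v / 2\<bar> = \<bar>2 / s\<^sup>2 * (1 - exp (- (s\<^sup>2 * v / 2)) - s\<^sup>2 * v / 2)\<bar>"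
      by (simp only: abs_mult) simp
    also have "2 / s\<^sup>2 * (1 - exp (- (s\<^sup>2 * v / 2)) - s\<^sup>2 * v / 2) = 2 * (1 - exp (- s\<^sup>2 * v / 2)) / s\<^sup>2 - v"
      using s by (simp add: field_simps)
    finally have lim: "\<bar>2 * (1 - exp (- s\<^sup>2 * v / 2)) / s\<^sup>2 - v\<bar> \<le> s\<^sup>2 * v\<^sup>2 / 2" .
    have "((\<lambda>n. 2 * (1 - measure_pmf.expectation (Q n) (\<lambda>x. cos (s * X n x))) / s\<^sup>2) \<longlongrightarrow> 2 * (1 - exp (- s\<^sup>2 * v / 2)) / s\<^sup>2) F"
      by (intro tendsto_divide tendsto_mult tendsto_diff tendsto_const E_cos) (use s in simp)
    then have "\<forall>\<^sub>F n in F. dist (2 * (1 - measure_pmf.expectation (Q n) (\<lambda>x. cos (s * X n x))) / s\<^sup>2) (2 * (1 - exp (- s\<^sup>2 * v / 2)) / s\<^sup>2) < \<epsilon> / 2"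
      using \<epsilon> by (intro tendstoD) auto
    then show "\<forall>\<^sub>F n in F. dist (measure_pmf.expectation (Q n) (\<lambda>x. (X n x)\<^sup>2)) v < \<epsilon>"
      using second[OF s(1)]
    proof eventually_elim
      case (elim n)
      have "s\<^sup>2 * C / 12 + s\<^sup>2 * v\<^sup>2 / 2 \<le> s\<^sup>2 * D" by (simp add: D_def algebra_simps)
      then show ?case using elim lim s(2) unfolding dist_real_def by linarith
    qed
  qed
  \<comment> \<open>The same argument with the sine; its quadratic error is controlled by the fourth
    moment because a square is at most 1 plus the fourth power.\<close>
  have first: "\<forall>\<^sub>F n in F. \<bar>measure_pmf.expectation (Q n) (X n) - measure_pmf.expectation (Q n) (\<lambda>x. sin (s * X n x)) / s\<bar> \<le> s * (1 + C) / 2"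
    if s: "s > 0" for s
    using fin m4
  proof eventually_elim
    case (elim n)
    have i: "integrable (Q n) f" for f :: "'a \<Rightarrow> real" by (rule integrable_measure_pmf_finite[OF elim(1)])
    let ?E = "measure_pmf.expectation (Q n)"
    have "?E (\<lambda>x. sin (s * X n x) - s * X n x) = ?E (\<lambda>x. sin (s * X n x)) - s * ?E (X n)"
      by (simp only: Bochner_Integration.integral_diff[OF i i] integral_mult_right_zero)
    moreover have "\<bar>?E (\<lambda>x. sin (s * X n x) - s * X n x)\<bar> \<le> ?E (\<lambda>x. s\<^sup>2 / 2 * (1 + (X n x) ^ 4))"
    proof (rule order_trans[OF integral_abs_bound integral_mono[OF i i]])
      fix x
      have "(X n x)\<^sup>2 \<le> 1 + (X n x) ^ 4"
      proof -
        have "2 * (X n x)\<^sup>2 \<le> (X n x) ^ 4 + 1"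
          using zero_le_power2[of "(X n x)\<^sup>2 - 1"] unfolding power2_diff by (simp flip: power_mult)
        moreover have "0 \<le> (X n x) ^ 4" "0 \<le> (X n x)\<^sup>2" by simp_all
        ultimately show ?thesis by linarith
      qed
      then have "s\<^sup>2 / 2 * (X n x)\<^sup>2 \<le> s\<^sup>2 / 2 * (1 + (X n x) ^ 4)" by (intro mult_left_mono) auto
      then show "\<bar>sin (s * X n x) - s * X n x\<bar> \<le> s\<^sup>2 / 2 * (1 + (X n x) ^ 4)"
        using sin_taylor[of "s * X n x"] by (simp add: power_mult_distrib)
    qed
    moreover have "?E (\<lambda>x. s\<^sup>2 / 2 * (1 + (X n x) ^ 4)) = s\<^sup>2 / 2 * (1 + ?E (\<lambda>x. (X n x) ^ 4))"
      by (simp only: integral_mult_right_zero Bochner_Integration.integral_add[OF i i]) simp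
    moreover have "s\<^sup>2 / 2 * (1 + ?E (\<lambda>x. (X n x) ^ 4)) \<le> s\<^sup>2 / 2 * (1 + C)"
      using elim(2) by (intro mult_left_mono) auto
    ultimately have *: "\<bar>?E (\<lambda>x. sin (s * X n x)) - s * ?E (X n)\<bar> \<le> s\<^sup>2 / 2 * (1 + C)" by linarith
    have "?E (X n) - ?E (\<lambda>x. sin (s * X n x)) / s = - (?E (\<lambda>x. sin (s * X n x)) - s * ?E (X n)) / s"
      using s by (simp add: field_simps)
    then have "\<bar>?E (X n) - ?E (\<lambda>x. sin (s * X n x)) / s\<bar> = \<bar>?E (\<lambda>x. sin (s * X n x)) - s * ?E (X n)\<bar> / s"
      using s by (simp add: abs_divide)
    also have "\<dots> \<le> (s\<^sup>2 / 2 * (1 + C)) / s" using s by (intro divide_right_mono *) simp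
    also have "\<dots> = s * (1 + C) / 2" using s by (simp add: power2_eq_square)
    finally show ?case .
  qed
  show "((\<lambda>n. measure_pmf.expectation (Q n) (X n)) \<longlongrightarrow> 0) F"
  proof (rule tendstoI)
    fix \<epsilon> :: real assume \<epsilon>: "\<epsilon> > 0"
    define s where "s = \<epsilon> / (1 + C)"
    have s: "s > 0" "s * (1 + C) / 2 = \<epsilon> / 2" using \<epsilon> C by (simp_all add: s_def)
    have "((\<lambda>n. measure_pmf.expectation (Q n) (\<lambda>x. sin (s * X n x)) / s) \<longlongrightarrow> 0 / s) F"
      by (intro tendsto_divide tendsto_const E_sin) (use s in simp)
    then have "((\<lambda>n. measure_pmf.expectation (Q n) (\<lambda>x. sin (s * X n x)) / s) \<longlongrightarrow> 0) F" by simp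
    then have "\<forall>\<^sub>F n in F. dist (measure_pmf.expectation (Q n) (\<lambda>x. sin (s * X n x)) / s) 0 < \<epsilon> / 2"
      using \<epsilon> by (intro tendstoD) auto
    then show "\<forall>\<^sub>F n in F. dist (measure_pmf.expectation (Q n) (X n)) 0 < \<epsilon>"
      using first[OF s(1)]
    proof eventually_elim
      case (elim n)
      then show ?case using s(2) unfolding dist_real_def by linarith
    qed
  qed
qed

text \<open>One fixed linear combination of counts: in the manner of Cramer and Wold, joint
  convergence and all mixed moments are recovered from such combinations.\<close>

locale tree_statistic = critical_offspring +
  fixes S :: "plane_tree set" and a :: "plane_tree \<Rightarrow> real"
  assumes finite_S: "finite S"
begin

definition "W xs = (\<Sum>T\<in>S. a T * dev T xs)"

text \<open>A block reads \<open>K - 1\<close> letters, which offer \<open>K - tree_order T\<close>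
  starts; the subtraction is thus the i.i.d. mean, and the functional is centred as
  \<open>block_functional\<close> demands.\<close>

definition "Bf K xs = (\<Sum>T\<in>S. a T * (rocc T xs - (real K - real (tree_order T)) * tree_prob p T))"

definition "k0 = (\<Sum>T\<in>S. tree_order T) + 1"

lemma tree_order_less: "T \<in> S \<Longrightarrow> k0 \<le> K \<Longrightarrow> tree_order T < K"
  using member_le_sum[of T S tree_order] finite_S by (auto simp: k0_def)

lemma integrable_centered: "integrable (replicate_pmf m p) (\<lambda>xs. rocc T xs - c)"
  "integrable (replicate_pmf m p) (\<lambda>xs. (rocc T xs - c) * (rocc T' xs - c'))"
  "integrable (replicate_pmf m p) (\<lambda>xs. (rocc T xs - c) * walk xs)"
  using integrable_rocc[of m] integrable_rocc_mult[of m] integrable_rocc_walk[of m] integrable_walk[of m]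
  by (simp_all add: left_diff_distrib right_diff_distrib)

lemma Bf_square: "(Bf K xs)\<^sup>2 = (\<Sum>T\<in>S. \<Sum>T'\<in>S. a T * a T' * ((rocc T xs - (real K - real (tree_order T)) * tree_prob p T) * (rocc T' xs - (real K - real (tree_order T')) * tree_prob p T')))"
  unfolding Bf_def power2_eq_square sum_product by (intro sum.cong refl) (simp add: algebra_simps)

lemma Bf_moments:
  assumes K: "K \<ge> k0"
  shows "integrable (replicate_pmf (K - 1) p) (Bf K)" "EE (K - 1) (Bf K) = 0"
    "integrable (replicate_pmf (K - 1) p) (\<lambda>xs. (Bf K xs)\<^sup>2)"
    "EE (K - 1) (\<lambda>xs. (Bf K xs)\<^sup>2) = (\<Sum>T\<in>S. \<Sum>T'\<in>S. a T * a T' * Cv T T' (K - 1))"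
    "integrable (replicate_pmf (K - 1) p) (\<lambda>xs. Bf K xs * walk xs)"
    "EE (K - 1) (\<lambda>xs. Bf K xs * walk xs) = (\<Sum>T\<in>S. a T * Cw T (K - 1))"
proof -
  let ?c = "\<lambda>T. (real K - real (tree_order T)) * tree_prob p T"
  have K1: "K \<ge> 1" using K by (simp add: k0_def)
  have mean: "EE (K - 1) (rocc T) = ?c T" if "T \<in> S" for T
    using tree_order_less[OF that K] K1 by (subst expectation_rocc) (auto simp: of_nat_diff)
  show "integrable (replicate_pmf (K - 1) p) (Bf K)"
    unfolding Bf_def[abs_def] by (intro Bochner_Integration.integrable_sum integrable_mult_right integrable_centered)
  have "EE (K - 1) (Bf K) = (\<Sum>T\<in>S. a T * EE (K - 1) (\<lambda>xs. rocc T xs - ?c T))"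
    unfolding Bf_def[abs_def] using integrable_centered(1) by simp
  also have "\<dots> = 0"
    using mean integrable_rocc by (intro sum.neutral) simp
  finally show "EE (K - 1) (Bf K) = 0" .
  show "integrable (replicate_pmf (K - 1) p) (\<lambda>xs. (Bf K xs)\<^sup>2)"
    unfolding Bf_square by (intro Bochner_Integration.integrable_sum integrable_mult_right integrable_centered)
  have Cv: "EE (K - 1) (\<lambda>xs. (rocc T xs - ?c T) * (rocc T' xs - ?c T')) = Cv T T' (K - 1)" if "T \<in> S" "T' \<in> S" for T T'
  proof -
    have eq: "(rocc T xs - ?c T) * (rocc T' xs - ?c T') = rocc T xs * rocc T' xs - ?c T' * rocc T xs - ?c T * rocc T' xs + ?c T * ?c T'" for xs
      by (simp add: algebra_simps)
    have "EE (K - 1) (\<lambda>xs. (rocc T xs - ?c T) * (rocc T' xs - ?c T')) = EE (K - 1) (\<lambda>xs. rocc T xs * rocc T' xs) - ?c T' * EE (K - 1) (rocc T) - ?c T * EE (K - 1) (rocc T') + ?c T * ?c T'"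
      unfolding eq using integrable_rocc integrable_rocc_mult by simp
    then show ?thesis unfolding Cv_def mean[OF that(1)] mean[OF that(2)] by simp
  qed
  have "EE (K - 1) (\<lambda>xs. (Bf K xs)\<^sup>2) = (\<Sum>T\<in>S. \<Sum>T'\<in>S. a T * a T' * EE (K - 1) (\<lambda>xs. (rocc T xs - ?c T) * (rocc T' xs - ?c T')))"
    unfolding Bf_square
    by (subst Bochner_Integration.integral_sum, intro Bochner_Integration.integrable_sum integrable_mult_right integrable_centered,
        rule sum.cong[OF refl], subst Bochner_Integration.integral_sum, intro integrable_mult_right integrable_centered,
        rule sum.cong[OF refl], rule integral_mult_right_zero)
  also have "\<dots> = (\<Sum>T\<in>S. \<Sum>T'\<in>S. a T * a T' * Cv T T' (K - 1))"
    by (intro sum.cong refl) (simp only: Cv)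
  finally show "EE (K - 1) (\<lambda>xs. (Bf K xs)\<^sup>2) = (\<Sum>T\<in>S. \<Sum>T'\<in>S. a T * a T' * Cv T T' (K - 1))" .
  have Bw: "Bf K xs * walk xs = (\<Sum>T\<in>S. a T * ((rocc T xs - ?c T) * walk xs))" for xs
    unfolding Bf_def by (simp add: sum_distrib_right mult.assoc)
  show "integrable (replicate_pmf (K - 1) p) (\<lambda>xs. Bf K xs * walk xs)"
    unfolding Bw by (intro Bochner_Integration.integrable_sum integrable_mult_right integrable_centered)
  have Cw: "EE (K - 1) (\<lambda>xs. (rocc T xs - ?c T) * walk xs) = Cw T (K - 1)" for T
    unfolding left_diff_distrib Cw_def
    by (subst Bochner_Integration.integral_diff) (simp_all add: integrable_rocc_walk integrable_walk expectation_walk)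
  show "EE (K - 1) (\<lambda>xs. Bf K xs * walk xs) = (\<Sum>T\<in>S. a T * Cw T (K - 1))"
    unfolding Bw
    by (subst Bochner_Integration.integral_sum, intro integrable_mult_right integrable_centered)
      (simp only: integral_mult_right_zero Cw)
qed

definition "vK K = (\<Sum>T\<in>S. \<Sum>T'\<in>S. a T * a T' * Cv T T' (K - 1)) / K - ((\<Sum>T\<in>S. a T * Cw T (K - 1)) / K)\<^sup>2 / \<tau>"

definition "v = (\<Sum>T\<in>S. \<Sum>T'\<in>S. a T * a T' * subtree_cov p T T')"

text \<open>The covariance with the walk tends to minus the combination of tree probabilities over
  the span, and \<open>\<tau>\<close> is \<open>\<sigma>2\<close> over the squared span. In the
  quotient the span drops out and the \<open>\<sigma>2\<close> term of \<open>subtree_cov\<close>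
  remains.\<close>

lemma vK_tendsto: "vK \<longlonglongrightarrow> v"
proof -
  have "(\<lambda>K. (\<Sum>T\<in>S. \<Sum>T'\<in>S. a T * a T' * (Cv T T' (K - 1) / K)) - (\<Sum>T\<in>S. a T * (Cw T (K - 1) / K))\<^sup>2 / \<tau>)
     \<longlonglongrightarrow> (\<Sum>T\<in>S. \<Sum>T'\<in>S. a T * a T' * \<gamma>0 T T') - (\<Sum>T\<in>S. a T * (- tree_prob p T / real period))\<^sup>2 / \<tau>"
    using \<tau>_pos by (intro tendsto_diff tendsto_sum tendsto_mult tendsto_const Cv_tendsto tendsto_divide tendsto_power Cw_tendsto) auto
  moreover have "(\<lambda>K. (\<Sum>T\<in>S. \<Sum>T'\<in>S. a T * a T' * (Cv T T' (K - 1) / K)) - (\<Sum>T\<in>S. a T * (Cw T (K - 1) / K))\<^sup>2 / \<tau>) = vK"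
    by (intro ext) (simp add: vK_def sum_divide_distrib)
  moreover have "(\<Sum>T\<in>S. a T * (- tree_prob p T / real period))\<^sup>2 / \<tau> = (\<Sum>T\<in>S. \<Sum>T'\<in>S. a T * a T' * (tree_prob p T * tree_prob p T' / \<sigma>2))"
  proof -
    have "(\<Sum>T\<in>S. a T * (- tree_prob p T / real period)) = - (\<Sum>T\<in>S. a T * tree_prob p T) / real period"
      by (simp add: sum_divide_distrib sum_negf)
    then have "(\<Sum>T\<in>S. a T * (- tree_prob p T / real period))\<^sup>2 / \<tau> = (\<Sum>T\<in>S. a T * tree_prob p T)\<^sup>2 / \<sigma>2"
      using period_pos by (simp add: \<tau>_def power_divide)
    also have "\<dots> = (\<Sum>T\<in>S. \<Sum>T'\<in>S. a T * a T' * (tree_prob p T * tree_prob p T' / \<sigma>2))"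
      unfolding power2_eq_square sum_product sum_divide_distrib by (intro sum.cong refl) (simp add: algebra_simps)
    finally show ?thesis .
  qed
  moreover have "(\<Sum>T\<in>S. \<Sum>T'\<in>S. a T * a T' * \<gamma>0 T T') - (\<Sum>T\<in>S. \<Sum>T'\<in>S. a T * a T' * (tree_prob p T * tree_prob p T' / \<sigma>2)) = v"
    unfolding v_def subtree_cov_eq sum_subtractf[symmetric] right_diff_distrib ..
  ultimately show ?thesis by simp
qed

lemma block_functional_Bf:
  assumes K: "K \<ge> k0"
  shows "\<exists>M. block_functional p (Bf K) K M"
proof -
  let ?M = "\<Sum>T\<in>S. \<bar>a T\<bar> * (real K + real K)"
  have K1: "K \<ge> 1" using K by (simp add: k0_def)
  have "block_functional p (Bf K) K ?M"
  proof unfold_locales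
    show "K > 0" using K1 by simp
    fix xs :: "nat list"
    have "\<bar>Bf K (take (K - 1) xs)\<bar> \<le> (\<Sum>T\<in>S. \<bar>a T * (rocc T (take (K - 1) xs) - (real K - real (tree_order T)) * tree_prob p T)\<bar>)"
      unfolding Bf_def by (rule sum_abs)
    also have "\<dots> \<le> ?M"
    proof (intro sum_mono)
      fix T assume T: "T \<in> S"
      have "occ (degree_seq T) (take (K - 1) xs) \<le> length (take (K - 1) xs)" by (rule occ_le_length)
      then have "occ (degree_seq T) (take (K - 1) xs) \<le> K" by (rule order_trans) simp
      then have "rocc T (take (K - 1) xs) \<le> real K" by simp
      moreover have "0 \<le> (real K - real (tree_order T)) * tree_prob p T"
        using tree_order_less[OF T K] tree_prob_bounds by simp
      moreover have "(real K - real (tree_order T)) * tree_prob p T \<le> real K * 1"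
        using tree_prob_bounds by (intro mult_mono) auto
      ultimately show "\<bar>a T * (rocc T (take (K - 1) xs) - (real K - real (tree_order T)) * tree_prob p T)\<bar> \<le> \<bar>a T\<bar> * (real K + real K)"
        unfolding abs_mult by (intro mult_left_mono) auto
    qed
    finally show "\<bar>Bf K (take (K - 1) xs)\<bar> \<le> ?M" .
  next
    have "EE (K - 1) (\<lambda>xs. Bf K (take (K - 1) xs)) = EE (K - 1) (Bf K)"
      by (intro integral_cong_AE) (auto simp: AE_measure_pmf_iff set_replicate_pmf)
    then show "EE (K - 1) (\<lambda>xs. Bf K (take (K - 1) xs)) = 0" by (simp only: Bf_moments(2)[OF K])
  qed
  then show ?thesis ..
qed

lemma limit_var_eq_vK:
  assumes K: "K \<ge> k0" and bf: "block_functional p (Bf K) K M"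
  shows "block_functional.limit_var p (Bf K) K = vK K" "vK K \<ge> 0"
proof -
  interpret bf: block_functional p "Bf K" K M by fact
  have K1: "(K - 1) + 1 = K" using K by (simp add: k0_def)
  note m = Bf_moments[OF K]
  have i1: "integrable (replicate_pmf 1 p) (\<lambda>_. 1 :: real)" by simp
  have cut: "Bf K (take (K - 1) (take (K - 1) xs)) = Bf K (take (K - 1) xs)" for xs by simp
  have "EE ((K - 1) + 1) (\<lambda>xs. (Bf K (take (K - 1) xs))\<^sup>2 * 1) = EE (K - 1) (\<lambda>xs. (Bf K xs)\<^sup>2) * EE 1 (\<lambda>_. 1)"
    by (rule expectation_replicate_split(2)[OF m(3) i1])
  then have \<beta>: "bf.\<beta> = (\<Sum>T\<in>S. \<Sum>T'\<in>S. a T * a T' * Cv T T' (K - 1)) / K"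
    unfolding K1 bf.\<beta>_def m(4) by simp
  \<comment> \<open>The free last letter contributes nothing to the covariance with the walk, being
    independent of a centred functional.\<close>
  have "EE ((K - 1) + 1) (\<lambda>xs. (Bf K (take (K - 1) xs) * walk (take (K - 1) xs)) * 1 + Bf K (take (K - 1) xs) * walk (drop (K - 1) xs))
     = EE ((K - 1) + 1) (\<lambda>xs. (Bf K (take (K - 1) xs) * walk (take (K - 1) xs)) * 1) + EE ((K - 1) + 1) (\<lambda>xs. Bf K (take (K - 1) xs) * walk (drop (K - 1) xs))"
    by (intro Bochner_Integration.integral_add expectation_replicate_split(1)[OF m(5) i1] expectation_replicate_split(1)[OF m(1) integrable_walk(1)])
  also have "\<dots> = EE (K - 1) (\<lambda>xs. Bf K xs * walk xs) * EE 1 (\<lambda>_. 1) + EE (K - 1) (Bf K) * EE 1 walk"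
    by (simp only: expectation_replicate_split(2)[OF m(5) i1] expectation_replicate_split(2)[OF m(1) integrable_walk(1)])
  also have "\<dots> = (\<Sum>T\<in>S. a T * Cw T (K - 1))" unfolding m(2) m(6) by simp
  also have "(\<lambda>xs. (Bf K (take (K - 1) xs) * walk (take (K - 1) xs)) * 1 + Bf K (take (K - 1) xs) * walk (drop (K - 1) xs)) = (\<lambda>xs. Bf K (take (K - 1) xs) * walk xs)"
  proof
    fix xs
    have "walk xs = walk (take (K - 1) xs) + walk (drop (K - 1) xs)" by (metis append_take_drop_id walk_append)
    then show "(Bf K (take (K - 1) xs) * walk (take (K - 1) xs)) * 1 + Bf K (take (K - 1) xs) * walk (drop (K - 1) xs) = Bf K (take (K - 1) xs) * walk xs"
      by (simp add: distrib_left)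
  qed
  finally have \<kappa>: "bf.\<kappa> = (\<Sum>T\<in>S. a T * Cw T (K - 1)) / K"
    unfolding K1 bf.\<kappa>_def by simp
  show eq: "bf.limit_var = vK K" unfolding bf.limit_var_def \<beta> \<kappa> vK_def ..
  \<comment> \<open>The coefficient \<open>- bf.\<kappa> / \<tau>\<close> minimises the quadratic
    form; its minimum, the second moment of the regression residual, is \<open>K\<close> times the
    limit variance.\<close>
  have "0 \<le> EE K (\<lambda>xs. (1 * bf.Bl xs + (- bf.\<kappa> / \<tau>) * walk xs)\<^sup>2)" by simp
  also have "\<dots> = K * (1\<^sup>2 * bf.\<beta> + 2 * 1 * (- bf.\<kappa> / \<tau>) * bf.\<kappa> + (- bf.\<kappa> / \<tau>)\<^sup>2 * \<tau>)"
    by (rule bf.expectation_block_square(1))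
  also have "1\<^sup>2 * bf.\<beta> + 2 * 1 * (- bf.\<kappa> / \<tau>) * bf.\<kappa> + (- bf.\<kappa> / \<tau>)\<^sup>2 * \<tau> = bf.limit_var"
    using \<tau>_pos by (simp add: bf.limit_var_def power2_eq_square)
  finally show "vK K \<ge> 0" using bf.K_pos by (simp add: eq zero_le_mult_iff)
qed

text \<open>Nonnegativity passes to the limit from the block variances \<open>vK\<close>. It shows
  that \<open>subtree_cov\<close> is positive semidefinite and thus a possible Gaussian
  covariance.\<close>

lemma v_nonneg: "v \<ge> 0"
proof (rule tendsto_lowerbound[OF vK_tendsto])
  show "\<forall>\<^sub>F K in sequentially. 0 \<le> vK K"
    using block_functional_Bf limit_var_eq_vK(2) by (intro eventually_sequentiallyI[of k0]) blast
qed simp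

lemma W_block_error:
  "\<exists>A\<ge>0. \<forall>K\<ge>k0. \<forall>\<^sub>F n in lattice_at_top.
     measure_pmf.expectation (bridge_pmf p n) (\<lambda>xs. \<bar>W xs - block_sum (Bf K) K (n div K) xs\<bar>) \<le> A * sqrt n / sqrt K"
proof -
  let ?P = "\<lambda>T A. A \<ge> 0 \<and> (\<forall>K>tree_order T. \<forall>\<^sub>F n in lattice_at_top.
     measure_pmf.expectation (bridge_pmf p n)
       (\<lambda>xs. \<bar>dev T xs - (block_sum (rocc T) K (n div K) xs - real (n div K) * ((real K - real (tree_order T)) * tree_prob p T))\<bar>)
     \<le> A * sqrt n / sqrt K)"
  have "\<forall>T. \<exists>A. ?P T A" using dev_block_error by blast
  from choice[OF this] obtain A where PA: "\<forall>T. ?P T (A T)" by blast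
  have A: "A T \<ge> 0" "K > tree_order T \<Longrightarrow> \<forall>\<^sub>F n in lattice_at_top.
     measure_pmf.expectation (bridge_pmf p n)
       (\<lambda>xs. \<bar>dev T xs - (block_sum (rocc T) K (n div K) xs - real (n div K) * ((real K - real (tree_order T)) * tree_prob p T))\<bar>)
     \<le> A T * sqrt n / sqrt K" for T K
    using PA[rule_format, of T] by blast+
  let ?A = "\<Sum>T\<in>S. \<bar>a T\<bar> * A T"
  have "\<forall>\<^sub>F n in lattice_at_top.
     measure_pmf.expectation (bridge_pmf p n) (\<lambda>xs. \<bar>W xs - block_sum (Bf K) K (n div K) xs\<bar>) \<le> ?A * sqrt n / sqrt K" if K: "K \<ge> k0" for K
  proof -
    have "\<forall>\<^sub>F n in lattice_at_top. \<forall>T\<in>S. measure_pmf.expectation (bridge_pmf p n)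
       (\<lambda>xs. \<bar>dev T xs - (block_sum (rocc T) K (n div K) xs - real (n div K) * ((real K - real (tree_order T)) * tree_prob p T))\<bar>)
     \<le> A T * sqrt n / sqrt K"
      using A(2) tree_order_less[OF _ K] by (intro eventually_ball_finite finite_S) auto
    then show ?thesis using eventually_bridge_prob_pos
    proof eventually_elim
      case (elim n)
      let ?d = "\<lambda>T xs. dev T xs - (block_sum (rocc T) K (n div K) xs - real (n div K) * ((real K - real (tree_order T)) * tree_prob p T))"
      have i: "integrable (bridge_pmf p n) f" for f :: "nat list \<Rightarrow> real" by (rule integrable_bridge_pmf[OF elim(2)])
      have "block_sum (Bf K) K (n div K) xs = (\<Sum>T\<in>S. a T * (block_sum (rocc T) K (n div K) xs - real (n div K) * ((real K - real (tree_order T)) * tree_prob p T)))" for xs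
        unfolding Bf_def[abs_def] by (rule block_sum_linear)
      then have eq: "W xs - block_sum (Bf K) K (n div K) xs = (\<Sum>T\<in>S. a T * ?d T xs)" for xs
        unfolding W_def by (simp add: sum_subtractf[symmetric] right_diff_distrib)
      have "measure_pmf.expectation (bridge_pmf p n) (\<lambda>xs. \<bar>W xs - block_sum (Bf K) K (n div K) xs\<bar>) \<le> measure_pmf.expectation (bridge_pmf p n) (\<lambda>xs. \<Sum>T\<in>S. \<bar>a T\<bar> * \<bar>?d T xs\<bar>)"
        unfolding eq by (intro integral_mono i) (simp flip: abs_mult)
      also have "\<dots> = (\<Sum>T\<in>S. \<bar>a T\<bar> * measure_pmf.expectation (bridge_pmf p n) (\<lambda>xs. \<bar>?d T xs\<bar>))"
        using i by simp
      also have "\<dots> \<le> (\<Sum>T\<in>S. \<bar>a T\<bar> * (A T * sqrt n / sqrt K))"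
        using elim(1) by (intro sum_mono mult_left_mono) auto
      also have "\<dots> = ?A * sqrt n / sqrt K" by (simp add: sum_distrib_right sum_divide_distrib mult.assoc)
      finally show ?case .
    qed
  qed
  moreover have "?A \<ge> 0" using A(1) by (intro sum_nonneg) simp
  ultimately show ?thesis by blast
qed

text \<open>A double limit: the block error divided by sqrt n is of order 1/sqrt K uniformly in
  large \<open>n\<close>, so \<open>K\<close> is fixed first, with small error and
  \<open>vK K\<close> close to \<open>v\<close>; only then \<open>n\<close> tends to
  infinity.\<close>

lemma charfun_W_tendsto:
  "((\<lambda>n. measure_pmf.expectation (bridge_pmf p n) (\<lambda>xs. iexp (s * (W xs / sqrt n)))) \<longlongrightarrow> of_real (exp (- s\<^sup>2 * v / 2))) lattice_at_top"
proof (rule tendstoI)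
  fix \<epsilon> :: real assume \<epsilon>: "\<epsilon> > 0"
  obtain A where A: "A \<ge> 0" "\<And>K. K \<ge> k0 \<Longrightarrow> \<forall>\<^sub>F n in lattice_at_top.
     measure_pmf.expectation (bridge_pmf p n) (\<lambda>xs. \<bar>W xs - block_sum (Bf K) K (n div K) xs\<bar>) \<le> A * sqrt n / sqrt K"
    using W_block_error by blast
  have "(\<lambda>K. exp (- s\<^sup>2 * vK K / 2)) \<longlonglongrightarrow> exp (- s\<^sup>2 * v / 2)"
    by (intro tendsto_exp tendsto_divide tendsto_mult tendsto_const vK_tendsto) simp
  then have e1: "\<forall>\<^sub>F K in sequentially. dist (exp (- s\<^sup>2 * vK K / 2)) (exp (- s\<^sup>2 * v / 2)) < \<epsilon> / 3"
    using \<epsilon> by (intro tendstoD) auto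
  have "(\<lambda>K. \<bar>s\<bar> * A / sqrt (real K)) \<longlonglongrightarrow> 0"
    by (intro tendsto_divide_0[OF tendsto_const] filterlim_at_top_imp_at_infinity
            filterlim_compose[OF sqrt_at_top] filterlim_real_sequentially)
  then have e2: "\<forall>\<^sub>F K in sequentially. dist (\<bar>s\<bar> * A / sqrt (real K)) 0 < \<epsilon> / 3"
    using \<epsilon> by (intro tendstoD) auto
  obtain K where K: "K \<ge> k0" "dist (exp (- s\<^sup>2 * vK K / 2)) (exp (- s\<^sup>2 * v / 2)) < \<epsilon> / 3" "\<bar>s\<bar> * A / sqrt (real K) < \<epsilon> / 3"
    using eventually_happens'[OF sequentially_bot eventually_conj[OF eventually_ge_at_top[of k0] eventually_conj[OF e1 e2]]]
    by (auto simp: dist_real_def abs_mult abs_of_nonneg[OF A(1)])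
  obtain M where bf: "block_functional p (Bf K) K M" using block_functional_Bf[OF K(1)] by blast
  have "((\<lambda>n. measure_pmf.expectation (bridge_pmf p n) (\<lambda>xs. iexp (s / sqrt n * block_sum (Bf K) K (n div K) xs)))
      \<longlongrightarrow> of_real (exp (- s\<^sup>2 * vK K / 2))) lattice_at_top"
    using block_functional.bridge_block_sum_tendsto[OF bf] unfolding limit_var_eq_vK(1)[OF K(1) bf] .
  then have "\<forall>\<^sub>F n in lattice_at_top. dist (measure_pmf.expectation (bridge_pmf p n) (\<lambda>xs. iexp (s / sqrt n * block_sum (Bf K) K (n div K) xs))) (of_real (exp (- s\<^sup>2 * vK K / 2))) < \<epsilon> / 3"
    using \<epsilon> by (intro tendstoD) auto
  moreover have "\<forall>\<^sub>F n in lattice_at_top. n \<ge> 1"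
    by (rule filter_leD[OF lattice_at_top_le eventually_ge_at_top])
  ultimately show "\<forall>\<^sub>F n in lattice_at_top. dist (measure_pmf.expectation (bridge_pmf p n) (\<lambda>xs. iexp (s * (W xs / sqrt n)))) (of_real (exp (- s\<^sup>2 * v / 2))) < \<epsilon>"
    using A(2)[OF K(1)] eventually_bridge_prob_pos
  proof eventually_elim
    case (elim n)
    let ?E1 = "measure_pmf.expectation (bridge_pmf p n) (\<lambda>xs. iexp (s * (W xs / sqrt n)))"
    let ?E2 = "measure_pmf.expectation (bridge_pmf p n) (\<lambda>xs. iexp (s / sqrt n * block_sum (Bf K) K (n div K) xs))"
    have i: "integrable (bridge_pmf p n) f" for f :: "nat list \<Rightarrow> real" by (rule integrable_bridge_pmf[OF elim(4)])
    have "norm (?E1 - ?E2) = norm (measure_pmf.expectation (bridge_pmf p n) (\<lambda>xs. iexp (s * (W xs / sqrt n)) - iexp (s / sqrt n * block_sum (Bf K) K (n div K) xs)))"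
      by (subst Bochner_Integration.integral_diff) (simp_all only: integrable_iexp_pmf)
    also have "\<dots> \<le> measure_pmf.expectation (bridge_pmf p n) (\<lambda>xs. norm (iexp (s * (W xs / sqrt n)) - iexp (s / sqrt n * block_sum (Bf K) K (n div K) xs)))"
      by (rule integral_norm_bound)
    also have "\<dots> \<le> measure_pmf.expectation (bridge_pmf p n) (\<lambda>xs. \<bar>s\<bar> / sqrt n * \<bar>W xs - block_sum (Bf K) K (n div K) xs\<bar>)"
    proof (intro integral_mono i order_trans[OF norm_iexp_diff_le])
      fix xs
      have "s * (W xs / sqrt n) - s / sqrt n * block_sum (Bf K) K (n div K) xs = s / sqrt n * (W xs - block_sum (Bf K) K (n div K) xs)"
        by (simp add: right_diff_distrib)
      then show "\<bar>s * (W xs / sqrt n) - s / sqrt n * block_sum (Bf K) K (n div K) xs\<bar> \<le> \<bar>s\<bar> / sqrt n * \<bar>W xs - block_sum (Bf K) K (n div K) xs\<bar>"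
        by (simp only: abs_mult abs_divide) simp
    qed
    also have "\<dots> = \<bar>s\<bar> / sqrt n * measure_pmf.expectation (bridge_pmf p n) (\<lambda>xs. \<bar>W xs - block_sum (Bf K) K (n div K) xs\<bar>)"
      by (rule integral_mult_right_zero)
    also have "\<dots> \<le> \<bar>s\<bar> / sqrt n * (A * sqrt n / sqrt K)" by (intro mult_left_mono elim(3)) simp
    also have "\<dots> = \<bar>s\<bar> * A / sqrt K" using elim(2) by simp
    also have "\<dots> < \<epsilon> / 3" by (rule K(3))
    finally have 1: "dist ?E1 ?E2 < \<epsilon> / 3" by (simp add: dist_norm)
    have 3: "dist (of_real (exp (- s\<^sup>2 * vK K / 2)) :: complex) (of_real (exp (- s\<^sup>2 * v / 2))) < \<epsilon> / 3"
      using K(2) by (simp only: dist_of_real)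
    show ?case
      using dist_triangle[of ?E1 "of_real (exp (- s\<^sup>2 * v / 2))" ?E2]
        dist_triangle[of ?E2 "of_real (exp (- s\<^sup>2 * v / 2))" "of_real (exp (- s\<^sup>2 * vK K / 2))"] 1 3 elim(1) by linarith
  qed
qed

lemma W_moment4:
  "\<exists>C\<ge>0. \<forall>\<^sub>F n in lattice_at_top. measure_pmf.expectation (bridge_pmf p n) (\<lambda>xs. (W xs / sqrt n) ^ 4) \<le> C"
proof -
  let ?P = "\<lambda>T C. C \<ge> 0 \<and> (\<forall>\<^sub>F n in lattice_at_top. measure_pmf.expectation (bridge_pmf p n) (\<lambda>xs. (dev T xs) ^ 4) \<le> C * (real n)\<^sup>2)"
  have "\<forall>T. \<exists>C. ?P T C" using dev_moment4 by blast
  from choice[OF this] obtain C where PC: "\<forall>T. ?P T (C T)" by blast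
  have C: "C T \<ge> 0" "\<forall>\<^sub>F n in lattice_at_top. measure_pmf.expectation (bridge_pmf p n) (\<lambda>xs. (dev T xs) ^ 4) \<le> C T * (real n)\<^sup>2" for T
    using PC[rule_format, of T] by blast+
  let ?C = "real (card S) ^ 3 * (\<Sum>T\<in>S. (a T) ^ 4 * C T)"
  have "\<forall>\<^sub>F n in lattice_at_top. \<forall>T\<in>S. measure_pmf.expectation (bridge_pmf p n) (\<lambda>xs. (dev T xs) ^ 4) \<le> C T * (real n)\<^sup>2"
    using C(2) by (intro eventually_ball_finite finite_S) auto
  moreover have "\<forall>\<^sub>F n in lattice_at_top. n \<ge> 1"
    by (rule filter_leD[OF lattice_at_top_le eventually_ge_at_top])
  ultimately have "\<forall>\<^sub>F n in lattice_at_top. measure_pmf.expectation (bridge_pmf p n) (\<lambda>xs. (W xs / sqrt n) ^ 4) \<le> ?C"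
    using eventually_bridge_prob_pos
  proof eventually_elim
    case (elim n)
    have i: "integrable (bridge_pmf p n) f" for f :: "nat list \<Rightarrow> real" by (rule integrable_bridge_pmf[OF elim(3)])
    have n4: "sqrt (real n) ^ 4 = (real n)\<^sup>2"
    proof -
      have "sqrt (real n) ^ (2 * 2) = ((sqrt (real n))\<^sup>2)\<^sup>2" by (rule power_mult)
      also have "(sqrt (real n))\<^sup>2 = real n" by simp
      finally show ?thesis by simp
    qed
    have "measure_pmf.expectation (bridge_pmf p n) (\<lambda>xs. (W xs / sqrt n) ^ 4) = measure_pmf.expectation (bridge_pmf p n) (\<lambda>xs. (W xs) ^ 4) / (real n)\<^sup>2"
      by (simp add: power_divide n4)
    also have "measure_pmf.expectation (bridge_pmf p n) (\<lambda>xs. (W xs) ^ 4) \<le> measure_pmf.expectation (bridge_pmf p n) (\<lambda>xs. real (card S) ^ 3 * (\<Sum>T\<in>S. (a T) ^ 4 * (dev T xs) ^ 4))"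
      unfolding W_def using sum_power4_le[of "\<lambda>T. a T * dev T _" S] by (intro integral_mono i) (simp add: power_mult_distrib)
    also have "\<dots> = real (card S) ^ 3 * (\<Sum>T\<in>S. (a T) ^ 4 * measure_pmf.expectation (bridge_pmf p n) (\<lambda>xs. (dev T xs) ^ 4))"
      using i by simp
    also have "\<dots> \<le> real (card S) ^ 3 * (\<Sum>T\<in>S. (a T) ^ 4 * (C T * (real n)\<^sup>2))"
      using elim(1) by (intro mult_left_mono sum_mono) auto
    also have "\<dots> = ?C * (real n)\<^sup>2" by (simp add: sum_distrib_right mult.assoc)
    finally show ?case using elim(2) by (simp add: divide_right_mono pos_divide_le_eq)
  qed
  moreover have "?C \<ge> 0" using C(1) by (intro mult_nonneg_nonneg sum_nonneg) auto
  ultimately show ?thesis by blast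
qed

lemma W_moments_tendsto:
  "((\<lambda>n. measure_pmf.expectation (bridge_pmf p n) (\<lambda>xs. W xs / sqrt n)) \<longlongrightarrow> 0) lattice_at_top"
  "((\<lambda>n. measure_pmf.expectation (bridge_pmf p n) (\<lambda>xs. (W xs / sqrt n)\<^sup>2)) \<longlongrightarrow> v) lattice_at_top"
proof -
  obtain C where C: "C \<ge> 0" "\<forall>\<^sub>F n in lattice_at_top. measure_pmf.expectation (bridge_pmf p n) (\<lambda>xs. (W xs / sqrt n) ^ 4) \<le> C"
    using W_moment4 by blast
  have fin: "\<forall>\<^sub>F n in lattice_at_top. finite (set_pmf (bridge_pmf p n))"
    using eventually_bridge_prob_pos by eventually_elim (rule finite_set_bridge_pmf)
  note M = moments_tendsto_of_charfun[of "bridge_pmf p" lattice_at_top "\<lambda>n xs. W xs / sqrt n", OF fin C(2) charfun_W_tendsto v_nonneg C(1)]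
  show "((\<lambda>n. measure_pmf.expectation (bridge_pmf p n) (\<lambda>xs. W xs / sqrt n)) \<longlongrightarrow> 0) lattice_at_top" by (rule M(1))
  show "((\<lambda>n. measure_pmf.expectation (bridge_pmf p n) (\<lambda>xs. (W xs / sqrt n)\<^sup>2)) \<longlongrightarrow> v) lattice_at_top" by (rule M(2))
qed

end

section \<open>Gaussian families\<close>

definition psd :: "('i \<Rightarrow> 'i \<Rightarrow> real) \<Rightarrow> bool" where
  "psd K \<longleftrightarrow> (\<forall>i j. K i j = K j i) \<and> (\<forall>S a. finite S \<longrightarrow> 0 \<le> (\<Sum>i\<in>S. \<Sum>j\<in>S. a i * a j * K i j))"

lemma psdD: "psd K \<Longrightarrow> K i j = K j i" "psd K \<Longrightarrow> finite S \<Longrightarrow> 0 \<le> (\<Sum>i\<in>S. \<Sum>j\<in>S. a i * a j * K i j)"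
  by (auto simp: psd_def)

lemma psd_diag: "psd K \<Longrightarrow> K i i \<ge> 0"
  using psdD(2)[of K "{i}" "\<lambda>_. 1"] by simp

text \<open>With a zero diagonal entry the form on two indices is affine in \<open>x\<close>; being
  nonnegative for all \<open>x\<close>, it has slope 0.\<close>

lemma psd_zero_row:
  assumes K: "psd K" and m: "K m m = 0"
  shows "K m j = 0"
proof (cases "j = m")
  case False
  have q: "0 \<le> 2 * x * K m j + K j j" for x
    using psdD(2)[OF K, of "{m, j}" "\<lambda>i. if i = m then x else 1"] False m psdD(1)[OF K, of j m]
    by (simp add: algebra_simps)
  show ?thesis
  proof (rule ccontr)
    assume "K m j \<noteq> 0"
    then have "2 * ((- K j j - 1) / (2 * K m j)) * K m j = - K j j - 1" by simp
    then show False using q[of "(- K j j - 1) / (2 * K m j)"] by linarith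
  qed
qed (use m in simp)

text \<open>Elimination of the index \<open>m\<close>. For a zero pivot the quotient is 0 by
  convention and the matrix is left unchanged, so degenerate covariances are included.\<close>

lemma psd_schur:
  assumes K: "psd K"
  shows "psd (\<lambda>i j. K i j - K i m * K j m / K m m)"
  unfolding psd_def
proof (intro conjI allI impI)
  fix i j show "K i j - K i m * K j m / K m m = K j i - K j m * K i m / K m m"
    using psdD(1)[OF K, of i j] by simp
next
  fix S :: "'a set" and a :: "'a \<Rightarrow> real" assume S: "finite S"
  define B where "B = (\<Sum>i\<in>S. a i * K i m)"
  define Q where "Q = (\<Sum>i\<in>S. \<Sum>j\<in>S. a i * a j * K i j)"
  have "(\<Sum>i\<in>S. \<Sum>j\<in>S. a i * a j * (K i j - K i m * K j m / K m m)) =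
     Q - (\<Sum>i\<in>S. \<Sum>j\<in>S. (a i * K i m) * (a j * K j m) / K m m)"
    unfolding Q_def sum_subtractf[symmetric] by (intro sum.cong refl) (simp add: algebra_simps)
  also have "(\<Sum>i\<in>S. \<Sum>j\<in>S. (a i * K i m) * (a j * K j m) / K m m) = B\<^sup>2 / K m m"
    unfolding B_def power2_eq_square sum_product by (simp add: sum_divide_distrib)
  finally have eq: "(\<Sum>i\<in>S. \<Sum>j\<in>S. a i * a j * (K i j - K i m * K j m / K m m)) = Q - B\<^sup>2 / K m m" .
  have Q0: "Q \<ge> 0" unfolding Q_def by (rule psdD(2)[OF K S])
  show "0 \<le> (\<Sum>i\<in>S. \<Sum>j\<in>S. a i * a j * (K i j - K i m * K j m / K m m))"
  proof (cases "K m m = 0")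
    case False
    \<comment> \<open>The weight at \<open>m\<close> that minimises the form for given
      \<open>a\<close>. It is added to the coefficient there, because \<open>m\<close> may already
      belong to \<open>S\<close>.\<close>
    define t where "t = - B / K m m"
    define b where "b = (\<lambda>i. if i \<in> S then a i else 0)"
    let ?S = "insert m S"
    have ins: "(\<Sum>i\<in>?S. b i * f i) = (\<Sum>i\<in>S. a i * f i)" for f :: "'a \<Rightarrow> real"
      using S by (intro sum.mono_neutral_cong_right) (auto simp: b_def)
    have del: "(\<Sum>i\<in>?S. (if i = m then t else 0) * f i) = t * f m" for f :: "'a \<Rightarrow> real"
    proof -
      have "(\<Sum>i\<in>?S. (if i = m then t else 0) * f i) = (\<Sum>i\<in>?S. if i = m then t * f i else 0)"
        by (intro sum.cong) auto
      then show ?thesis using S by simp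
    qed
    have lin: "(\<Sum>i\<in>?S. (b i + (if i = m then t else 0)) * f i) = (\<Sum>i\<in>S. a i * f i) + t * f m" for f :: "'a \<Rightarrow> real"
      by (simp only: distrib_right sum.distrib ins del)
    have "0 \<le> (\<Sum>i\<in>?S. \<Sum>j\<in>?S. (b i + (if i = m then t else 0)) * (b j + (if j = m then t else 0)) * K i j)"
      using S by (intro psdD(2)[OF K]) simp
    also have "\<dots> = (\<Sum>i\<in>?S. (b i + (if i = m then t else 0)) * (\<Sum>j\<in>?S. (b j + (if j = m then t else 0)) * K i j))"
      by (simp only: sum_distrib_left mult.assoc)
    also have "\<dots> = (\<Sum>i\<in>S. a i * ((\<Sum>j\<in>S. a j * K i j) + t * K i m)) + t * ((\<Sum>j\<in>S. a j * K m j) + t * K m m)"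
      by (simp only: lin)
    also have "(\<Sum>i\<in>S. a i * ((\<Sum>j\<in>S. a j * K i j) + t * K i m)) = Q + t * B"
      unfolding Q_def B_def by (simp add: distrib_left sum.distrib sum_distrib_left mult.assoc mult.left_commute)
    also have "(\<Sum>j\<in>S. a j * K m j) = B" unfolding B_def by (simp add: psdD(1)[OF K, of m])
    also have "Q + t * B + t * (B + t * K m m) = Q - B\<^sup>2 / K m m"
      using False by (simp add: t_def power2_eq_square)
    finally show ?thesis unfolding eq .
  qed (use eq Q0 in simp)
qed

text \<open>\<open>R m\<close> is the residual after \<open>m\<close> elimination steps. Its first
  \<open>m\<close> rows and columns vanish, also after zero pivots by \<open>psd_zero_row\<close>,
  so the telescoped expansion of the entry \<open>i j\<close> ends at \<open>min i j\<close>; every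
  row of \<open>L\<close> used is finite even though the matrix is infinite.\<close>

lemma cholesky:
  fixes K :: "nat \<Rightarrow> nat \<Rightarrow> real"
  assumes K: "psd K"
  shows "\<exists>L. \<forall>i j. K i j = (\<Sum>m\<le>min i j. L i m * L j m)"
proof -
  define R where "R = rec_nat K (\<lambda>m R i j. R i j - R i m * R j m / R m m)"
  have R0: "R 0 = K" and RS: "R (Suc m) = (\<lambda>i j. R m i j - R m i m * R m j m / R m m m)" for m
    by (simp_all add: R_def)
  have psd: "psd (R m)" for m
    by (induction m) (simp_all add: R0 K RS psd_schur)
  have zero: "R m i j = 0" if "i < m \<or> j < m" for m i j
    using that
  proof (induction m arbitrary: i j)
    case (Suc m)
    have row: "R m m j - R m m m * R m j m / R m m m = 0" for j
      using psd_zero_row[OF psd, of m m j] psdD(1)[OF psd, of m m j] by (cases "R m m m = 0") auto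
    have col: "R m i m - R m i m * R m m m / R m m m = 0" for i
      using psd_zero_row[OF psd, of m m i] psdD(1)[OF psd, of m m i] by (cases "R m m m = 0") auto
    from Suc.prems consider "i = m" | "j = m" | "i < m \<or> j < m" by linarith
    then show ?case
    proof cases
      case 1
      then show ?thesis using row[of j] by (simp only: RS)
    next
      case 2
      then show ?thesis using col[of i] by (simp only: RS)
    next
      case 3
      then have "R m i j = 0" "R m i m * R m j m = 0" using Suc.IH by auto
      then show ?thesis by (simp add: RS)
    qed
  qed simp
  define L where "L i m = R m i m / sqrt (R m m m)" for i m
  have LL: "L i m * L j m = R m i m * R m j m / R m m m" for i j m
  proof -
    have "L i m * L j m = (R m i m * R m j m) / (sqrt (R m m m) * sqrt (R m m m))" by (simp add: L_def)
    also have "sqrt (R m m m) * sqrt (R m m m) = R m m m" using psd_diag[OF psd, of m m] by simp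
    finally show ?thesis .
  qed
  have tel: "K i j = R n i j + (\<Sum>m<n. L i m * L j m)" for n i j
    by (induction n) (simp_all add: R0 RS LL)
  have "K i j = (\<Sum>m\<le>min i j. L i m * L j m)" for i j
    using tel[of i j "Suc (min i j)"] zero[of i "Suc (min i j)" j] by (auto simp: lessThan_Suc_atMost min_def)
  then show ?thesis by blast
qed

section \<open>Linear combinations of independent standard normal variables\<close>

abbreviation gauss_space :: "('i \<Rightarrow> real) measure" where
  "gauss_space \<equiv> \<Pi>\<^sub>M i\<in>UNIV. std_normal_distribution"

lemma prob_space_gauss_space: "prob_space (gauss_space :: ('i \<Rightarrow> real) measure)"
  by (intro prob_space_PiM prob_space_normal_density) simp

lemma gauss_coordinate:
  "(\<lambda>\<omega>. \<omega> i) \<in> borel_measurable (gauss_space :: ('i \<Rightarrow> real) measure)"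
  "distributed (gauss_space :: ('i \<Rightarrow> real) measure) lborel (\<lambda>\<omega>. \<omega> i) std_normal_density"
proof -
  have m: "(\<lambda>\<omega>. \<omega> i) \<in> measurable (gauss_space :: ('i \<Rightarrow> real) measure) std_normal_distribution"
    by (rule measurable_component_singleton) simp
  then show b: "(\<lambda>\<omega>. \<omega> i) \<in> borel_measurable (gauss_space :: ('i \<Rightarrow> real) measure)"
    by (simp cong: measurable_cong_sets)
  have "distr (gauss_space :: ('i \<Rightarrow> real) measure) lborel (\<lambda>\<omega>. \<omega> i) = distr gauss_space std_normal_distribution (\<lambda>\<omega>. \<omega> i)"
    by (rule distr_cong) auto
  also have "\<dots> = std_normal_distribution"
    by (intro distr_PiM_component prob_space_normal_density) simp_all
  finally show "distributed (gauss_space :: ('i \<Rightarrow> real) measure) lborel (\<lambda>\<omega>. \<omega> i) std_normal_density"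
    using b by (simp add: distributed_def)
qed

lemma indep_gauss: "prob_space.indep_vars (gauss_space :: ('i \<Rightarrow> real) measure) (\<lambda>_. borel) (\<lambda>i \<omega>. \<omega> i) UNIV"
proof -
  interpret prob_space "gauss_space :: ('i \<Rightarrow> real) measure" by (rule prob_space_gauss_space)
  show ?thesis
  proof (subst indep_vars_iff_distr_eq_PiM)
    show "random_variable borel (\<lambda>\<omega>. \<omega> i)" for i :: 'i by (rule gauss_coordinate(1))
    have comp: "distr (gauss_space :: ('i \<Rightarrow> real) measure) borel (\<lambda>\<omega>. \<omega> i) = std_normal_distribution" for i
    proof -
      have "distr (gauss_space :: ('i \<Rightarrow> real) measure) borel (\<lambda>\<omega>. \<omega> i) = distr gauss_space std_normal_distribution (\<lambda>\<omega>. \<omega> i)"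
        by (rule distr_cong) auto
      also have "\<dots> = std_normal_distribution"
        by (intro distr_PiM_component prob_space_normal_density) simp_all
      finally show ?thesis .
    qed
    have sets: "sets (gauss_space :: ('i \<Rightarrow> real) measure) = sets (\<Pi>\<^sub>M i\<in>UNIV. borel)"
      by (rule sets_PiM_cong) simp_all
    have "distr (gauss_space :: ('i \<Rightarrow> real) measure) (\<Pi>\<^sub>M i\<in>UNIV. borel) (\<lambda>x. \<lambda>i\<in>UNIV. x i) = distr gauss_space gauss_space (\<lambda>x. x)"
      by (rule distr_cong) (use sets in auto)
    then show "distr (gauss_space :: ('i \<Rightarrow> real) measure) (\<Pi>\<^sub>M i\<in>UNIV. borel) (\<lambda>x. \<lambda>i\<in>UNIV. x i) = (\<Pi>\<^sub>M i\<in>UNIV. distr gauss_space borel (\<lambda>\<omega>. \<omega> i))"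
      by (simp add: comp)
  qed simp
qed

lemma gauss_lincomb_measurable [measurable]:
  "(\<lambda>\<omega>. \<Sum>j\<in>J. c j * \<omega> j) \<in> borel_measurable (gauss_space :: ('i \<Rightarrow> real) measure)"
  by (intro borel_measurable_sum borel_measurable_times borel_measurable_const gauss_coordinate(1))

lemma gauss_lincomb_degenerate:
  assumes "finite J" "(\<Sum>j\<in>J. (c j)\<^sup>2) = (0 :: real)"
  shows "(\<Sum>j\<in>J. c j * \<omega> j) = (0 :: real)"
proof -
  have "\<forall>j\<in>J. (c j)\<^sup>2 = 0" using assms by (subst (asm) sum_nonneg_eq_0_iff) auto
  then show ?thesis by (intro sum.neutral) simp
qed

lemma gauss_lincomb_distributed:
  fixes c :: "'i \<Rightarrow> real"
  assumes J: "finite J" and pos: "(\<Sum>j\<in>J. (c j)\<^sup>2) > 0"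
  shows "distributed (gauss_space :: ('i \<Rightarrow> real) measure) lborel (\<lambda>\<omega>. \<Sum>j\<in>J. c j * \<omega> j) (normal_density 0 (sqrt (\<Sum>j\<in>J. (c j)\<^sup>2)))"
proof -
  interpret prob_space "gauss_space :: ('i \<Rightarrow> real) measure" by (rule prob_space_gauss_space)
  \<comment> \<open>Zero coefficients are dropped since a multiple by 0 has no normal
    density.\<close>
  define I where "I = {j\<in>J. c j \<noteq> 0}"
  have sum_I: "(\<Sum>j\<in>J. c j * f j) = (\<Sum>j\<in>I. c j * f j)" for f :: "'i \<Rightarrow> real"
    using J unfolding I_def by (intro sum.mono_neutral_right) auto
  have sq_I: "(\<Sum>j\<in>J. (c j)\<^sup>2) = (\<Sum>j\<in>I. (c j)\<^sup>2)"
    using J unfolding I_def by (intro sum.mono_neutral_right) auto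
  have "distributed gauss_space lborel (\<lambda>\<omega>. \<Sum>j\<in>I. c j * \<omega> j) (normal_density (\<Sum>j\<in>I. 0) (sqrt (\<Sum>j\<in>I. \<bar>c j\<bar>\<^sup>2)))"
  proof (rule sum_indep_normal)
    show "finite I" using J by (simp add: I_def)
    show "I \<noteq> {}" using pos sq_I by auto
    show "indep_vars (\<lambda>i. borel) (\<lambda>j \<omega>. c j * \<omega> j) I"
      by (rule indep_vars_compose2[OF indep_vars_subset[OF indep_gauss]]) auto
    fix i assume i: "i \<in> I"
    then show "0 < \<bar>c i\<bar>" by (simp add: I_def)
    show "distributed gauss_space lborel (\<lambda>\<omega>. c i * \<omega> i) (normal_density 0 \<bar>c i\<bar>)"
      using normal_density_affine[OF gauss_coordinate(2)[of i], of "c i" 0] i by (simp add: I_def)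
  qed
  then show ?thesis unfolding sum_I sq_I by simp
qed

lemma iexp_mult: "iexp b * iexp y = iexp (y + b)"
  by (simp add: exp_add[symmetric] algebra_simps)

lemma Re_iexp: "Re (iexp x) = cos x"
  by (simp add: Re_exp)

text \<open>The phase \<open>b\<close> makes cosines carry the whole characteristic function in real
  form: \<open>b = 0\<close> gives its real part, and a shift by a quarter turn its imaginary
  part.\<close>

lemma gauss_lincomb_moments:
  fixes c :: "'i \<Rightarrow> real"
  assumes J: "finite J"
  defines "X \<equiv> \<lambda>\<omega> :: 'i \<Rightarrow> real. \<Sum>j\<in>J. c j * \<omega> j"
  shows "integrable gauss_space X" "(\<integral>\<omega>. X \<omega> \<partial>gauss_space) = 0"
    "integrable gauss_space (\<lambda>\<omega>. (X \<omega>)\<^sup>2)" "(\<integral>\<omega>. (X \<omega>)\<^sup>2 \<partial>gauss_space) = (\<Sum>j\<in>J. (c j)\<^sup>2)"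
    "(\<integral>\<omega>. cos (X \<omega> + b) \<partial>gauss_space) = cos b * exp (- (\<Sum>j\<in>J. (c j)\<^sup>2) / 2)"
proof -
  interpret prob_space "gauss_space :: ('i \<Rightarrow> real) measure" by (rule prob_space_gauss_space)
  let ?v = "\<Sum>j\<in>J. (c j)\<^sup>2"
  have "integrable gauss_space X \<and> expectation X = 0 \<and> integrable gauss_space (\<lambda>\<omega>. (X \<omega>)\<^sup>2) \<and> expectation (\<lambda>\<omega>. (X \<omega>)\<^sup>2) = ?v \<and>
     expectation (\<lambda>\<omega>. cos (X \<omega> + b)) = cos b * exp (- ?v / 2)"
  proof (cases "?v = 0")
    case True
    then have "X = (\<lambda>_. 0)" unfolding X_def using gauss_lincomb_degenerate[OF J] by blast
    then show ?thesis using True prob_space by simp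
  next
    case False
    then have v: "?v > 0" by (simp add: sum_nonneg less_le)
    let ?s = "sqrt ?v"
    have s: "?s > 0" using v by simp
    have D: "distributed gauss_space lborel X (normal_density 0 ?s)"
      unfolding X_def by (rule gauss_lincomb_distributed[OF J v])
    have i1: "integrable gauss_space X"
      using distributed_integrable[OF D, of "\<lambda>x. x"] integrable_normal_moment[OF s, of 0 1] by simp
    have i2: "integrable gauss_space (\<lambda>\<omega>. (X \<omega>)\<^sup>2)"
      using distributed_integrable[OF D, of "\<lambda>x. x\<^sup>2"] integrable_normal_moment[OF s, of 0 2] by simp
    have e1: "expectation X = 0" by (rule normal_distributed_expectation[OF s D])
    have e2: "expectation (\<lambda>\<omega>. (X \<omega>)\<^sup>2) = ?v" using normal_distributed_variance[OF s D] v by (simp add: e1)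
    have Y: "distributed gauss_space lborel (\<lambda>\<omega>. 0 + 1 / ?s * X \<omega>) (normal_density (0 + 1 / ?s * 0) (\<bar>1 / ?s\<bar> * ?s))"
      by (rule normal_density_affine[OF D s]) (use s in simp)
    have Y: "distr gauss_space lborel (\<lambda>\<omega>. X \<omega> / ?s) = std_normal_distribution" and mY: "(\<lambda>\<omega>. X \<omega> / ?s) \<in> measurable gauss_space lborel"
      using Y s by (simp_all add: distributed_def)
    have "expectation (\<lambda>\<omega>. cos (X \<omega> + b)) = expectation (\<lambda>\<omega>. cos (?s * (X \<omega> / ?s) + b))" using s by simp
    also have "\<dots> = (\<integral>y. cos (?s * y + b) \<partial>distr gauss_space lborel (\<lambda>\<omega>. X \<omega> / ?s))"
      using mY by (intro integral_distr[symmetric]) simp_all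
    also have "\<dots> = (\<integral>y. Re (iexp b * iexp (?s * y)) \<partial>std_normal_distribution)"
      unfolding Y by (intro Bochner_Integration.integral_cong refl) (simp only: iexp_mult Re_iexp)
    also have "\<dots> = Re (\<integral>y. iexp b * iexp (?s * y) \<partial>std_normal_distribution)"
    proof (rule integral_Re)
      interpret std: real_distribution std_normal_distribution by (rule real_dist_normal_dist)
      show "complex_integrable std_normal_distribution (\<lambda>y. iexp b * iexp (?s * y))"
        by (intro integrable_mult_right std.integrable_iexp) simp_all
    qed
    also have "(\<integral>y. iexp b * iexp (?s * y) \<partial>std_normal_distribution) = iexp b * char std_normal_distribution ?s"
      unfolding char_def by (rule integral_mult_right_zero)
    also have "\<dots> = iexp b * of_real (exp (- ?v / 2))" using v by (simp add: char_std_normal_distribution)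
    finally have "expectation (\<lambda>\<omega>. cos (X \<omega> + b)) = cos b * exp (- ?v / 2)" by (simp add: Re_exp)
    then show ?thesis using i1 i2 e1 e2 by blast
  qed
  then show "integrable gauss_space X" "expectation X = 0" "integrable gauss_space (\<lambda>\<omega>. (X \<omega>)\<^sup>2)" "expectation (\<lambda>\<omega>. (X \<omega>)\<^sup>2) = ?v"
     "expectation (\<lambda>\<omega>. cos (X \<omega> + b)) = cos b * exp (- ?v / 2)" by auto
qed

text \<open>An enumeration \<open>g\<close> of the index set reduces the construction to the
  Cholesky factor over the natural numbers. Each \<open>Z i\<close> is a finite combination of noise
  variables; these are indexed by the original type, so that the sample space is a function space
  over it.\<close>

theorem gaussian_family_exists:
  fixes G :: "'i :: countable \<Rightarrow> 'i \<Rightarrow> real"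
  assumes G: "psd G" and inf: "infinite (UNIV :: 'i set)"
  shows "\<exists>(N :: ('i \<Rightarrow> real) measure) Z. prob_space N \<and> jointly_normal N Z \<and>
     (\<forall>i. Z i \<in> borel_measurable N \<and> integrable N (Z i) \<and> integrable N (\<lambda>\<omega>. (Z i \<omega>)\<^sup>2) \<and> (\<integral>\<omega>. Z i \<omega> \<partial>N) = 0) \<and>
     (\<forall>i j. covariance N (Z i) (Z j) = G i j) \<and>
     (\<forall>S a b. finite S \<longrightarrow> (\<integral>\<omega>. cos ((\<Sum>i\<in>S. a i * Z i \<omega>) + b) \<partial>N) = cos b * exp (- (\<Sum>i\<in>S. \<Sum>j\<in>S. a i * a j * G i j) / 2))"
proof -
  define g where "g = from_nat_into (UNIV :: 'i set)"
  define h where "h = to_nat_on (UNIV :: 'i set)"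
  have bij: "bij g" unfolding g_def using inf by (intro bij_betw_from_nat_into) auto
  have gh: "g (h i) = i" for i by (simp add: g_def h_def)
  have injg: "inj_on g A" for A using bij by (meson bij_is_inj inj_on_subset subset_UNIV)
  have "psd (\<lambda>m n. G (g m) (g n))"
    unfolding psd_def
  proof (intro conjI allI impI)
    show "G (g m) (g n) = G (g n) (g m)" for m n by (rule psdD(1)[OF G])
    fix S :: "nat set" and a :: "nat \<Rightarrow> real" assume S: "finite S"
    have ag: "the_inv g (g m) = m" for m using bij by (intro the_inv_f_f) (rule bij_is_inj)
    have "0 \<le> (\<Sum>i\<in>g ` S. \<Sum>j\<in>g ` S. a (the_inv g i) * a (the_inv g j) * G i j)"
      using S by (intro psdD(2)[OF G]) simp
    then show "0 \<le> (\<Sum>m\<in>S. \<Sum>n\<in>S. a m * a n * G (g m) (g n))"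
      by (simp add: sum.reindex[OF injg] ag)
  qed
  then obtain L where L: "\<And>m n. G (g m) (g n) = (\<Sum>k\<le>min m n. L m k * L n k)" using cholesky by blast
  \<comment> \<open>The rows of \<open>L\<close> padded by zeros, so that different \<open>i\<close>
    can share one summation range.\<close>
  define l where "l i k = (if k \<le> h i then L (h i) k else 0)" for i k
  define Z where "Z i \<omega> = (\<Sum>k\<le>h i. L (h i) k * \<omega> (g k))" for i and \<omega> :: "'i \<Rightarrow> real"
  define N where "N = (gauss_space :: ('i \<Rightarrow> real) measure)"
  have Gl: "G i j = (\<Sum>k\<le>n. l i k * l j k)" if "h i \<le> n" "h j \<le> n" for i j n
  proof -
    have "G i j = (\<Sum>k\<le>min (h i) (h j). L (h i) k * L (h j) k)" using L[of "h i" "h j"] by (simp add: gh)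
    also have "\<dots> = (\<Sum>k\<le>n. l i k * l j k)"
      using that by (intro sum.mono_neutral_cong_left) (auto simp: l_def)
    finally show ?thesis .
  qed
  have Zl: "Z i \<omega> = (\<Sum>k\<le>n. l i k * \<omega> (g k))" if "h i \<le> n" for i n \<omega>
    unfolding Z_def using that by (intro sum.mono_neutral_cong_left) (auto simp: l_def)
  define cf where "cf S a j = (\<Sum>i\<in>S. a i * l i (the_inv g j))" for S and a :: "'i \<Rightarrow> real" and j
  \<comment> \<open>All noise coordinates that enter some \<open>Z i\<close> with \<open>i\<close>
    in \<open>S\<close>; the inserted 0 gives \<open>Max\<close> a value for empty
    \<open>S\<close>.\<close>
  define J where "J S = g ` {..Max (insert 0 (h ` S))}" for S
  have the: "the_inv g (g k) = k" for k using bij by (intro the_inv_f_f) (rule bij_is_inj)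
  have le: "h i \<le> Max (insert 0 (h ` S))" if "finite S" "i \<in> S" for S i
    using that by (intro Max_ge) auto
  have J: "finite (J S)" for S by (simp add: J_def)
  have comb: "(\<Sum>i\<in>S. a i * Z i \<omega>) = (\<Sum>j\<in>J S. cf S a j * \<omega> j)" if S: "finite S" for S a \<omega>
  proof -
    have "(\<Sum>i\<in>S. a i * Z i \<omega>) = (\<Sum>i\<in>S. \<Sum>k\<le>Max (insert 0 (h ` S)). a i * l i k * \<omega> (g k))"
    proof (intro sum.cong refl)
      fix i assume "i \<in> S"
      show "a i * Z i \<omega> = (\<Sum>k\<le>Max (insert 0 (h ` S)). a i * l i k * \<omega> (g k))"
        unfolding Zl[OF le[OF S \<open>i \<in> S\<close>]] by (simp add: sum_distrib_left mult.assoc)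
    qed
    also have "\<dots> = (\<Sum>k\<le>Max (insert 0 (h ` S)). (\<Sum>i\<in>S. a i * l i k) * \<omega> (g k))"
      by (subst sum.swap) (simp add: sum_distrib_right)
    also have "\<dots> = (\<Sum>j\<in>J S. cf S a j * \<omega> j)"
      unfolding J_def by (simp add: sum.reindex[OF injg] cf_def the)
    finally show ?thesis .
  qed
  have var: "(\<Sum>j\<in>J S. (cf S a j)\<^sup>2) = (\<Sum>i\<in>S. \<Sum>j\<in>S. a i * a j * G i j)" if S: "finite S" for S a
  proof -
    let ?n = "Max (insert 0 (h ` S))"
    have "(\<Sum>j\<in>J S. (cf S a j)\<^sup>2) = (\<Sum>k\<le>?n. (\<Sum>i\<in>S. a i * l i k)\<^sup>2)"
      unfolding J_def by (simp add: sum.reindex[OF injg] cf_def the)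
    also have "\<dots> = (\<Sum>k\<le>?n. \<Sum>i\<in>S. \<Sum>j\<in>S. (a i * l i k) * (a j * l j k))"
      unfolding power2_eq_square sum_product ..
    also have "\<dots> = (\<Sum>i\<in>S. \<Sum>j\<in>S. \<Sum>k\<le>?n. (a i * l i k) * (a j * l j k))"
      by (subst sum.swap, rule sum.cong[OF refl], rule sum.swap)
    also have "\<dots> = (\<Sum>i\<in>S. \<Sum>j\<in>S. a i * a j * G i j)"
    proof (intro sum.cong refl)
      fix i j assume "i \<in> S" "j \<in> S"
      show "(\<Sum>k\<le>?n. (a i * l i k) * (a j * l j k)) = a i * a j * G i j"
        unfolding Gl[OF le[OF S \<open>i \<in> S\<close>] le[OF S \<open>j \<in> S\<close>]] by (simp add: sum_distrib_left algebra_simps)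
    qed
    finally show ?thesis .
  qed
  interpret N: prob_space N unfolding N_def by (rule prob_space_gauss_space)
  note mom = gauss_lincomb_moments[OF J, folded N_def]
  have meas: "(\<lambda>\<omega>. \<Sum>i\<in>S. a i * Z i \<omega>) \<in> borel_measurable N" if "finite S" for S a
    unfolding comb[OF that] N_def by (rule gauss_lincomb_measurable)
  have jn: "jointly_normal N Z"
    unfolding jointly_normal_def
  proof (intro allI impI)
    fix S :: "'i set" and a :: "'i \<Rightarrow> real" assume S: "finite S"
    let ?v = "\<Sum>j\<in>J S. (cf S a j)\<^sup>2"
    show "normal_variable N (\<lambda>\<omega>. \<Sum>i\<in>S. a i * Z i \<omega>)"
    proof (cases "?v = 0")
      case True
      have "AE \<omega> in N. (\<Sum>i\<in>S. a i * Z i \<omega>) = 0"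
        unfolding comb[OF S] using gauss_lincomb_degenerate[OF J True] by simp
      then show ?thesis using meas[OF S] unfolding normal_variable_def by blast
    next
      case False
      then have v: "?v > 0" by (simp add: sum_nonneg less_le)
      have "distributed N lborel (\<lambda>\<omega>. \<Sum>i\<in>S. a i * Z i \<omega>) (normal_density 0 (sqrt ?v))"
        unfolding comb[OF S] N_def by (rule gauss_lincomb_distributed[OF J v])
      moreover have "sqrt ?v > 0" using v by simp
      ultimately show ?thesis using meas[OF S] unfolding normal_variable_def by blast
    qed
  qed
  have single: "Z i = (\<lambda>\<omega>. \<Sum>i'\<in>{i}. 1 * Z i' \<omega>)" for i by simp
  have Z1: "Z i \<in> borel_measurable N" "integrable N (Z i)" "integrable N (\<lambda>\<omega>. (Z i \<omega>)\<^sup>2)" "(\<integral>\<omega>. Z i \<omega> \<partial>N) = 0" for i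
  proof -
    have c: "Z i = (\<lambda>\<omega>. \<Sum>j\<in>J {i}. cf {i} (\<lambda>_. 1) j * \<omega> j)"
      using comb[of "{i}" "\<lambda>_. 1"] by (intro ext) simp
    show "Z i \<in> borel_measurable N" using meas[of "{i}" "\<lambda>_. 1"] by simp
    show "integrable N (Z i)" using mom(1)[where c = "cf {i} (\<lambda>_. 1)" and S1 = "{i}"] c by simp
    show "integrable N (\<lambda>\<omega>. (Z i \<omega>)\<^sup>2)" using mom(3)[where c = "cf {i} (\<lambda>_. 1)" and S1 = "{i}"] c by simp
    show "(\<integral>\<omega>. Z i \<omega> \<partial>N) = 0" using mom(2)[where c = "cf {i} (\<lambda>_. 1)" and S1 = "{i}"] c by simp
  qed
  have sq: "integrable N (\<lambda>\<omega>. (\<Sum>i\<in>S. a i * Z i \<omega>)\<^sup>2)" "(\<integral>\<omega>. (\<Sum>i\<in>S. a i * Z i \<omega>)\<^sup>2 \<partial>N) = (\<Sum>i\<in>S. \<Sum>j\<in>S. a i * a j * G i j)"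
    if S: "finite S" for S a
    unfolding comb[OF S] using mom(3,4)[where c = "cf S a" and S1 = S] var[OF S, of a] by simp_all
  have cov: "covariance N (Z i) (Z j) = G i j" for i j
  proof (cases "i = j")
    case True
    then show ?thesis using sq(2)[of "{j}" "\<lambda>_. 1"] by (simp add: covariance_def Z1 power2_eq_square)
  next
    case False
    have sum2: "(\<integral>\<omega>. (Z i \<omega> + Z j \<omega>)\<^sup>2 \<partial>N) = G i i + 2 * G i j + G j j" "integrable N (\<lambda>\<omega>. (Z i \<omega> + Z j \<omega>)\<^sup>2)"
      using sq[of "{i, j}" "\<lambda>_. 1"] False psdD(1)[OF G, of j i] by simp_all
    have diag: "(\<integral>\<omega>. (Z i \<omega>)\<^sup>2 \<partial>N) = G i i" for i using sq(2)[of "{i}" "\<lambda>_. 1"] by simp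
    have "(\<integral>\<omega>. Z i \<omega> * Z j \<omega> \<partial>N) = (\<integral>\<omega>. ((Z i \<omega> + Z j \<omega>)\<^sup>2 - (Z i \<omega>)\<^sup>2 - (Z j \<omega>)\<^sup>2) / 2 \<partial>N)"
      by (intro Bochner_Integration.integral_cong refl) (simp add: power2_eq_square algebra_simps)
    also have "\<dots> = G i j" using sum2 Z1(3) by (simp add: diag)
    finally show ?thesis by (simp add: covariance_def Z1)
  qed
  have cosi: "(\<integral>\<omega>. cos ((\<Sum>i\<in>S. a i * Z i \<omega>) + b) \<partial>N) = cos b * exp (- (\<Sum>i\<in>S. \<Sum>j\<in>S. a i * a j * G i j) / 2)" if S: "finite S" for S a b
    unfolding comb[OF S] using mom(5)[where c = "cf S a" and S1 = S] var[OF S, of a] by simp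
  show ?thesis
    using N.prob_space_axioms jn Z1 cov cosi by (intro exI[of _ N] exI[of _ Z]) blast
qed

section \<open>Joint convergence\<close>

text \<open>Integrals converge termwise for this class, and with phases allowed the product-to-sum
  formula makes it closed under multiplication, hence an algebra as Stone-Weierstrass
  requires.\<close>

inductive trig_poly :: "'i set \<Rightarrow> (('i \<Rightarrow> real) \<Rightarrow> real) \<Rightarrow> bool" for S where
  cos: "trig_poly S (\<lambda>x. c * cos ((\<Sum>i\<in>S. a i * x i) + b))"
| add: "trig_poly S f \<Longrightarrow> trig_poly S g \<Longrightarrow> trig_poly S (\<lambda>x. f x + g x)"

lemma trig_poly_cos_mult:
  "trig_poly S f \<Longrightarrow> trig_poly S (\<lambda>x. f x * (c * cos ((\<Sum>i\<in>S. a i * x i) + b)))"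
proof (induction rule: trig_poly.induct)
  case (cos c' a' b')
  have "c' * cos ((\<Sum>i\<in>S. a' i * x i) + b') * (c * cos ((\<Sum>i\<in>S. a i * x i) + b)) =
     c' * c / 2 * cos ((\<Sum>i\<in>S. (a' i - a i) * x i) + (b' - b)) + c' * c / 2 * cos ((\<Sum>i\<in>S. (a' i + a i) * x i) + (b' + b))" for x
  proof -
    let ?u = "(\<Sum>i\<in>S. a' i * x i) + b'" and ?v = "(\<Sum>i\<in>S. a i * x i) + b"
    have "(\<Sum>i\<in>S. (a' i - a i) * x i) + (b' - b) = ?u - ?v" "(\<Sum>i\<in>S. (a' i + a i) * x i) + (b' + b) = ?u + ?v"
      by (simp_all add: sum_subtractf sum.distrib left_diff_distrib distrib_right)
    moreover have "c' * cos u * (c * cos v) = c' * c / 2 * cos (u - v) + c' * c / 2 * cos (u + v)" for u v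
      unfolding cos_diff cos_add by (simp add: algebra_simps)
    ultimately show ?thesis by (simp only:)
  qed
  then show ?case by (simp only:) (rule trig_poly.add[OF trig_poly.cos trig_poly.cos])
next
  case (add f g)
  then show ?case unfolding distrib_right by (intro trig_poly.add)
qed

lemma trig_poly_mult:
  assumes "trig_poly S f" "trig_poly S g"
  shows "trig_poly S (\<lambda>x. f x * g x)"
  using assms(2)
proof (induction rule: trig_poly.induct)
  case (cos c a b)
  then show ?case by (rule trig_poly_cos_mult[OF assms(1)])
next
  case (add g h)
  then show ?case unfolding distrib_left by (intro trig_poly.add)
qed

lemma trig_poly_const: "trig_poly S (\<lambda>_. c)"
  using trig_poly.cos[of S c "\<lambda>_. 0" 0] by simp

lemma trig_poly_sin:
  assumes "finite S" "i \<in> S"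
  shows "trig_poly S (\<lambda>x. sin (x i * w))"
proof -
  have "(\<Sum>j\<in>S. (if j = i then w else 0) * x j) = x i * w" for x :: "'a \<Rightarrow> real"
  proof -
    have "(\<Sum>j\<in>S. (if j = i then w else 0) * x j) = (\<Sum>j\<in>S. if j = i then w * x j else 0)"
      by (intro sum.cong) auto
    then show ?thesis using assms by simp
  qed
  then show ?thesis
    using trig_poly.cos[of S 1 "\<lambda>j. if j = i then w else 0" "- pi / 2"]
    by (simp add: cos_diff)
qed

lemma trig_poly_bounded: "trig_poly S f \<Longrightarrow> \<exists>C. \<forall>x. \<bar>f x\<bar> \<le> C"
proof (induction rule: trig_poly.induct)
  case (cos c a b)
  have "\<bar>c * cos ((\<Sum>i\<in>S. a i * x i) + b)\<bar> \<le> \<bar>c\<bar> * 1" for x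
    unfolding abs_mult by (rule mult_left_mono[OF abs_cos_le_one abs_ge_zero])
  then show ?case by auto
next
  case (add f g)
  from add.IH obtain C D where CD: "\<forall>x. \<bar>f x\<bar> \<le> C" "\<forall>x. \<bar>g x\<bar> \<le> D" by blast
  have "\<bar>f x + g x\<bar> \<le> C + D" for x
    using abs_triangle_ineq[of "f x" "g x"] CD[rule_format, of x] by linarith
  then show ?case by blast
qed

lemma trig_poly_continuous:
  fixes f :: "('i :: countable \<Rightarrow> real) \<Rightarrow> real"
  shows "trig_poly S f \<Longrightarrow> continuous_on UNIV f"
proof (induction rule: trig_poly.induct)
  case (cos c a b)
  show ?case by (intro continuous_intros continuous_on_product_coordinates)
qed (intro continuous_intros)

text \<open>Coordinates outside \<open>S\<close> are pinned to 0, so that the coordinates in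
  \<open>S\<close> separate points, while the full function space keeps its product
  topology.\<close>

lemma compact_cube:
  "compact {y :: 'i :: countable \<Rightarrow> real. \<forall>i. (i \<in> S \<longrightarrow> \<bar>y i\<bar> \<le> 1) \<and> (i \<notin> S \<longrightarrow> y i = 0)}"
proof -
  let ?B = "\<lambda>i. if i \<in> S then {-1..1} else {0 :: real}"
  have "compactin (product_topology (\<lambda>_. euclideanreal) UNIV) (PiE UNIV ?B)"
    by (subst compactin_PiE) (auto simp: compactin_euclidean_iff)
  then have "compact (PiE UNIV ?B)" by (simp add: euclidean_product_topology)
  also have "PiE UNIV ?B = {y. \<forall>i. (i \<in> S \<longrightarrow> \<bar>y i\<bar> \<le> 1) \<and> (i \<notin> S \<longrightarrow> y i = 0)}"
    by (auto simp: PiE_def Pi_def abs_le_iff split: if_splits)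
  finally show ?thesis .
qed

text \<open>Since \<open>R arcsin (sin (x / R)) = x\<close> for \<open>\<bar>x\<bar> \<le> R\<close>, a polynomial approximation of
  \<open>y \<mapsto> f (R arcsin y)\<close> on the cube turns, by substituting \<open>sin (x / R)\<close>, into a trigonometric
  polynomial that approximates \<open>f\<close> on \<open>[-R, R]\<^sup>S\<close> and is bounded globally.\<close>

lemma trig_poly_approx:
  fixes f :: "('i :: countable \<Rightarrow> real) \<Rightarrow> real"
  assumes S: "finite S" and f: "continuous_on UNIV f" and bound: "\<And>x. \<bar>f x\<bar> \<le> B"
    and local: "\<And>x y. (\<And>i. i \<in> S \<Longrightarrow> x i = y i) \<Longrightarrow> f x = f y"
    and e: "e > 0" and R: "R > 0"
  shows "\<exists>g. trig_poly S g \<and> (\<forall>x. \<bar>g x\<bar> \<le> B + e) \<and> (\<forall>x. (\<forall>i\<in>S. \<bar>x i\<bar> \<le> R) \<longrightarrow> \<bar>f x - g x\<bar> \<le> e)"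
proof -
  define C where "C = {y :: 'i \<Rightarrow> real. \<forall>i. (i \<in> S \<longrightarrow> \<bar>y i\<bar> \<le> 1) \<and> (i \<notin> S \<longrightarrow> y i = 0)}"
  define sn where "sn x = (\<lambda>i. if i \<in> S then sin (x i * (1 / R)) else 0)" for x :: "'i \<Rightarrow> real"
  \<comment> \<open>The functions whose pullback under \<open>sn\<close> is trigonometric. The
    coordinates belong to it because they pull back to sines, so it separates the points of
    \<open>C\<close>.\<close>
  define Rg where "Rg = {g :: ('i \<Rightarrow> real) \<Rightarrow> real. continuous_on C g \<and> trig_poly S (\<lambda>x. g (sn x))}"
  interpret function_ring_on Rg C
  proof unfold_locales
    show "compact C" unfolding C_def by (rule compact_cube)
    fix x y assume xy: "x \<in> C" "y \<in> C" "x \<noteq> y"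
    then obtain i where i: "x i \<noteq> y i" by auto
    then have "i \<in> S" using xy by (auto simp: C_def)
    then have "(\<lambda>z. z i) \<in> Rg"
      using trig_poly_sin[OF S, of i "1 / R"] continuous_on_subset[OF continuous_on_product_coordinates]
      by (simp add: Rg_def sn_def)
    then show "\<exists>g\<in>Rg. g x \<noteq> g y" using i by (intro bexI[of _ "\<lambda>z. z i"])
  qed (auto simp: Rg_def intro: continuous_intros trig_poly.add trig_poly_mult trig_poly_const)
  define F where "F y = f (\<lambda>i. R * arcsin (if i \<in> S then y i else 0))" for y
  have contF: "continuous_on C F"
    unfolding F_def
  proof (rule continuous_on_compose2[OF f])
    show "continuous_on C (\<lambda>y i. R * arcsin (if i \<in> S then y i else 0))"
    proof (intro continuous_on_coordinatewise_then_product)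
      fix i
      show "continuous_on C (\<lambda>y. R * arcsin (if i \<in> S then y i else 0))"
      proof (cases "i \<in> S")
        case True
        have "continuous_on C (\<lambda>y. y i)" by (rule continuous_on_subset[OF continuous_on_product_coordinates]) simp
        then show ?thesis using True by (intro continuous_intros) (auto simp: C_def abs_le_iff)
      qed simp
    qed
  qed simp
  obtain g where g: "g \<in> Rg" "\<And>y. y \<in> C \<Longrightarrow> \<bar>F y - g y\<bar> < e"
    using Stone_Weierstrass_basic[OF contF e] by blast
  have snC: "sn x \<in> C" for x by (auto simp: sn_def C_def)
  show ?thesis
  proof (intro exI[of _ "\<lambda>x. g (sn x)"] conjI allI impI)
    show "trig_poly S (\<lambda>x. g (sn x))" using g(1) by (simp add: Rg_def)
    show "\<bar>g (sn x)\<bar> \<le> B + e" for x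
    proof -
      have "\<bar>F (sn x)\<bar> \<le> B" unfolding F_def by (rule bound)
      then show ?thesis using g(2)[OF snC[of x]] by linarith
    qed
    fix x assume x: "\<forall>i\<in>S. \<bar>x i\<bar> \<le> R"
    have "F (sn x) = f x"
      unfolding F_def
    proof (rule local)
      fix i assume i: "i \<in> S"
      have "\<bar>x i * (1 / R)\<bar> \<le> 1" using x i R by (simp add: abs_mult)
      then have "\<bar>x i * (1 / R)\<bar> \<le> pi / 2" using pi_ge_two by linarith
      then have "arcsin (sin (x i * (1 / R))) = x i * (1 / R)"
        unfolding abs_le_iff by (intro arcsin_sin) linarith+
      then show "R * arcsin (if i \<in> S then sn x i else 0) = x i" using i R by (simp add: sn_def)
    qed
    then show "\<bar>f x - g (sn x)\<bar> \<le> e" using g(2)[OF snC[of x]] by simp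
  qed
qed

text \<open>A trigonometric polynomial approximates \<open>f\<close> only on the cube of radius
  \<open>R\<close>. Outside it both functions are bounded, and by Chebyshev the uniformly bounded
  second moments leave little mass there.\<close>

theorem joint_conv_of_cos:
  fixes X :: "nat \<Rightarrow> 'i :: countable \<Rightarrow> 'a \<Rightarrow> real" and Z :: "'i \<Rightarrow> 'b \<Rightarrow> real"
  assumes M: "\<forall>\<^sub>F n in F. prob_space (M n) \<and> (\<forall>i. X n i \<in> borel_measurable (M n) \<and> integrable (M n) (\<lambda>x. (X n i x)\<^sup>2))"
    and N: "prob_space N" and Z: "\<And>i. Z i \<in> borel_measurable N" "\<And>i. integrable N (\<lambda>x. (Z i x)\<^sup>2)"
    and tight: "\<And>i. \<exists>C. \<forall>\<^sub>F n in F. (\<integral>x. (X n i x)\<^sup>2 \<partial>M n) \<le> C"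
    and cos: "\<And>S a b. finite S \<Longrightarrow> ((\<lambda>n. \<integral>x. cos ((\<Sum>i\<in>S. a i * X n i x) + b) \<partial>M n) \<longlongrightarrow> (\<integral>y. cos ((\<Sum>i\<in>S. a i * Z i y) + b) \<partial>N)) F"
  shows "joint_conv_in_distr M X N Z F"
  unfolding joint_conv_in_distr_def
proof (intro allI impI, elim conjE)
  fix S :: "'i set" and f :: "('i \<Rightarrow> real) \<Rightarrow> real"
  assume S: "finite S" and cf: "continuous_map (product_topology (\<lambda>_. euclideanreal) S) euclideanreal f"
    and bd: "bounded (f ` topspace (product_topology (\<lambda>_. euclideanreal) S))"
  \<comment> \<open>The extension of \<open>f\<close> to functions on the whole index type, where
    the product topology is that of the type.\<close>
  define f' where "f' x = f (restrict x S)" for x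
  have cont: "continuous_on UNIV f'"
  proof -
    have "continuous_map (product_topology (\<lambda>_. euclideanreal) UNIV) (product_topology (\<lambda>_. euclideanreal) S) (\<lambda>x. restrict x S)"
      unfolding continuous_map_componentwise by (auto intro: continuous_map_product_coordinates)
    from continuous_map_compose[OF this cf] show ?thesis
      by (simp add: euclidean_product_topology f'_def[abs_def] comp_def)
  qed
  obtain B where B: "\<And>x. \<bar>f' x\<bar> \<le> B"
  proof -
    obtain B where "\<forall>y\<in>f ` topspace (product_topology (\<lambda>_. euclideanreal) S). norm y \<le> B" using bd bounded_iff by blast
    then show ?thesis by (intro that[of B]) (auto simp: f'_def)
  qed
  have B0: "B \<ge> 0" using B[of "\<lambda>_. 0"] by linarith
  have "\<forall>i. \<exists>C. \<forall>\<^sub>F n in F. (\<integral>x. (X n i x)\<^sup>2 \<partial>M n) \<le> C" using tight by blast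
  from choice[OF this] obtain C1 where C1: "\<forall>i. \<forall>\<^sub>F n in F. (\<integral>x. (X n i x)\<^sup>2 \<partial>M n) \<le> C1 i" by blast
  define C where "C = (\<Sum>i\<in>S. max (C1 i) (\<integral>y. (Z i y)\<^sup>2 \<partial>N))"
  have C0: "C \<ge> 0" unfolding C_def by (intro sum_nonneg) (simp add: le_max_iff_disj)
  have local: "f' x = f' y" if "\<And>i. i \<in> S \<Longrightarrow> x i = y i" for x y
    unfolding f'_def using that by (intro arg_cong[of _ _ f]) (auto simp: restrict_def)
  \<comment> \<open>Stated for an arbitrary probability space, as it is applied to the laws
    \<open>M n\<close> and to the limit \<open>N\<close>. The maximum in the moment bound covers
    both.\<close>
  have approx: "\<bar>(\<integral>x. f' (\<lambda>i. Y i x) \<partial>P) - (\<integral>x. g (\<lambda>i. Y i x) \<partial>P)\<bar> \<le> e + (2 * B + e) * C / R\<^sup>2"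
    if P: "prob_space P" and Y: "\<And>i. Y i \<in> borel_measurable P" "\<And>i. integrable P (\<lambda>x. (Y i x)\<^sup>2)"
      and YC: "\<And>i. i \<in> S \<Longrightarrow> (\<integral>x. (Y i x)\<^sup>2 \<partial>P) \<le> max (C1 i) (\<integral>y. (Z i y)\<^sup>2 \<partial>N)"
      and g: "trig_poly S g" "\<And>x. \<bar>g x\<bar> \<le> B + e" "\<And>x. (\<forall>i\<in>S. \<bar>x i\<bar> \<le> R) \<Longrightarrow> \<bar>f' x - g x\<bar> \<le> e" and e: "e > 0" and R: "R > 0"
    for P :: "'c measure" and Y :: "'i \<Rightarrow> 'c \<Rightarrow> real" and g e R
  proof -
    interpret P: prob_space P by fact
    have mY: "(\<lambda>x i. Y i x) \<in> borel_measurable P" by (intro measurable_coordinatewise_then_product Y(1))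
    have m1: "(\<lambda>x. f' (\<lambda>i. Y i x)) \<in> borel_measurable P"
      by (rule measurable_compose[OF mY borel_measurable_continuous_onI[OF cont]])
    have m2: "(\<lambda>x. g (\<lambda>i. Y i x)) \<in> borel_measurable P"
      by (rule measurable_compose[OF mY borel_measurable_continuous_onI[OF trig_poly_continuous[OF g(1)]]])
    have i1: "integrable P (\<lambda>x. f' (\<lambda>i. Y i x))"
      by (rule P.integrable_const_bound[OF _ m1, of B]) (simp add: B)
    have i2: "integrable P (\<lambda>x. g (\<lambda>i. Y i x))"
      by (rule P.integrable_const_bound[OF _ m2, of "B + e"]) (simp add: g(2))
    have i3: "integrable P (\<lambda>x. e + (2 * B + e) / R\<^sup>2 * (\<Sum>i\<in>S. (Y i x)\<^sup>2))"
      using Y(2) by simp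
    have pw: "\<bar>f' y - g y\<bar> \<le> e + (2 * B + e) / R\<^sup>2 * (\<Sum>i\<in>S. (y i)\<^sup>2)" for y
    proof (cases "\<forall>i\<in>S. \<bar>y i\<bar> \<le> R")
      case True
      have "0 \<le> (2 * B + e) / R\<^sup>2 * (\<Sum>i\<in>S. (y i)\<^sup>2)" using B0 e by (intro mult_nonneg_nonneg sum_nonneg) auto
      then show ?thesis using g(3)[OF True] by linarith
    next
      case False
      then obtain i where i: "i \<in> S" "\<bar>y i\<bar> > R" by auto
      have "R\<^sup>2 \<le> \<bar>y i\<bar>\<^sup>2" using i R by (intro power_mono) auto
      also have "\<bar>y i\<bar>\<^sup>2 \<le> (\<Sum>i\<in>S. (y i)\<^sup>2)" using i S member_le_sum[of i S "\<lambda>i. (y i)\<^sup>2"] by simp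
      finally have "(2 * B + e) / R\<^sup>2 * R\<^sup>2 \<le> (2 * B + e) / R\<^sup>2 * (\<Sum>i\<in>S. (y i)\<^sup>2)"
        using B0 e by (intro mult_left_mono) auto
      then have "2 * B + e \<le> (2 * B + e) / R\<^sup>2 * (\<Sum>i\<in>S. (y i)\<^sup>2)" using R by simp
      then show ?thesis using B[of y] g(2)[of y] e by linarith
    qed
    have "\<bar>(\<integral>x. f' (\<lambda>i. Y i x) \<partial>P) - (\<integral>x. g (\<lambda>i. Y i x) \<partial>P)\<bar> = \<bar>\<integral>x. f' (\<lambda>i. Y i x) - g (\<lambda>i. Y i x) \<partial>P\<bar>"
      using i1 i2 by simp
    also have "\<dots> \<le> (\<integral>x. \<bar>f' (\<lambda>i. Y i x) - g (\<lambda>i. Y i x)\<bar> \<partial>P)" by (rule integral_abs_bound)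
    also have "\<dots> \<le> (\<integral>x. e + (2 * B + e) / R\<^sup>2 * (\<Sum>i\<in>S. (Y i x)\<^sup>2) \<partial>P)"
      using i1 i2 by (intro integral_mono i3 pw) simp
    also have "\<dots> = e + (2 * B + e) / R\<^sup>2 * (\<Sum>i\<in>S. \<integral>x. (Y i x)\<^sup>2 \<partial>P)"
      using Y(2) by (simp add: P.prob_space)
    also have "\<dots> \<le> e + (2 * B + e) / R\<^sup>2 * C"
      unfolding C_def using B0 e by (intro add_left_mono mult_left_mono sum_mono YC) auto
    finally show ?thesis by simp
  qed
  have trig: "((\<lambda>n. \<integral>x. g (\<lambda>i. X n i x) \<partial>M n) \<longlongrightarrow> (\<integral>y. g (\<lambda>i. Z i y) \<partial>N)) F" if "trig_poly S g" for g
    using that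
  proof (induction rule: trig_poly.induct)
    case (cos c a b)
    show ?case using tendsto_mult[OF tendsto_const[of c] assms(6)[OF S, of a b]] by simp
  next
    case (add g h)
    have int: "integrable P (\<lambda>x. k (\<lambda>i. Y i x))" if P: "prob_space P" and Y: "\<And>i. Y i \<in> borel_measurable P" and k: "trig_poly S k"
      for P :: "'c measure" and Y :: "'i \<Rightarrow> 'c \<Rightarrow> real" and k
    proof -
      interpret P: prob_space P by fact
      obtain D where D: "\<And>x. \<bar>k x\<bar> \<le> D" using trig_poly_bounded[OF k] by blast
      have mY: "(\<lambda>x i. Y i x) \<in> borel_measurable P" by (intro measurable_coordinatewise_then_product Y)
      have "(\<lambda>x. k (\<lambda>i. Y i x)) \<in> borel_measurable P"
        by (rule measurable_compose[OF mY borel_measurable_continuous_onI[OF trig_poly_continuous[OF k]]])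
      then show ?thesis by (rule P.integrable_const_bound[rotated, of _ D]) (simp add: D)
    qed
    have "((\<lambda>n. (\<integral>x. g (\<lambda>i. X n i x) \<partial>M n) + (\<integral>x. h (\<lambda>i. X n i x) \<partial>M n)) \<longlongrightarrow> (\<integral>y. g (\<lambda>i. Z i y) \<partial>N) + (\<integral>y. h (\<lambda>i. Z i y) \<partial>N)) F"
      by (intro tendsto_add add.IH)
    moreover have "(\<integral>y. g (\<lambda>i. Z i y) \<partial>N) + (\<integral>y. h (\<lambda>i. Z i y) \<partial>N) = (\<integral>y. g (\<lambda>i. Z i y) + h (\<lambda>i. Z i y) \<partial>N)"
      by (intro Bochner_Integration.integral_add[symmetric] int N Z(1) add.hyps)
    moreover have "\<forall>\<^sub>F n in F. (\<integral>x. g (\<lambda>i. X n i x) \<partial>M n) + (\<integral>x. h (\<lambda>i. X n i x) \<partial>M n) = (\<integral>x. g (\<lambda>i. X n i x) + h (\<lambda>i. X n i x) \<partial>M n)"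
      using M
    proof eventually_elim
      case (elim n)
      then show ?case by (intro Bochner_Integration.integral_add[symmetric] int add.hyps) auto
    qed
    ultimately show ?case using Lim_transform_eventually by force
  qed
  have main: "((\<lambda>n. \<integral>x. f' (\<lambda>i. X n i x) \<partial>M n) \<longlongrightarrow> (\<integral>y. f' (\<lambda>i. Z i y) \<partial>N)) F"
  proof (rule tendstoI)
    fix \<epsilon> :: real assume \<epsilon>: "\<epsilon> > 0"
    define e where "e = \<epsilon> / 6"
    have e: "e > 0" using \<epsilon> by (simp add: e_def)
    \<comment> \<open>The radius brings the tail term down to \<open>e\<close>, so each
      approximation costs at most \<open>2 * e\<close>, a third of \<open>\<epsilon>\<close>;
      \<open>C + 1\<close> keeps the radius positive when \<open>C\<close> is 0.\<close>
    define R where "R = sqrt ((2 * B + e) * (C + 1) / e)"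
    have pos: "(2 * B + e) * (C + 1) / e > 0" using B0 C0 e by (intro divide_pos_pos mult_pos_pos) auto
    have R: "R > 0" using pos by (simp add: R_def)
    have "(2 * B + e) * C / R\<^sup>2 \<le> e"
    proof -
      have R2: "R\<^sup>2 = (2 * B + e) * (C + 1) / e" using pos by (simp add: R_def)
      have "(2 * B + e) * C \<le> e * R\<^sup>2" unfolding R2 using B0 e by simp
      then show ?thesis using R by (simp add: pos_divide_le_eq)
    qed
    then have small: "e + (2 * B + e) * C / R\<^sup>2 \<le> \<epsilon> / 3" by (simp add: e_def)
    obtain g where g: "trig_poly S g" "\<And>x. \<bar>g x\<bar> \<le> B + e" "\<And>x. (\<forall>i\<in>S. \<bar>x i\<bar> \<le> R) \<Longrightarrow> \<bar>f' x - g x\<bar> \<le> e"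
      using trig_poly_approx[OF S cont B local e R] by blast
    have aN: "\<bar>(\<integral>y. f' (\<lambda>i. Z i y) \<partial>N) - (\<integral>y. g (\<lambda>i. Z i y) \<partial>N)\<bar> \<le> \<epsilon> / 3"
    proof -
      have "\<bar>(\<integral>y. f' (\<lambda>i. Z i y) \<partial>N) - (\<integral>y. g (\<lambda>i. Z i y) \<partial>N)\<bar> \<le> e + (2 * B + e) * C / R\<^sup>2"
        by (intro approx N Z g e R) auto
      then show ?thesis using small by linarith
    qed
    have "\<forall>\<^sub>F n in F. dist (\<integral>x. g (\<lambda>i. X n i x) \<partial>M n) (\<integral>y. g (\<lambda>i. Z i y) \<partial>N) < \<epsilon> / 3"
      using \<epsilon> by (intro tendstoD[OF trig[OF g(1)]]) simp
    moreover have "\<forall>\<^sub>F n in F. \<forall>i\<in>S. (\<integral>x. (X n i x)\<^sup>2 \<partial>M n) \<le> C1 i"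
      using C1 by (intro eventually_ball_finite S) auto
    ultimately show "\<forall>\<^sub>F n in F. dist (\<integral>x. f' (\<lambda>i. X n i x) \<partial>M n) (\<integral>y. f' (\<lambda>i. Z i y) \<partial>N) < \<epsilon>"
      using M
    proof eventually_elim
      case (elim n)
      have "\<bar>(\<integral>x. f' (\<lambda>i. X n i x) \<partial>M n) - (\<integral>x. g (\<lambda>i. X n i x) \<partial>M n)\<bar> \<le> e + (2 * B + e) * C / R\<^sup>2"
        using elim by (intro approx g e R) (auto simp: le_max_iff_disj)
      then show ?case using aN small elim(1) unfolding dist_real_def by linarith
    qed
  qed
  then show "((\<lambda>n. \<integral>x. f (\<lambda>i\<in>S. X n i x) \<partial>M n) \<longlongrightarrow> (\<integral>y. f (\<lambda>i\<in>S. Z i y) \<partial>N)) F"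
    by (simp add: f'_def)
qed

section \<open>Conditioned Galton--Watson trees\<close>

context critical_offspring
begin

text \<open>A bridge of positive probability has sum \<open>n - 1\<close>, and the support makes
  this sum a multiple of the span. For \<open>n = 0\<close> the truncated difference is 0 and
  divisibility is trivial.\<close>

lemma admissible_at_top_le: "admissible_at_top p \<le> lattice_at_top"
  unfolding admissible_at_top_def lattice_at_top_def
proof (rule inf_mono)
  have "period dvd n - 1" if pos: "measure (gw_law p) (order_event n) > 0" for n
  proof (cases "n = 0")
    case False
    then have "bridge_prob p n > 0" using pos by (simp add: measure_order_event_eq[symmetric])
    from bridge_prob_pos_imp_nonempty[OF this]
    obtain xs where xs: "xs \<in> set_pmf (replicate_pmf n p)" "xs \<in> bridges n" by blast
    then have "sum_list xs = n - 1" by (auto simp: bridges_def)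
    then show ?thesis using period_dvd_sum_list[OF xs(1)] by simp
  qed simp
  then show "principal {n. measure (gw_law p) (order_event n) > 0} \<le> principal {n. period dvd n - 1}" by auto
qed simp

lemma eventually_admissible:
  "\<forall>\<^sub>F n in admissible_at_top p. measure (gw_law p) (order_event n) > 0 \<and> n \<ge> 1 \<and> bridge_prob p n > 0"
proof -
  have "measure (gw_law p) (order_event n) > 0 \<and> n \<ge> 1 \<and> bridge_prob p n > 0"
    if "n \<ge> 1" "measure (gw_law p) (order_event n) > 0" for n
    using that by (simp add: measure_order_event_eq[symmetric])
  then show ?thesis
    unfolding admissible_at_top_def eventually_inf_principal
    by (intro eventually_mono[OF eventually_ge_at_top[of 1]]) auto
qed

end

text \<open>The law lives on the finitely many trees of order \<open>n\<close>, where every function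
  is bounded.\<close>

lemma integrable_cond_gw_law:
  fixes G :: "plane_tree \<Rightarrow> real"
  assumes pos: "measure (gw_law p) (order_event n) > 0"
  shows "integrable (cond_gw_law p n) G"
proof -
  interpret prob_space "cond_gw_law p n" by (rule prob_space_cond_gw_law[OF pos])
  have AE: "AE t in cond_gw_law p n. tree_order t = n"
    unfolding cond_gw_law_def
  proof (subst AE_distr_iff)
    show "AE x in uniform_measure (gw_law p) (order_event n). tree_order (the x) = n"
      by (rule AE_uniform_measureI) (auto simp: order_event_def)
  qed (auto simp: measurable_def)
  have "\<bar>G t\<bar> \<le> (\<Sum>t | tree_order t = n. \<bar>G t\<bar>)" if "tree_order t = n" for t
    using that finite_trees_of_order by (intro member_le_sum) auto
  then show ?thesis
    by (intro integrable_const_bound[of _ "\<Sum>t | tree_order t = n. \<bar>G t\<bar>"])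
      (use AE in \<open>auto simp: cond_gw_law_def measurable_def elim!: eventually_mono\<close>)
qed

context tree_statistic
begin

lemma expectation_cond_W:
  fixes h :: "real \<Rightarrow> real"
  assumes pos: "measure (gw_law p) (order_event n) > 0" "bridge_prob p n > 0"
  shows "(\<integral>t. h (\<Sum>T\<in>S. a T * (real (subtree_count T t) - real n * tree_prob p T)) \<partial>cond_gw_law p n) =
    measure_pmf.expectation (bridge_pmf p n) (\<lambda>xs. h (W xs))"
proof -
  have "(\<integral>t. h (\<Sum>T\<in>S. a T * (real (subtree_count T t) - real n * tree_prob p T)) \<partial>cond_gw_law p n) =
     measure_pmf.expectation (bridge_pmf p n) (\<lambda>xs. h (\<Sum>T\<in>S. a T * (real (cyclic_occ (degree_seq T) xs) - real n * tree_prob p T)))"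
    by (rule expectation_cond_gw_law[OF pos(1)]) (simp_all add: cyclic_occ_rotate cyclic_occ_degree_seq)
  also have "\<dots> = measure_pmf.expectation (bridge_pmf p n) (\<lambda>xs. h (W xs))"
    by (intro integral_cong_AE)
      (auto simp: AE_measure_pmf_iff W_def dev_def set_bridge_pmf_length[OF pos(2)])
  finally show ?thesis .
qed

lemma cond_W_tendsto:
  fixes h :: "nat \<Rightarrow> real \<Rightarrow> real"
  assumes "((\<lambda>n. measure_pmf.expectation (bridge_pmf p n) (\<lambda>xs. h n (W xs))) \<longlongrightarrow> l) lattice_at_top"
  shows "((\<lambda>n. \<integral>t. h n (\<Sum>T\<in>S. a T * (real (subtree_count T t) - real n * tree_prob p T)) \<partial>cond_gw_law p n) \<longlongrightarrow> l) (admissible_at_top p)"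
proof (rule Lim_transform_eventually)
  show "((\<lambda>n. measure_pmf.expectation (bridge_pmf p n) (\<lambda>xs. h n (W xs))) \<longlongrightarrow> l) (admissible_at_top p)"
    by (rule tendsto_mono[OF admissible_at_top_le assms])
  show "\<forall>\<^sub>F n in admissible_at_top p. measure_pmf.expectation (bridge_pmf p n) (\<lambda>xs. h n (W xs)) =
     (\<integral>t. h n (\<Sum>T\<in>S. a T * (real (subtree_count T t) - real n * tree_prob p T)) \<partial>cond_gw_law p n)"
    using eventually_admissible by eventually_elim (simp add: expectation_cond_W)
qed

lemma expectation_cos_W_tendsto:
  "((\<lambda>n. measure_pmf.expectation (bridge_pmf p n) (\<lambda>xs. cos (W xs / sqrt n + b))) \<longlongrightarrow> cos b * exp (- v / 2)) lattice_at_top"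
proof -
  have eq: "measure_pmf.expectation (bridge_pmf p n) (\<lambda>xs. cos (W xs / sqrt n + b)) =
     Re (iexp b * measure_pmf.expectation (bridge_pmf p n) (\<lambda>xs. iexp (1 * (W xs / sqrt n))))" for n
  proof -
    have "measure_pmf.expectation (bridge_pmf p n) (\<lambda>xs. cos (W xs / sqrt n + b)) =
       measure_pmf.expectation (bridge_pmf p n) (\<lambda>xs. Re (iexp b * iexp (1 * (W xs / sqrt n))))"
      by (simp only: iexp_mult Re_iexp mult_1)
    also have "\<dots> = Re (measure_pmf.expectation (bridge_pmf p n) (\<lambda>xs. iexp b * iexp (1 * (W xs / sqrt n))))"
      by (intro integral_Re integrable_mult_right integrable_iexp_pmf)
    finally show ?thesis by (simp only: integral_mult_right_zero)
  qed
  have "((\<lambda>n. Re (iexp b * measure_pmf.expectation (bridge_pmf p n) (\<lambda>xs. iexp (1 * (W xs / sqrt n))))) \<longlongrightarrow>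
     Re (iexp b * of_real (exp (- 1\<^sup>2 * v / 2)))) lattice_at_top"
    by (intro tendsto_Re tendsto_mult tendsto_const charfun_W_tendsto)
  moreover have "Re (iexp b * of_real (exp (- 1\<^sup>2 * v / 2))) = cos b * exp (- v / 2)" by (simp add: Re_exp)
  ultimately show ?thesis unfolding eq by (simp only:)
qed

end

section \<open>Moments and limit law of the normalised counts\<close>

context critical_offspring
begin

abbreviation "Y n T t \<equiv> (real (subtree_count T t) - real n * tree_prob p T) / sqrt (real n)"

abbreviation "EC n \<equiv> integral\<^sup>L (cond_gw_law p n)"

lemma tree_statistic_finite: "finite S \<Longrightarrow> tree_statistic p S"
  by unfold_locales

lemma Y_lincomb: "(\<Sum>T\<in>S. a T * Y n T t) = (\<Sum>T\<in>S. a T * (real (subtree_count T t) - real n * tree_prob p T)) / sqrt n"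
  by (simp add: sum_divide_distrib)

lemma EC_Y_tendsto: "((\<lambda>n. EC n (Y n T)) \<longlongrightarrow> 0) (admissible_at_top p)"
proof -
  interpret tree_statistic p "{T}" "\<lambda>_. 1" by (rule tree_statistic_finite) simp
  show ?thesis using cond_W_tendsto[OF W_moments_tendsto(1)] by simp
qed

lemma EC_lincomb_square_tendsto:
  assumes "finite S"
  shows "((\<lambda>n. EC n (\<lambda>t. (\<Sum>T\<in>S. a T * Y n T t)\<^sup>2)) \<longlongrightarrow> (\<Sum>T\<in>S. \<Sum>T'\<in>S. a T * a T' * subtree_cov p T T')) (admissible_at_top p)"
proof -
  interpret tree_statistic p S a by (rule tree_statistic_finite) fact
  show ?thesis unfolding Y_lincomb using cond_W_tendsto[OF W_moments_tendsto(2)] by (simp only: v_def)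
qed

lemma EC_cos_tendsto:
  assumes "finite S"
  shows "((\<lambda>n. EC n (\<lambda>t. cos ((\<Sum>T\<in>S. a T * Y n T t) + b))) \<longlongrightarrow> cos b * exp (- (\<Sum>T\<in>S. \<Sum>T'\<in>S. a T * a T' * subtree_cov p T T') / 2)) (admissible_at_top p)"
proof -
  interpret tree_statistic p S a by (rule tree_statistic_finite) fact
  show ?thesis unfolding Y_lincomb using cond_W_tendsto[OF expectation_cos_W_tendsto] by (simp only: v_def)
qed

lemma subtree_cov_sym: "subtree_cov p T T' = subtree_cov p T' T"
  by (simp add: subtree_cov_eq \<gamma>0_def mult.commute mult.left_commute add.commute)

lemma psd_subtree_cov: "psd (subtree_cov p)"
  unfolding psd_def
proof (intro conjI allI impI)
  show "subtree_cov p T T' = subtree_cov p T' T" for T T' by (rule subtree_cov_sym)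
  fix S :: "plane_tree set" and a assume "finite S"
  then interpret tree_statistic p S a by (rule tree_statistic_finite)
  show "0 \<le> (\<Sum>i\<in>S. \<Sum>j\<in>S. a i * a j * subtree_cov p i j)" using v_nonneg by (simp only: v_def)
qed

text \<open>Polarisation: the second moments of linear combinations determine the mixed
  ones.\<close>

lemma EC_product_tendsto: "((\<lambda>n. EC n (\<lambda>t. Y n T t * Y n T' t)) \<longlongrightarrow> subtree_cov p T T') (admissible_at_top p)"
proof (cases "T = T'")
  case True
  then show ?thesis using EC_lincomb_square_tendsto[of "{T}" "\<lambda>_. 1"] by (simp add: power2_eq_square)
next
  case False
  have polarization: "x * y = ((x + y)\<^sup>2 - x\<^sup>2 - y\<^sup>2) / 2" for x y :: real
    by (simp add: power2_eq_square algebra_simps)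
  have sq: "((\<lambda>n. EC n (\<lambda>t. (Y n T t)\<^sup>2)) \<longlongrightarrow> subtree_cov p T T) (admissible_at_top p)" for T
    using EC_lincomb_square_tendsto[of "{T}" "\<lambda>_. 1"] by simp
  have sum: "((\<lambda>n. EC n (\<lambda>t. (Y n T t + Y n T' t)\<^sup>2)) \<longlongrightarrow> subtree_cov p T T + 2 * subtree_cov p T T' + subtree_cov p T' T') (admissible_at_top p)"
    using EC_lincomb_square_tendsto[of "{T, T'}" "\<lambda>_. 1"] False subtree_cov_sym[of T' T] by (simp add: algebra_simps)
  have "((\<lambda>n. (EC n (\<lambda>t. (Y n T t + Y n T' t)\<^sup>2) - EC n (\<lambda>t. (Y n T t)\<^sup>2) - EC n (\<lambda>t. (Y n T' t)\<^sup>2)) / 2) \<longlongrightarrow>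
     (subtree_cov p T T + 2 * subtree_cov p T T' + subtree_cov p T' T' - subtree_cov p T T - subtree_cov p T' T') / 2) (admissible_at_top p)"
    by (intro tendsto_divide tendsto_diff sum sq tendsto_const) simp
  moreover have "\<forall>\<^sub>F n in admissible_at_top p. (EC n (\<lambda>t. (Y n T t + Y n T' t)\<^sup>2) - EC n (\<lambda>t. (Y n T t)\<^sup>2) - EC n (\<lambda>t. (Y n T' t)\<^sup>2)) / 2 = EC n (\<lambda>t. Y n T t * Y n T' t)"
    using eventually_admissible
  proof eventually_elim
    case (elim n)
    then have i: "integrable (cond_gw_law p n) G" for G :: "plane_tree \<Rightarrow> real" by (intro integrable_cond_gw_law) simp
    have "EC n (\<lambda>t. Y n T t * Y n T' t) = EC n (\<lambda>t. ((Y n T t + Y n T' t)\<^sup>2 - (Y n T t)\<^sup>2 - (Y n T' t)\<^sup>2) / 2)"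
      by (intro Bochner_Integration.integral_cong refl polarization)
    then show ?case
      by (simp only: integral_divide_zero Bochner_Integration.integral_diff[OF i i])
  qed
  ultimately show ?thesis using Lim_transform_eventually by force
qed

text \<open>After division by sqrt n this is the convergence of the mean of the normalised count to
  0, which rests on the fourth moment bound and not on weak convergence alone.\<close>

lemma expectation_subtree_count_smallo:
  "(\<lambda>n. EC n (\<lambda>t. real (subtree_count T t)) - real n * tree_prob p T) \<in> o[admissible_at_top p](\<lambda>n. sqrt (real n))"
proof (rule smalloI_tendsto)
  have "\<forall>\<^sub>F n in admissible_at_top p. EC n (Y n T) = (EC n (\<lambda>t. real (subtree_count T t)) - real n * tree_prob p T) / sqrt (real n)"
    using eventually_admissible
  proof eventually_elim
    case (elim n)
    then have i: "integrable (cond_gw_law p n) G" for G :: "plane_tree \<Rightarrow> real" by (intro integrable_cond_gw_law) simp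
    interpret prob_space "cond_gw_law p n" using elim by (intro prob_space_cond_gw_law) simp
    show ?case by (simp add: Bochner_Integration.integral_diff[OF i i] prob_space)
  qed
  then show "((\<lambda>n. (EC n (\<lambda>t. real (subtree_count T t)) - real n * tree_prob p T) / sqrt (real n)) \<longlongrightarrow> 0) (admissible_at_top p)"
    by (rule Lim_transform_eventually[OF EC_Y_tendsto])
  show "\<forall>\<^sub>F n in admissible_at_top p. sqrt (real n) \<noteq> 0"
    using eventually_admissible by eventually_elim simp
qed

text \<open>Covariance ignores the centring and scales by \<open>n\<close>, so the claim reduces to
  the limits of the mixed moments and of the means, the latter being 0.\<close>

lemma covariance_subtree_count_smallo:
  "(\<lambda>n. covariance (cond_gw_law p n) (\<lambda>t. real (subtree_count T t)) (\<lambda>t. real (subtree_count T' t)) - real n * subtree_cov p T T')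
     \<in> o[admissible_at_top p](\<lambda>n. real n)"
proof (rule smalloI_tendsto)
  have "((\<lambda>n. EC n (\<lambda>t. Y n T t * Y n T' t) - EC n (Y n T) * EC n (Y n T') - subtree_cov p T T') \<longlongrightarrow> subtree_cov p T T' - 0 * 0 - subtree_cov p T T') (admissible_at_top p)"
    by (intro tendsto_diff tendsto_mult EC_product_tendsto EC_Y_tendsto tendsto_const)
  then have lim: "((\<lambda>n. EC n (\<lambda>t. Y n T t * Y n T' t) - EC n (Y n T) * EC n (Y n T') - subtree_cov p T T') \<longlongrightarrow> 0) (admissible_at_top p)"
    by simp
  have "\<forall>\<^sub>F n in admissible_at_top p. EC n (\<lambda>t. Y n T t * Y n T' t) - EC n (Y n T) * EC n (Y n T') - subtree_cov p T T' =
     (covariance (cond_gw_law p n) (\<lambda>t. real (subtree_count T t)) (\<lambda>t. real (subtree_count T' t)) - real n * subtree_cov p T T') / real n"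
    using eventually_admissible
  proof eventually_elim
    case (elim n)
    then have i: "integrable (cond_gw_law p n) G" for G :: "plane_tree \<Rightarrow> real" by (intro integrable_cond_gw_law) simp
    interpret prob_space "cond_gw_law p n" using elim by (intro prob_space_cond_gw_law) simp
    have normalize: "a - x * y - g = (c - n * g) / n" if "c = n * (a - y * x - x * y + x * y)" "n > 0" for a c g x y n :: real
      unfolding that(1) using that(2) by (simp add: field_simps)
    have expand: "(x - x') * (y - y') = x * y - y' * x - x' * y + x' * y'" for x x' y y' :: real
      by (simp add: algebra_simps)
    have scale: "(sqrt n * x) * (sqrt n * y) = n * (x * y)" for x y :: real
      by simp
    have Yd: "real (subtree_count T t) - EC n (\<lambda>t. real (subtree_count T t)) = sqrt n * (Y n T t - EC n (Y n T))" for T t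
    proof -
      have "EC n (Y n T) = (EC n (\<lambda>t. real (subtree_count T t)) - real n * tree_prob p T) / sqrt (real n)"
        by (simp add: Bochner_Integration.integral_diff[OF i i] prob_space)
      moreover have "x - e = s * ((x - m) / s - (e - m) / s)" if "s > 0" for x e m s :: real
        using that by (simp add: field_simps)
      ultimately show ?thesis using elim by simp
    qed
    have "covariance (cond_gw_law p n) (\<lambda>t. real (subtree_count T t)) (\<lambda>t. real (subtree_count T' t)) =
      EC n (\<lambda>t. real n * ((Y n T t - EC n (Y n T)) * (Y n T' t - EC n (Y n T'))))"
      unfolding covariance_def Yd by (intro Bochner_Integration.integral_cong refl scale)
    also have "\<dots> = real n * EC n (\<lambda>t. (Y n T t - EC n (Y n T)) * (Y n T' t - EC n (Y n T')))"
      by (rule integral_mult_right_zero)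
    also have "EC n (\<lambda>t. (Y n T t - EC n (Y n T)) * (Y n T' t - EC n (Y n T'))) =
       EC n (\<lambda>t. Y n T t * Y n T' t - EC n (Y n T') * Y n T t - EC n (Y n T) * Y n T' t + EC n (Y n T) * EC n (Y n T'))"
      by (intro Bochner_Integration.integral_cong refl expand)
    also have "\<dots> = EC n (\<lambda>t. Y n T t * Y n T' t) - EC n (Y n T') * EC n (Y n T) - EC n (Y n T) * EC n (Y n T') + EC n (Y n T) * EC n (Y n T')"
      by (simp only: Bochner_Integration.integral_add[OF i i] Bochner_Integration.integral_diff[OF i i] integral_mult_right_zero lebesgue_integral_const prob_space) simp
    finally show ?case by (rule normalize) (use elim in simp)
  qed
  then show "((\<lambda>n. (covariance (cond_gw_law p n) (\<lambda>t. real (subtree_count T t)) (\<lambda>t. real (subtree_count T' t)) - real n * subtree_cov p T T') / real n) \<longlongrightarrow> 0) (admissible_at_top p)"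
    by (rule Lim_transform_eventually[OF lim])
  show "\<forall>\<^sub>F n in admissible_at_top p. real n \<noteq> 0"
    using eventually_admissible by eventually_elim simp
qed

end

text \<open>The paths already have all orders. Infinitude lets the trees be enumerated by all
  natural numbers in \<open>gaussian_family_exists\<close>.\<close>

lemma infinite_plane_tree: "infinite (UNIV :: plane_tree set)"
proof -
  define f where "f = rec_nat (Node []) (\<lambda>_ t. Node [t])"
  have "tree_order (f n) = n + 1" for n
    by (induction n) (simp_all add: f_def tree_order_Node)
  then have "inj f" by (metis add_right_cancel injI)
  then show ?thesis by (rule infinite_super[OF subset_UNIV range_inj_infinite])
qed

theorem corollary1p8:
  fixes p :: "nat pmf"
  assumes "integrable (measure_pmf p) (\<lambda>k. (real k)\<^sup>2)"
    and "measure_pmf.expectation p real = 1"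
    and "measure_pmf.variance p real > 0"
  shows
    "(\<forall>T. (\<lambda>n. prob_space.expectation (cond_gw_law p n) (\<lambda>t. real (subtree_count T t))
              - real n * tree_prob p T)
          \<in> o[admissible_at_top p](\<lambda>n. sqrt (real n)))
   \<and> (\<forall>T. (\<lambda>n. prob_space.variance (cond_gw_law p n) (\<lambda>t. real (subtree_count T t))
              - real n * subtree_cov p T T)
          \<in> o[admissible_at_top p](\<lambda>n. real n))
   \<and> (\<forall>T1 T2. (\<lambda>n. covariance (cond_gw_law p n)
                       (\<lambda>t. real (subtree_count T1 t)) (\<lambda>t. real (subtree_count T2 t))
                   - real n * subtree_cov p T1 T2)
          \<in> o[admissible_at_top p](\<lambda>n. real n))
   \<and> (\<exists>(N :: (plane_tree \<Rightarrow> real) measure) (Z :: plane_tree \<Rightarrow> (plane_tree \<Rightarrow> real) \<Rightarrow> real).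
        prob_space N \<and> jointly_normal N Z
        \<and> (\<forall>T. prob_space.expectation N (Z T) = 0)
        \<and> (\<forall>T1 T2. covariance N (Z T1) (Z T2) = subtree_cov p T1 T2)
        \<and> joint_conv_in_distr (cond_gw_law p)
             (\<lambda>n T t. (real (subtree_count T t) - real n * tree_prob p T) / sqrt (real n))
             N Z (admissible_at_top p))"
proof -
  interpret critical_offspring p by unfold_locales (fact assms)+
  obtain N :: "(plane_tree \<Rightarrow> real) measure" and Z where N: "prob_space N" "jointly_normal N Z"
    and Z: "\<forall>i. Z i \<in> borel_measurable N \<and> integrable N (Z i) \<and> integrable N (\<lambda>\<omega>. (Z i \<omega>)\<^sup>2) \<and> (\<integral>\<omega>. Z i \<omega> \<partial>N) = 0"
    and cov: "\<forall>i j. covariance N (Z i) (Z j) = subtree_cov p i j"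
    and cosZ: "\<forall>S a b. finite S \<longrightarrow> (\<integral>\<omega>. cos ((\<Sum>i\<in>S. a i * Z i \<omega>) + b) \<partial>N) = cos b * exp (- (\<Sum>i\<in>S. \<Sum>j\<in>S. a i * a j * subtree_cov p i j) / 2)"
    using gaussian_family_exists[OF psd_subtree_cov infinite_plane_tree] by blast
  have "joint_conv_in_distr (cond_gw_law p)
             (\<lambda>n T t. (real (subtree_count T t) - real n * tree_prob p T) / sqrt (real n)) N Z (admissible_at_top p)"
  proof (rule joint_conv_of_cos)
    show "\<forall>\<^sub>F n in admissible_at_top p. prob_space (cond_gw_law p n) \<and>
        (\<forall>i. Y n i \<in> borel_measurable (cond_gw_law p n) \<and> integrable (cond_gw_law p n) (\<lambda>x. (Y n i x)\<^sup>2))"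
      using eventually_admissible
    proof eventually_elim
      case (elim n)
      have "integrable (cond_gw_law p n) G" for G :: "plane_tree \<Rightarrow> real" by (intro integrable_cond_gw_law) (use elim in simp)
      then show ?case using prob_space_cond_gw_law elim by (metis borel_measurable_integrable)
    qed
    show "\<exists>C. \<forall>\<^sub>F n in admissible_at_top p. EC n (\<lambda>x. (Y n i x)\<^sup>2) \<le> C" for i
    proof -
      \<comment> \<open>Tightness: convergent second moments are eventually below their limit plus
        1.\<close>
      have "((\<lambda>n. EC n (\<lambda>x. (Y n i x)\<^sup>2)) \<longlongrightarrow> subtree_cov p i i) (admissible_at_top p)"
        using EC_lincomb_square_tendsto[of "{i}" "\<lambda>_. 1"] by simp
      then have "\<forall>\<^sub>F n in admissible_at_top p. EC n (\<lambda>x. (Y n i x)\<^sup>2) < subtree_cov p i i + 1"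
        by (rule order_tendstoD) simp
      then show ?thesis by (intro exI[of _ "subtree_cov p i i + 1"]) (auto elim: eventually_mono)
    qed
    show "((\<lambda>n. EC n (\<lambda>x. cos ((\<Sum>i\<in>S. a i * Y n i x) + b))) \<longlongrightarrow> (\<integral>y. cos ((\<Sum>i\<in>S. a i * Z i y) + b) \<partial>N)) (admissible_at_top p)"
      if "finite S" for S a b
      using EC_cos_tendsto[OF that, of a b] cosZ that by simp
  qed (use N Z in auto)
  moreover have "(\<lambda>n. prob_space.variance (cond_gw_law p n) (\<lambda>t. real (subtree_count T t)) - real n * subtree_cov p T T)
          \<in> o[admissible_at_top p](\<lambda>n. real n)" for T
    using covariance_subtree_count_smallo[of T T] by (simp add: covariance_def power2_eq_square)
  ultimately show ?thesis
    using expectation_subtree_count_smallo covariance_subtree_count_smallo N Z cov by blast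
qed

end
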